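(* Let $\Sigma\subset Y=[-1/2,1/2]^3$ be non-empty and open with Lipschitz boundary as a subset of the flat $3$-torus, and let $Y\setminus\overline\Sigma$ be a simple Helmholtz domain. Consider the cell problem for $u\in L^2_\sharp(Y;\mathbb{C}^3)$: $$\operatorname{curl}u=0\ \text{ in }Y\setminus\overline\Sigma,\qquad \operatorname{div}u=0\ \text{ in }Y,\qquad u=0\ \text{ in }\Sigma.\tag{$*$}$$ For every $k\in\mathcal{L}_{Y\setminus\overline\Sigma}$ let $H^k$ be the unique solution of $( * )$ with geometric average $\oint H^k=e_k$. Then every solution $u$ of $( * )$ can be written as $$u=\sum_{k\in\mathcal{L}_{Y\setminus\overline\Sigma}}\alpha_kH^k$$ with constants $\alpha_k:=(\oint u)_k\in\mathbb{C}$ for $k\in\mathcal{L}_{Y\setminus\overline\Sigma}$. In particular, the dimension of the solution space of $( * )$ coincides with $|\mathcal{L}_{Y\setminus\overline\Sigma}|$.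
   Context: The flat torus $\mathbb{T}^3$ is obtained from $Y$ by identifying $y_a,y_b\in Y$ whenever $y_a-y_b\in\mathbb{Z}^3$; $\iota:Y\to\mathbb{T}^3$ is the canonical projection and $\pi:\mathbb{R}^3\to\mathbb{T}^3$ the universal covering. For $U\subset Y$ with $\iota(U)$ open, $L^2_\sharp(U;\mathbb{C}^3)=L^2(\iota(U);\mathbb{C}^3)$ and $H^1_\sharp(U)=H^1(\iota(U))$. Differential equations in subsets of $Y$ (including $Y$ itself) are understood in the distributional sense on the corresponding open subsets of $\mathbb{T}^3$; closures and boundaries are taken in $\mathbb{T}^3$. $e_1,e_2,e_3$ is the standard basis of $\mathbb{R}^3$. Simple Helmholtz domain: $U\subset Y$ with $\iota(U)$ open such that for every $u\in L^2_\sharp(U;\mathbb{C}^3)$ with $\operatorname{curl}u=0$ in $U$ there are $\Theta\in H^1_\sharp(U)$ and $c_0\in\mathbb{C}^3$ with $u=\nabla\Theta+c_0$ in $U$. $k$-loop in $U$: a continuous, piecewise continuously differentiable $\gamma:[0,1]\to\iota(U)$ with $\gamma(0)=\gamma(1)$ and $\langle\tilde\gamma(1)-\tilde\gamma(0),e_k\rangle\neq0$ for a continuous lift $\tilde\gamma:[0,1]\to\mathbb{R}^3$ ($\pi\circ\tilde\gamma=\gamma$). $\mathcal{L}_U:=\{k\in\{1,2,3\}:\text{there is a }k\text{-loop in }U\}$. Geometric average: for a simple Helmholtz domain $U$ and $u\in L^2_\sharp(U;\mathbb{C}^3)$ curl free in $U$, write $u=\nabla\Theta+c_0$ and set $(\oint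 u)_k:=\langle c_0,e_k\rangle$ if $k\in\mathcal{L}_U$ and $(\oint u)_k:=0$ otherwise (well defined). For a field on $Y$ that is curl free in $U$ and vanishes in $Y\setminus\overline U$, $\oint$ is applied to its restriction to $U$; here $U=Y\setminus\overline\Sigma$. For every $k\in\mathcal{L}_{Y\setminus\overline\Sigma}$ there is a unique solution $H^k$ of $( * )$ with $\oint H^k=e_k$. *)

theory Defs
  imports "HOL-Analysis.Analysis"
begin

section \<open>The flat torus\<close>

quotient_type torus3 = "real^3" / "\<lambda>x y. \<forall>i. x $ i - y $ i \<in> \<int>"
  morphisms torus_rep torus_proj
proof (rule equivpI)
  show "reflp (\<lambda>x y :: real^3. \<forall>i. x $ i - y $ i \<in> \<int>)"
    by (simp add: reflp_def)
  show "symp (\<lambda>x y :: real^3. \<forall>i. x $ i - y $ i \<in> \<int>)"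
  proof (rule sympI, intro allI)
    fix x y :: "real^3" and i
    assume "\<forall>i. x $ i - y $ i \<in> \<int>"
    then have "- (x $ i - y $ i) \<in> \<int>" by (blast intro: Ints_minus)
    then show "y $ i - x $ i \<in> \<int>" by simp
  qed
  show "transp (\<lambda>x y :: real^3. \<forall>i. x $ i - y $ i \<in> \<int>)"
  proof (rule transpI, intro allI)
    fix x y z :: "real^3" and i
    assume "\<forall>i. x $ i - y $ i \<in> \<int>" "\<forall>i. y $ i - z $ i \<in> \<int>"
    then have "(x $ i - y $ i) + (y $ i - z $ i) \<in> \<int>" by (blast intro: Ints_add)
    then show "x $ i - z $ i \<in> \<int>" by simp
  qed
qed

text \<open>\<^const>\<open>torus_proj\<close> is the universal covering \<open>\<pi>\<close>; its restriction to \<open>unit_cell\<close> is the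
  canonical projection \<open>\<iota>\<close>. The torus carries the quotient topology.\<close>

instantiation torus3 :: topological_space
begin

definition open_torus3 :: "torus3 set \<Rightarrow> bool"
  where "open_torus3 V \<longleftrightarrow> open (torus_proj -` V)"

instance
proof
  show "open (UNIV :: torus3 set)"
    by (simp add: open_torus3_def)
  show "open (S \<inter> T)" if "open S" "open T" for S T :: "torus3 set"
    using that by (simp add: open_torus3_def vimage_Int open_Int)
  show "open (\<Union>K)" if "\<forall>S\<in>K. open S" for K :: "torus3 set set"
    using that by (auto simp: open_torus3_def vimage_Union)
qed

end

definition unit_cell :: "(real^3) set"
  where "unit_cell = {x. \<forall>i. \<bar>x $ i\<bar> \<le> 1/2}"

definition torus_measure :: "torus3 measure"
  where "torus_measure = distr (restrict_space lborel unit_cell) borel torus_proj"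

lemma torus_proj_eq_iff: "torus_proj x = torus_proj y \<longleftrightarrow> (\<forall>i. x $ i - y $ i \<in> \<int>)"
  by (simp add: torus3.abs_eq_iff)

lemma continuous_on_torus_proj: "continuous_on UNIV torus_proj"
  by (simp add: continuous_on_open_vimage open_torus3_def)

lemma measurable_torus_proj: "torus_proj \<in> restrict_space lborel unit_cell \<rightarrow>\<^sub>M borel"
  using borel_measurable_continuous_onI[OF continuous_on_torus_proj]
  by (simp add: measurable_restrict_space1)

definition lipschitz_boundary :: "torus3 set \<Rightarrow> bool"
  \<comment> \<open>Near every boundary point, in suitable orthonormal coordinates \<open>y = T (z - x)\<close> on a cylinder,
    the set is the region strictly below the graph of a Lipschitz function.\<close>
  where "lipschitz_boundary V \<longleftrightarrow>
    (\<forall>x. torus_proj x \<in> frontier V \<longrightarrow>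
      (\<exists>(T :: real^3 \<Rightarrow> real^3) (g :: real \<times> real \<Rightarrow> real) C r h.
        orthogonal_transformation T \<and> C-lipschitz_on UNIV g \<and> 0 < r \<and> 0 < h \<and>
        (\<forall>w. norm w < r \<longrightarrow> \<bar>g w\<bar> < h) \<and>
        (\<forall>z. let y = T (z - x) in
          norm (y $ 1, y $ 2) < r \<and> \<bar>y $ 3\<bar> < h \<longrightarrow>
          (torus_proj z \<in> V \<longleftrightarrow> y $ 3 < g (y $ 1, y $ 2)))))"

section \<open>Function spaces and distributional derivatives\<close>

text \<open>For \<open>U \<subseteq> unit_cell\<close>, functions on \<open>U\<close> are functions on the torus, considered on the set
  \<open>torus_proj ` U\<close> only. Elements of Lebesgue and Sobolev spaces are represented by Borel functions;
  identities between them are understood almost everywhere.\<close>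

definition L2_space :: "torus3 set \<Rightarrow> (torus3 \<Rightarrow> 'b::euclidean_space) set"
  where "L2_space V = {u. set_borel_measurable torus_measure V u \<and>
    set_integrable torus_measure V (\<lambda>p. (norm (u p))\<^sup>2)}"

definition partial_deriv :: "3 \<Rightarrow> (real^3 \<Rightarrow> real) \<Rightarrow> real^3 \<Rightarrow> real"
  where "partial_deriv i f x = frechet_derivative f (at x) (axis i 1)"

definition smooth :: "(real^3 \<Rightarrow> real) \<Rightarrow> bool"
  where "smooth f \<longleftrightarrow> (\<forall>is. foldr partial_deriv is f differentiable_on UNIV)"

definition test_functions :: "torus3 set \<Rightarrow> (torus3 \<Rightarrow> real) set"
  \<comment> \<open>The support, being closed in the compact torus, is automatically compact.\<close>
  where "test_functions V = {\<phi>. smooth (\<phi> \<circ> torus_proj) \<and> closure {p. \<phi> p \<noteq> 0} \<subseteq> V}"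

definition torus_deriv :: "3 \<Rightarrow> (torus3 \<Rightarrow> real) \<Rightarrow> torus3 \<Rightarrow> real"
  where "torus_deriv i \<phi> p = partial_deriv i (\<phi> \<circ> torus_proj) (torus_rep p)"

lemma torus_deriv_torus_proj:
  "torus_deriv i \<phi> (torus_proj x) = partial_deriv i (\<phi> \<circ> torus_proj) x"
proof -
  define z where "z = torus_rep (torus_proj x) - x"
  have "torus_proj (torus_rep (torus_proj x)) = torus_proj x"
    by (rule Quotient3_abs_rep[OF Quotient3_torus3])
  then have z: "torus_proj (y + z) = torus_proj y" for y
    by (simp add: torus_proj_eq_iff z_def)
  have shift: "((\<phi> \<circ> torus_proj) has_derivative D) (at (x + z)) \<longleftrightarrow>
      ((\<phi> \<circ> torus_proj) has_derivative D) (at x)" for D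
  proof -
    have "((\<phi> \<circ> torus_proj) has_derivative D) (at (x + z)) \<longleftrightarrow>
        (((\<phi> \<circ> torus_proj) \<circ> (\<lambda>y. y + z)) has_derivative D) (at x)"
      by (simp add: has_derivative_at o_def LIM_offset_zero_iff algebra_simps)
    also have "(\<phi> \<circ> torus_proj) \<circ> (\<lambda>y. y + z) = \<phi> \<circ> torus_proj"
      by (auto simp: fun_eq_iff z)
    finally show ?thesis .
  qed
  show ?thesis
    using shift by (simp add: torus_deriv_def partial_deriv_def frechet_derivative_def z_def)
qed

definition weak_curl_free :: "torus3 set \<Rightarrow> (torus3 \<Rightarrow> complex^3) \<Rightarrow> bool"
  where "weak_curl_free V u \<longleftrightarrow> (\<forall>\<phi> \<in> test_functions V.
    (LINT p:V|torus_measure. torus_deriv 2 \<phi> p *\<^sub>R (u p $ 3) - torus_deriv 3 \<phi> p *\<^sub>R (u p $ 2)) = 0 \<and>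
    (LINT p:V|torus_measure. torus_deriv 3 \<phi> p *\<^sub>R (u p $ 1) - torus_deriv 1 \<phi> p *\<^sub>R (u p $ 3)) = 0 \<and>
    (LINT p:V|torus_measure. torus_deriv 1 \<phi> p *\<^sub>R (u p $ 2) - torus_deriv 2 \<phi> p *\<^sub>R (u p $ 1)) = 0)"

definition weak_div_free :: "torus3 set \<Rightarrow> (torus3 \<Rightarrow> complex^3) \<Rightarrow> bool"
  where "weak_div_free V u \<longleftrightarrow> (\<forall>\<phi> \<in> test_functions V.
    (LINT p:V|torus_measure. (\<Sum>i\<in>UNIV. torus_deriv i \<phi> p *\<^sub>R (u p $ i))) = 0)"

definition has_L2_gradient ::
    "torus3 set \<Rightarrow> (torus3 \<Rightarrow> complex) \<Rightarrow> (torus3 \<Rightarrow> complex^3) \<Rightarrow> bool"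
  where "has_L2_gradient V \<Theta> g \<longleftrightarrow> g \<in> L2_space V \<and> (\<forall>\<phi> \<in> test_functions V. \<forall>i.
    (LINT p:V|torus_measure. torus_deriv i \<phi> p *\<^sub>R \<Theta> p) =
    - (LINT p:V|torus_measure. \<phi> p *\<^sub>R (g p $ i)))"

definition H1_space :: "torus3 set \<Rightarrow> (torus3 \<Rightarrow> complex) set"
  where "H1_space V = {\<Theta> \<in> L2_space V. \<exists>g. has_L2_gradient V \<Theta> g}"

section \<open>Helmholtz domains, loops and the geometric average\<close>

definition is_decomposition ::
    "(real^3) set \<Rightarrow> (torus3 \<Rightarrow> complex^3) \<Rightarrow> (torus3 \<Rightarrow> complex) \<Rightarrow> complex^3 \<Rightarrow> bool"
  \<comment> \<open>\<open>u = \<nabla>\<Theta> + c\<^sub>0\<close> in \<open>U\<close> with \<open>\<Theta>\<close> of class \<open>H\<^sup>1\<close>\<close>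
  where "is_decomposition U u \<Theta> c\<^sub>0 \<longleftrightarrow> \<Theta> \<in> H1_space (torus_proj ` U) \<and>
    (\<exists>g. has_L2_gradient (torus_proj ` U) \<Theta> g \<and>
      (AE p in torus_measure. p \<in> torus_proj ` U \<longrightarrow> u p = g p + c\<^sub>0))"

definition simple_Helmholtz_domain :: "(real^3) set \<Rightarrow> bool"
  where "simple_Helmholtz_domain U \<longleftrightarrow> U \<subseteq> unit_cell \<and> open (torus_proj ` U) \<and>
    (\<forall>u \<in> L2_space (torus_proj ` U). weak_curl_free (torus_proj ` U) u \<longrightarrow>
      (\<exists>\<Theta> c\<^sub>0. is_decomposition U u \<Theta> c\<^sub>0))"

definition is_loop :: "3 \<Rightarrow> (real^3) set \<Rightarrow> (real \<Rightarrow> torus3) \<Rightarrow> bool"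
  \<comment> \<open>Since \<open>torus_proj\<close> is a local diffeomorphism, \<open>\<gamma>\<close> is piecewise \<open>C\<^sup>1\<close> iff its lift is.\<close>
  where "is_loop k U \<gamma> \<longleftrightarrow> path \<gamma> \<and> path_image \<gamma> \<subseteq> torus_proj ` U \<and> \<gamma> 0 = \<gamma> 1 \<and>
    (\<exists>\<gamma>' :: real \<Rightarrow> real^3. continuous_on {0..1} \<gamma>' \<and> \<gamma>' piecewise_C1_differentiable_on {0..1} \<and>
      (\<forall>t\<in>{0..1}. torus_proj (\<gamma>' t) = \<gamma> t) \<and> (\<gamma>' 1 - \<gamma>' 0) \<bullet> axis k 1 \<noteq> 0)"

definition loop_directions :: "(real^3) set \<Rightarrow> 3 set"
  where "loop_directions U = {k. \<exists>\<gamma>. is_loop k U \<gamma>}"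

definition has_geometric_average ::
    "(real^3) set \<Rightarrow> (torus3 \<Rightarrow> complex^3) \<Rightarrow> complex^3 \<Rightarrow> bool"
  \<comment> \<open>\<open>a\<close> is the value of the geometric average of \<open>u\<close>: some decomposition of \<open>u\<close> exists, and every
    decomposition gives the value \<open>a\<close>. Independence of the decomposition has to be part of the
    notion: in a thin tube around the diagonal loop \<open>t \<mapsto> (t, t, 0)\<close> both 1 and 2 are loop directions,
    but \<open>c\<^sub>0 = (1, -1, 0)\<close> is a gradient.\<close>
  where "has_geometric_average U u a \<longleftrightarrow>
    (\<exists>\<Theta> c\<^sub>0. is_decomposition U u \<Theta> c\<^sub>0) \<and>
    (\<forall>\<Theta> c\<^sub>0. is_decomposition U u \<Theta> c\<^sub>0 \<longrightarrow>
      a = (\<chi> k. if k \<in> loop_directions U then c\<^sub>0 $ k else 0))"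

section \<open>The cell problem\<close>

definition outer_cell :: "(real^3) set \<Rightarrow> (real^3) set"
  \<comment> \<open>\<open>Y\<close> without the closure of \<open>\<Sigma>\<close>, the closure being taken in the torus\<close>
  where "outer_cell \<Sigma> = {y \<in> unit_cell. torus_proj y \<notin> closure (torus_proj ` \<Sigma>)}"

definition cell_solution :: "(real^3) set \<Rightarrow> (torus3 \<Rightarrow> complex^3) \<Rightarrow> bool"
  where "cell_solution \<Sigma> u \<longleftrightarrow> u \<in> L2_space (torus_proj ` unit_cell) \<and>
    weak_curl_free (torus_proj ` outer_cell \<Sigma>) u \<and>
    weak_div_free (torus_proj ` unit_cell) u \<and>
    (AE p in torus_measure. p \<in> torus_proj ` \<Sigma> \<longrightarrow> u p = 0)"

definition unique_cell_solution ::
    "(real^3) set \<Rightarrow> complex^3 \<Rightarrow> (torus3 \<Rightarrow> complex^3) \<Rightarrow> bool"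
  where "unique_cell_solution \<Sigma> a u \<longleftrightarrow>
    cell_solution \<Sigma> u \<and> has_geometric_average (outer_cell \<Sigma>) u a \<and>
    (\<forall>v. cell_solution \<Sigma> v \<and> has_geometric_average (outer_cell \<Sigma>) v a \<longrightarrow>
      (AE p in torus_measure. v p = u p))"

section \<open>Square-integrable fields up to almost-everywhere equality as a complex vector space\<close>

lemma torus_proj_unit_cell: "torus_proj ` unit_cell = UNIV"
proof -
  have "p \<in> torus_proj ` unit_cell" for p
  proof -
    obtain x where x: "p = torus_proj x"
      by (metis Quotient3_abs_rep[OF Quotient3_torus3])
    define y :: "real^3" where "y = (\<chi> i. x $ i - of_int (round (x $ i)))"
    have "y \<in> unit_cell"
      using of_int_round_abs_le[of "x $ i" for i]
      by (auto simp: unit_cell_def y_def abs_minus_commute)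
    moreover have "torus_proj y = p"
      by (simp add: x torus_proj_eq_iff y_def)
    ultimately show ?thesis by blast
  qed
  then show ?thesis by blast
qed

lemma L2_space_UNIV:
  "(u :: torus3 \<Rightarrow> 'b::euclidean_space) \<in> L2_space UNIV \<longleftrightarrow>
    u \<in> borel_measurable torus_measure \<and> integrable torus_measure (\<lambda>p. (norm (u p))\<^sup>2)"
  by (simp add: L2_space_def set_borel_measurable_def set_integrable_def)

lemma L2_zero: "(\<lambda>p. 0) \<in> L2_space UNIV"
  by (simp add: L2_space_UNIV)

lemma norm_vector_scalar_mult: "norm (c *s (x :: complex^3)) = cmod c * norm x"
  by (simp add: norm_vec_def norm_mult L2_set_right_distrib)

lemma borel_measurable_vector_scalar_mult:
  fixes u :: "torus3 \<Rightarrow> complex^3"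
  assumes "u \<in> borel_measurable M"
  shows "(\<lambda>p. c *s u p) \<in> borel_measurable M"
proof -
  have "linear ((*s) c :: complex^3 \<Rightarrow> complex^3)"
    by (rule linearI) (auto simp: vec_eq_iff algebra_simps scaleR_conv_of_real)
  then have "continuous_on UNIV ((*s) c :: complex^3 \<Rightarrow> complex^3)"
    by (simp add: linear_continuous_on linear_conv_bounded_linear)
  then show ?thesis
    using assms borel_measurable_continuous_on by blast
qed

lemma L2_scale:
  fixes u :: "torus3 \<Rightarrow> complex^3"
  assumes "u \<in> L2_space UNIV"
  shows "(\<lambda>p. c *s u p) \<in> L2_space UNIV"
  using assms
  by (simp add: L2_space_UNIV borel_measurable_vector_scalar_mult norm_vector_scalar_mult
      power_mult_distrib)

lemma L2_add:
  fixes u v :: "torus3 \<Rightarrow> complex^3"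
  assumes "u \<in> L2_space UNIV" "v \<in> L2_space UNIV"
  shows "(\<lambda>p. u p + v p) \<in> L2_space UNIV"
proof -
  have m [measurable]: "u \<in> borel_measurable torus_measure" "v \<in> borel_measurable torus_measure"
    using assms by (auto simp: L2_space_UNIV)
  have "integrable torus_measure (\<lambda>p. (norm (u p + v p))\<^sup>2)"
  proof (rule Bochner_Integration.integrable_bound)
    show "integrable torus_measure (\<lambda>p. 2 * (norm (u p))\<^sup>2 + 2 * (norm (v p))\<^sup>2)"
      using assms by (auto simp: L2_space_UNIV)
    have "(norm (x + y))\<^sup>2 \<le> 2 * (norm x)\<^sup>2 + 2 * (norm y)\<^sup>2" for x y :: "complex^3"
    proof -
      have "(norm (x + y))\<^sup>2 \<le> (norm x + norm y)\<^sup>2"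
        by (simp add: norm_triangle_ineq)
      also have "\<dots> \<le> 2 * (norm x)\<^sup>2 + 2 * (norm y)\<^sup>2"
        using zero_le_power2[of "norm x - norm y"] by (simp add: power2_eq_square algebra_simps)
      finally show ?thesis .
    qed
    then show "AE p in torus_measure.
        norm ((norm (u p + v p))\<^sup>2) \<le> norm (2 * (norm (u p))\<^sup>2 + 2 * (norm (v p))\<^sup>2)"
      by simp
  qed simp
  then show ?thesis by (simp add: L2_space_UNIV)
qed

quotient_type L2_field = "torus3 \<Rightarrow> complex^3" / partial:
    "\<lambda>u v. u \<in> L2_space UNIV \<and> v \<in> L2_space UNIV \<and> (AE p in torus_measure. u p = v p)"
  morphisms L2_rep L2_class
proof (rule part_equivpI)
  show "\<exists>u :: torus3 \<Rightarrow> complex^3.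
      u \<in> L2_space UNIV \<and> u \<in> L2_space UNIV \<and> (AE p in torus_measure. u p = u p)"
    using L2_zero by auto
  show "symp (\<lambda>u v :: torus3 \<Rightarrow> complex^3.
      u \<in> L2_space UNIV \<and> v \<in> L2_space UNIV \<and> (AE p in torus_measure. u p = v p))"
    by (auto intro!: sympI elim: AE_mp)
  show "transp (\<lambda>u v :: torus3 \<Rightarrow> complex^3.
      u \<in> L2_space UNIV \<and> v \<in> L2_space UNIV \<and> (AE p in torus_measure. u p = v p))"
    by (auto intro!: transpI)
qed

lift_definition scale_L2 :: "complex \<Rightarrow> L2_field \<Rightarrow> L2_field"
  is "\<lambda>c u p. c *s u p"
  by (auto simp: L2_scale)

instantiation L2_field :: ab_group_add
begin

lift_definition zero_L2_field :: L2_field is "\<lambda>p. 0"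
  by (simp add: L2_zero)

lift_definition plus_L2_field :: "L2_field \<Rightarrow> L2_field \<Rightarrow> L2_field" is "\<lambda>u v p. u p + v p"
  by (auto simp: L2_add)

lift_definition uminus_L2_field :: "L2_field \<Rightarrow> L2_field" is "\<lambda>u p. - u p"
  by (auto simp: L2_space_UNIV)

definition minus_L2_field :: "L2_field \<Rightarrow> L2_field \<Rightarrow> L2_field"
  where "minus_L2_field u v = u + - v"

instance
proof
  fix a b c :: L2_field
  show "a + b + c = a + (b + c)"
    by transfer (auto simp: L2_add add.assoc)
  show "a + b = b + a"
    by transfer (auto simp: L2_add add.commute)
  show "0 + a = a"
    by transfer auto
  show "- a + a = 0"
    by transfer (auto simp: L2_zero)
  show "a - b = a + - b"
    by (rule minus_L2_field_def)
qed

end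

global_interpretation L2: vector_space scale_L2
proof
  fix a b :: complex and x y :: L2_field
  show "scale_L2 a (x + y) = scale_L2 a x + scale_L2 a y"
    by transfer (auto simp: L2_add L2_scale vector_add_ldistrib)
  show "scale_L2 (a + b) x = scale_L2 a x + scale_L2 b x"
    by transfer (auto simp: L2_add L2_scale vector_sadd_rdistrib)
  show "scale_L2 a (scale_L2 b x) = scale_L2 (a * b) x"
    by transfer (auto simp: L2_scale vector_smult_assoc)
  show "scale_L2 1 x = x"
    by transfer auto
qed

definition solution_space :: "(real^3) set \<Rightarrow> L2_field set"
  where "solution_space \<Sigma> = L2_class ` {u. cell_solution \<Sigma> u}"

end

theory Submission
  imports Defs
begin

text \<open>If there is a loop direction \<open>k\<close>, everything is linear algebra. Adding the difference of two
  decompositions of some field to a decomposition of \<open>H k\<close> gives another decomposition of \<open>H k\<close>, so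
  all geometric averages are well defined; and a solution \<open>v\<close> with average 0 vanishes because
  \<open>H k + v\<close> solves the problem with the same average as \<open>H k\<close>.

  Without loop directions one has to show that every solution \<open>u = \<nabla>\<Theta> + c\<^sub>0\<close> vanishes. The
  components of the lifted domain are then disjoint from their lattice translates, so that the
  coordinates, too, are potentials on the domain. It remains to show that a divergence-free
  field vanishing in \<open>\<Sigma>\<close> is orthogonal to every gradient on the complement: locally, the field
  is tested with a mollification of the potential that is shifted across the Lipschitz graph, and the
  local identities are averaged over the torus. Hence \<open>\<integral> \<bar>u\<bar>\<^sup>2 = 0\<close>.\<close>

section \<open>Integration of periodic functions\<close>

text \<open>The hypotheses supply fields \<open>H k\<close> for loop directions only. Without loop
  directions nothing is given in advance, and dimension 0 has to be earned by analysis; this case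
  occupies most of the development. The obstacle is a mismatch of test functions. The divergence is
  tested with smooth functions on the whole torus, but the weak gradient of the potential is known
  only for test functions supported away from the closed obstacle. A centred mollifier would reach
  across the boundary. Displacing the kernel outwards makes the mollified potential, at every point
  outside the obstacle, sample only the open complement; inside the obstacle the field is 0, so the
  values there are harmless. Two pairings are needed because u = \<nabla>\<Theta> +
  \<open>c\<^sub>0\<close>: one with \<Theta>, one with the coordinates, for which the constant is a
  gradient only after a periodic choice of lift. All analysis is done for real periodic functions on
  R^3 integrated over one cell; complex fields enter through their real and imaginary parts.\<close>

definition lattice :: "(real^3) set"
  where "lattice = {m. \<forall>i. m $ i \<in> \<int>}"

definition periodic :: "(real^3 \<Rightarrow> 'b) \<Rightarrow> bool"
  where "periodic f \<longleftrightarrow> (\<forall>x. \<forall>m\<in>lattice. f (x + m) = f x)"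

text \<open>A density rather than a restricted space: the sigma-algebra remains that of the Borel
  sets of R^3, so periodic functions and their translates need no bookkeeping of domains. A real
  indicator under \<open>ennreal\<close> is the shape expected by the rules for integrals over
  densities.\<close>

definition lcell :: "(real^3) measure"
  where "lcell = density lborel (\<lambda>x. ennreal (indicator unit_cell x))"

lemma lattice_uminus: "m \<in> lattice \<Longrightarrow> - m \<in> lattice"
  by (simp add: lattice_def)

lemma lattice_add: "m \<in> lattice \<Longrightarrow> n \<in> lattice \<Longrightarrow> m + n \<in> lattice"
  by (simp add: lattice_def)

lemma lattice_diff: "m \<in> lattice \<Longrightarrow> n \<in> lattice \<Longrightarrow> m - n \<in> lattice"
  by (simp add: lattice_def)

lemma torus_proj_eq_lattice: "torus_proj x = torus_proj y \<longleftrightarrow> x - y \<in> lattice"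
  by (simp add: torus_proj_eq_iff lattice_def)

lemma torus_proj_add_lattice: "m \<in> lattice \<Longrightarrow> torus_proj (x + m) = torus_proj x"
  by (simp add: torus_proj_eq_lattice)

lemma periodic_torus_proj: "periodic (\<lambda>x. f (torus_proj x))"
  by (simp add: periodic_def torus_proj_add_lattice)

lemma countable_lattice: "countable lattice"
proof -
  have "lattice \<subseteq> (\<lambda>f :: 3 \<Rightarrow> int. \<chi> i. of_int (f i)) ` UNIV"
  proof
    fix m assume "m \<in> lattice"
    then have "\<forall>i. \<exists>k. m $ i = of_int k"
      by (auto simp: lattice_def elim: Ints_cases)
    then obtain f where "\<forall>i. m $ i = of_int (f i)" by metis
    then have "m = (\<chi> i. of_int (f i))" by (simp add: vec_eq_iff)
    then show "m \<in> (\<lambda>f :: 3 \<Rightarrow> int. \<chi> i. of_int (f i)) ` UNIV" by blast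
  qed
  then show ?thesis by (rule countable_subset) simp
qed

lemma unit_cell_cbox: "unit_cell = cbox (\<chi> i. - (1/2)) (\<chi> i. 1/2)"
proof -
  have "\<bar>t\<bar> \<le> 1/2 \<longleftrightarrow> - (1/2) \<le> t \<and> t \<le> 1/2" for t :: real by (auto simp: abs_le_iff)
  then show ?thesis by (simp add: unit_cell_def set_eq_iff mem_box_cart)
qed

lemma compact_unit_cell: "compact unit_cell"
  by (simp add: unit_cell_cbox)

lemma unit_cell_borel [measurable]: "unit_cell \<in> sets borel"
  by (simp add: unit_cell_cbox)

text \<open>Translates of the closed cell share faces. Dropping the upper faces makes the tiling
  exact at every point, as the cutting argument for translation invariance requires.\<close>

definition half_open_cell :: "(real^3) set"
  where "half_open_cell = {x. \<forall>i. - (1/2) \<le> x $ i \<and> x $ i < 1/2}"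

lemma half_open_cell_borel [measurable]: "half_open_cell \<in> sets borel"
  unfolding half_open_cell_def by measurable

lemma AE_frontier_unit_cell: "AE x in lborel. x \<notin> frontier unit_cell"
proof -
  have "negligible (frontier unit_cell)"
    unfolding unit_cell_cbox by (rule negligible_convex_frontier) (rule convex_box(1))
  moreover have "frontier unit_cell \<in> sets borel"
    by (intro borel_closed frontier_closed)
  ultimately have "frontier unit_cell \<in> null_sets lborel"
    by (simp add: negligible_iff_null_sets null_sets_completion_iff)
  then show ?thesis by (rule AE_not_in)
qed

lemma AE_half_open_cell: "AE x in lborel. x \<in> half_open_cell \<longleftrightarrow> x \<in> unit_cell"
proof -
  have "x \<in> half_open_cell \<longleftrightarrow> x \<in> unit_cell" if "x \<notin> frontier unit_cell" for x
  proof
    assume "x \<in> unit_cell"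
    then have "x \<in> box (\<chi> i. - (1/2)) (\<chi> i. 1/2)"
      using that by (simp add: unit_cell_cbox frontier_cbox)
    then show "x \<in> half_open_cell" by (simp add: half_open_cell_def mem_box_cart less_imp_le)
  next
    assume "x \<in> half_open_cell"
    then show "x \<in> unit_cell"
      by (simp add: half_open_cell_def unit_cell_cbox mem_box_cart less_imp_le)
  qed
  then show ?thesis using AE_frontier_unit_cell by (auto elim: AE_mp)
qed

lemma half_open_cell_tiles: "\<exists>!m. m \<in> lattice \<and> x - m \<in> half_open_cell"
proof (rule ex1I)
  let ?m = "(\<chi> i. of_int \<lfloor>x $ i + 1/2\<rfloor>) :: real^3"
  have *: "- (1/2) \<le> x $ i - of_int \<lfloor>x $ i + 1/2\<rfloor> \<and> x $ i - of_int \<lfloor>x $ i + 1/2\<rfloor> < 1/2" for i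
    by linarith
  show "?m \<in> lattice \<and> x - ?m \<in> half_open_cell"
    using * by (simp add: lattice_def half_open_cell_def)
  fix m assume m: "m \<in> lattice \<and> x - m \<in> half_open_cell"
  show "m = ?m"
  proof (simp add: vec_eq_iff, intro allI)
    fix i
    obtain k where k: "m $ i = of_int k" using m by (auto simp: lattice_def elim: Ints_cases)
    have "- (1/2) \<le> x $ i - of_int k" "x $ i - of_int k < 1/2"
      using m k by (simp_all add: half_open_cell_def flip: k)
    then have "\<lfloor>x $ i + 1/2\<rfloor> = k"
      by (intro floor_unique) linarith+
    then show "m $ i = of_int \<lfloor>x $ i + 1/2\<rfloor>"
      using k by simp
  qed
qed

text \<open>The exact tiling as a partition of unity. Writing the lattice sum as an integral over
  \<open>count_space\<close> makes Tonelli available for exchanging it with Lebesgue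
  integrals.\<close>

lemma nn_integral_lattice_indicator:
  "(\<integral>\<^sup>+m. indicator half_open_cell (x - m) \<partial>count_space lattice) = (1::ennreal)"
proof -
  obtain n where n: "n \<in> lattice" "x - n \<in> half_open_cell"
    "\<And>m. m \<in> lattice \<Longrightarrow> x - m \<in> half_open_cell \<Longrightarrow> m = n"
    using half_open_cell_tiles[of x] by metis
  have "indicator half_open_cell (x - m) = (indicator {n} m :: ennreal)"
    if "m \<in> lattice" for m
    using n(2) n(3)[OF that] by (cases "m = n") (auto simp: indicator_def)
  then have "(\<integral>\<^sup>+m. indicator half_open_cell (x - m) \<partial>count_space lattice)
      = (\<integral>\<^sup>+m. indicator {n} m \<partial>count_space lattice)"
    by (intro nn_integral_cong) simp
  also have "\<dots> = emeasure (count_space lattice) {n}"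
    using n(1) by (intro nn_integral_indicator) simp
  also have "\<dots> = 1" using n(1) by simp
  finally show ?thesis .
qed

lemma nn_integral_lattice_indicator':
  "(\<integral>\<^sup>+m. indicator half_open_cell (x + m) \<partial>count_space lattice) = (1::ennreal)"
proof -
  have "bij_betw uminus lattice lattice"
    by (rule bij_betwI[of _ _ _ uminus]) (auto simp: lattice_uminus)
  from nn_integral_bij_count_space[OF this, of "\<lambda>m. indicator half_open_cell (x + m)"]
  show ?thesis by (simp add: nn_integral_lattice_indicator)
qed

lemma nn_integral_lborel_shift:
  fixes f :: "real^3 \<Rightarrow> ennreal"
  assumes [measurable]: "f \<in> borel_measurable borel"
  shows "(\<integral>\<^sup>+x. f (x + w) \<partial>lborel) = (\<integral>\<^sup>+x. f x \<partial>lborel)"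
proof -
  have "(\<integral>\<^sup>+x. f x \<partial>lborel) = (\<integral>\<^sup>+x. f x \<partial>distr lborel borel ((+) w))"
    by (simp add: lborel_distr_plus)
  also have "\<dots> = (\<integral>\<^sup>+x. f (w + x) \<partial>lborel)"
    by (subst nn_integral_distr) auto
  finally show ?thesis by (simp add: add.commute)
qed

lemma nn_integral_lcell:
  "f \<in> borel_measurable borel \<Longrightarrow>
    (\<integral>\<^sup>+x. f x \<partial>lcell) = (\<integral>\<^sup>+x. f x * indicator half_open_cell x \<partial>lborel)"
  unfolding lcell_def
  apply (subst nn_integral_density)
    apply simp_all
  apply (rule nn_integral_cong_AE)
  using AE_half_open_cell by eventually_elim (auto simp: indicator_def)

text \<open>Two fundamental domains of the lattice give a periodic function the same integral: the
  shifted cell is cut along the tiling, each piece is moved back by its lattice vector, and the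
  pieces reassemble to the standard cell.\<close>

lemma nn_integral_cell_shift:
  fixes f :: "real^3 \<Rightarrow> ennreal"
  assumes [measurable]: "f \<in> borel_measurable borel" and p: "periodic f"
  shows "(\<integral>\<^sup>+x. f (x + w) \<partial>lcell) = (\<integral>\<^sup>+x. f x \<partial>lcell)"
proof -
  let ?I = "indicator half_open_cell :: real^3 \<Rightarrow> ennreal"
  have "(\<integral>\<^sup>+x. f (x + w) \<partial>lcell) = (\<integral>\<^sup>+x. f (x + w) * ?I x \<partial>lborel)"
    by (simp add: nn_integral_lcell)
  also have "\<dots> = (\<integral>\<^sup>+x. f x * ?I (x - w) \<partial>lborel)"
    using nn_integral_lborel_shift[of "\<lambda>x. f x * ?I (x - w)" w] by simp
  \<comment> \<open>The inserted inner sum is 1; it cuts the shifted cell into pieces indexed by the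
    tiles.\<close>
  also have "\<dots> = (\<integral>\<^sup>+x. \<integral>\<^sup>+m. f x * ?I (x - w) * ?I (x - m) \<partial>count_space lattice \<partial>lborel)"
    by (simp add: nn_integral_cmult nn_integral_lattice_indicator)
  also have "\<dots> = (\<integral>\<^sup>+m. \<integral>\<^sup>+x. f x * ?I (x - w) * ?I (x - m) \<partial>lborel \<partial>count_space lattice)"
    by (rule nn_integral_count_space_nn_integral) (auto simp: countable_lattice)
  also have "\<dots> = (\<integral>\<^sup>+m. \<integral>\<^sup>+x. f x * ?I (x - w + m) * ?I x \<partial>lborel \<partial>count_space lattice)"
  proof (rule nn_integral_cong)
    fix m assume m: "m \<in> space (count_space lattice)"
    have "(\<integral>\<^sup>+x. f x * ?I (x - w) * ?I (x - m) \<partial>lborel)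
        = (\<integral>\<^sup>+x. f (x + m) * ?I (x + m - w) * ?I (x + m - m) \<partial>lborel)"
      using nn_integral_lborel_shift[of "\<lambda>x. f x * ?I (x - w) * ?I (x - m)" m] by simp
    also have "\<dots> = (\<integral>\<^sup>+x. f x * ?I (x - w + m) * ?I x \<partial>lborel)"
      using m p by (simp add: periodic_def algebra_simps)
    finally show "(\<integral>\<^sup>+x. f x * ?I (x - w) * ?I (x - m) \<partial>lborel) =
        (\<integral>\<^sup>+x. f x * ?I (x - w + m) * ?I x \<partial>lborel)" .
  qed
  \<comment> \<open>Now the other indicator is summed: translates of the shifted cell tile as well,
    so only the standard cell remains.\<close>
  also have "\<dots> = (\<integral>\<^sup>+x. \<integral>\<^sup>+m. f x * ?I (x - w + m) * ?I x \<partial>count_space lattice \<partial>lborel)"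
    by (rule nn_integral_count_space_nn_integral[symmetric]) (auto simp: countable_lattice)
  also have "\<dots> = (\<integral>\<^sup>+x. f x * ?I x \<partial>lborel)"
  proof (rule nn_integral_cong)
    fix x
    have "(\<integral>\<^sup>+m. f x * ?I (x - w + m) * ?I x \<partial>count_space lattice) =
       (\<integral>\<^sup>+m. (f x * ?I x) * ?I (x - w + m) \<partial>count_space lattice)"
      by (simp add: mult_ac)
    also have "\<dots> = f x * ?I x"
      by (subst nn_integral_cmult) (auto simp: nn_integral_lattice_indicator')
    finally show "(\<integral>\<^sup>+m. f x * ?I (x - w + m) * ?I x \<partial>count_space lattice) = f x * ?I x" .
  qed
  also have "\<dots> = (\<integral>\<^sup>+x. f x \<partial>lcell)"
    by (simp add: nn_integral_lcell)
  finally show ?thesis .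
qed

lemma sets_lcell [simp, measurable_cong]: "sets lcell = sets borel"
  by (simp add: lcell_def)

lemma space_lcell [simp]: "space lcell = UNIV"
  by (simp add: lcell_def)

lemma finite_measure_lcell: "finite_measure lcell"
proof
  have "emeasure lcell UNIV = emeasure lborel unit_cell"
    by (simp add: lcell_def emeasure_density ennreal_indicator)
  then show "emeasure lcell (space lcell) \<noteq> \<infinity>"
    using emeasure_bounded_finite[OF compact_imp_bounded[OF compact_unit_cell]]
    by (simp add: top.not_eq_extremum infinity_ennreal_def)
qed

interpretation cell: finite_measure lcell
  by (rule finite_measure_lcell)

lemma integrable_cell_shift:
  fixes f :: "real^3 \<Rightarrow> real"
  assumes [measurable]: "f \<in> borel_measurable borel" and p: "periodic f"
  shows "integrable lcell (\<lambda>x. f (x + w)) \<longleftrightarrow> integrable lcell f"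
proof -
  have "periodic (\<lambda>x. ennreal (norm (f x)))" using p by (simp add: periodic_def)
  from nn_integral_cell_shift[OF _ this, of w]
  show ?thesis by (simp add: integrable_iff_bounded)
qed

lemma integral_cell_shift:
  fixes f :: "real^3 \<Rightarrow> real"
  assumes [measurable]: "f \<in> borel_measurable borel" and p: "periodic f"
  shows "(LINT x|lcell. f (x + w)) = (LINT x|lcell. f x)"
proof (cases "integrable lcell f")
  case True
  have "periodic (\<lambda>x. ennreal (f x))" "periodic (\<lambda>x. ennreal (- f x))"
    using p by (simp_all add: periodic_def)
  note * = this[THEN nn_integral_cell_shift[rotated], of w]
  show ?thesis
    using True * integrable_cell_shift[OF assms, of w] by (simp add: real_lebesgue_integral_def)
next
  case False
  then show ?thesis
    using integrable_cell_shift[OF assms, of w] by (simp add: not_integrable_integral_eq)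
qed

section \<open>Transfer between the torus and the cell\<close>

lemma torus_proj_borel [measurable]: "torus_proj \<in> borel \<rightarrow>\<^sub>M borel"
  by (rule borel_measurable_continuous_onI) (rule continuous_on_torus_proj)

lemma torus_measure_eq: "torus_measure = distr lcell borel torus_proj"
proof (rule measure_eqI)
  fix A :: "torus3 set" assume "A \<in> sets torus_measure"
  then have [measurable]: "A \<in> sets borel" by (simp add: torus_measure_def)
  have "emeasure torus_measure A =
      emeasure (restrict_space lborel unit_cell) (torus_proj -` A \<inter> unit_cell)"
    unfolding torus_measure_def
    by (subst emeasure_distr[OF measurable_torus_proj]) (simp_all add: space_restrict_space)
  also have "\<dots> = emeasure lborel (torus_proj -` A \<inter> unit_cell)"
    by (subst emeasure_restrict_space) auto
  also have "\<dots> = emeasure (distr lcell borel torus_proj) A"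
    using measurable_sets[OF torus_proj_borel, of A]
    by (subst emeasure_distr) (simp_all add: lcell_def emeasure_density
        ennreal_indicator indicator_inter_arith[symmetric] Int_commute)
  finally show "emeasure torus_measure A = emeasure (distr lcell borel torus_proj) A" .
qed (simp add: torus_measure_def)

lemma integral_torus_measure:
  fixes f :: "torus3 \<Rightarrow> 'b::{banach, second_countable_topology}"
  assumes "f \<in> borel_measurable borel"
  shows "(LINT p|torus_measure. f p) = (LINT x|lcell. f (torus_proj x))"
  unfolding torus_measure_eq using assms by (intro integral_distr) simp_all

lemma integrable_torus_measure:
  fixes f :: "torus3 \<Rightarrow> 'b::{banach, second_countable_topology}"
  assumes "f \<in> borel_measurable borel"
  shows "integrable torus_measure f \<longleftrightarrow> integrable lcell (\<lambda>x. f (torus_proj x))"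
  unfolding torus_measure_eq using assms by (intro integrable_distr_eq) simp_all

lemma finite_measure_torus_measure: "finite_measure torus_measure"
  unfolding torus_measure_eq by (rule cell.finite_measure_distr) simp

interpretation torus: finite_measure torus_measure
  by (rule finite_measure_torus_measure)

lemma sets_torus_measure [simp, measurable_cong]: "sets torus_measure = sets borel"
  by (simp add: torus_measure_def)

lemma space_torus_measure [simp]: "space torus_measure = UNIV"
  by (simp add: torus_measure_def)

lemma AE_torus_measure:
  assumes "Measurable.pred borel P"
  shows "(AE p in torus_measure. P p) \<longleftrightarrow> (AE x in lcell. P (torus_proj x))"
proof -
  have "{p \<in> space borel. P p} \<in> sets borel" using assms by measurable
  then show ?thesis unfolding torus_measure_eq by (intro AE_distr_iff) simp_all
qed

section \<open>Smooth periodic functions\<close>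

text \<open>\<open>flat 0\<close> is the classical smooth function that vanishes to infinite order
  at 0. Differentiation produces the negative powers, and up to linear combinations the whole family
  is closed under it.\<close>

definition flat :: "nat \<Rightarrow> real \<Rightarrow> real"
  where "flat n y = (if y > 0 then exp (- 1 / y) / y ^ n else 0)"

lemma flat_nonneg: "0 \<le> flat n y"
  by (simp add: flat_def)

lemma has_real_derivative_flat:
  "(flat n has_real_derivative flat (n + 2) y - real n * flat (n + 1) y) (at y)"
proof -
  consider "y > 0" | "y < 0" | "y = 0" by linarith
  then show ?thesis
  proof cases
    case 1
    have "((\<lambda>y. exp (- 1 / y) / y ^ n) has_real_derivative
        (exp (- 1 / y) * (1 / y\<^sup>2) * y ^ n - exp (- 1 / y) * (real n * y ^ (n - 1)))
          / (y ^ n * y ^ n)) (at y)"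
      using 1 by (auto intro!: derivative_eq_intros simp: power2_eq_square)
    also have "(exp (- 1 / y) * (1 / y\<^sup>2) * y ^ n - exp (- 1 / y) * (real n * y ^ (n - 1)))
          / (y ^ n * y ^ n) = flat (n + 2) y - real n * flat (n + 1) y"
    proof (cases n)
      case (Suc m)
      define P where "P = y ^ m"
      have P: "P \<noteq> 0" "y ^ n = y * P" "y ^ (n - 1) = P" "y ^ (n + 1) = y * y * P"
        "y ^ (n + 2) = y * y * y * P"
        using 1 by (simp_all add: P_def Suc)
      show ?thesis unfolding flat_def P using 1 P(1)
        by (simp add: divide_simps power2_eq_square) (simp add: algebra_simps)
    qed (use 1 in \<open>simp add: flat_def power2_eq_square\<close>)
    finally have "((\<lambda>y. exp (- 1 / y) / y ^ n) has_real_derivative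
        flat (n + 2) y - real n * flat (n + 1) y) (at y)" .
    moreover have "\<forall>\<^sub>F x in nhds y. flat n x = exp (- 1 / x) / x ^ n"
      using eventually_nhds_in_open[of "{0<..}" y] 1
      by (auto elim!: eventually_mono simp: flat_def)
    ultimately show ?thesis by (simp add: DERIV_cong_ev[OF refl _ refl])
  next
    case 2
    have "\<forall>\<^sub>F x in nhds y. flat n x = 0"
      using eventually_nhds_in_open[of "{..<0}" y] 2
      by (auto elim!: eventually_mono simp: flat_def)
    then have "(flat n has_real_derivative 0) (at y) \<longleftrightarrow> ((\<lambda>_. 0) has_real_derivative (0::real)) (at y)"
      by (intro DERIV_cong_ev) auto
    then show ?thesis using 2 by (simp add: flat_def)
  next
    case 3
    \<comment> \<open>This is the difference quotient at 0 from the right, written in terms of 1/x,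
      where the exponential beats every power; \<open>Suc n\<close> contains the division by the
      increment.\<close>
    have lim: "((\<lambda>x::real. inverse x ^ Suc n / exp (inverse x)) \<longlongrightarrow> 0) (at_right 0)"
      by (rule filterlim_compose[OF tendsto_power_div_exp_0 filterlim_inverse_at_top_right])
    have "((\<lambda>h. flat n h / h) \<longlongrightarrow> 0) (at_right 0)"
      by (rule Lim_transform_eventually[OF lim])
        (auto simp: eventually_at_filter flat_def exp_minus field_simps power_inverse)
    moreover have "((\<lambda>h. flat n h / h) \<longlongrightarrow> 0) (at_left 0)"
      by (rule Lim_transform_eventually[OF tendsto_const])
        (auto simp: eventually_at_filter flat_def)
    ultimately have "((\<lambda>h. flat n h / h) \<longlongrightarrow> 0) (at 0)"
      by (simp add: filterlim_at_split)
    then show ?thesis using 3 by (simp add: DERIV_def flat_def)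
  qed
qed

text \<open>A class of smooth periodic functions that is closed under differentiation by construction, so
  that smoothness of all test functions below needs no calculus of higher derivatives.\<close>

inductive_set bump_algebra :: "(real \<Rightarrow> real) set"
  where
    const: "(\<lambda>s. c) \<in> bump_algebra"
  | cos: "(\<lambda>s. cos (2 * pi * s + a)) \<in> bump_algebra"
  | flat: "(\<lambda>s. flat n (cos (2 * pi * s + a) - \<kappa>)) \<in> bump_algebra"
  | add: "f \<in> bump_algebra \<Longrightarrow> g \<in> bump_algebra \<Longrightarrow> (\<lambda>s. f s + g s) \<in> bump_algebra"
  | mult: "f \<in> bump_algebra \<Longrightarrow> g \<in> bump_algebra \<Longrightarrow> (\<lambda>s. f s * g s) \<in> bump_algebra"

lemma bump_algebra_deriv_ex:
  "f \<in> bump_algebra \<Longrightarrow> \<exists>f'\<in>bump_algebra. \<forall>s. (f has_real_derivative f' s) (at s)"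
proof (induction rule: bump_algebra.induct)
  case (const c)
  show ?case by (rule bexI[OF _ bump_algebra.const[of 0]]) auto
next
  case (cos a)
  \<comment> \<open>A phase shift by pi/2 turns cos into -sin; thanks to the free phase in the
    constructors no separate sine is required.\<close>
  have "(\<lambda>s. 2 * pi * cos (2 * pi * s + (a + pi/2))) \<in> bump_algebra"
    by (intro bump_algebra.intros)
  moreover have "cos (2 * pi * s + (a + pi/2)) = - sin (2 * pi * s + a)" for s
    by (simp add: minus_sin_cos_eq add.assoc)
  then have "((\<lambda>s. cos (2 * pi * s + a)) has_real_derivative
      2 * pi * cos (2 * pi * s + (a + pi/2))) (at s)" for s
    by (auto intro!: derivative_eq_intros)
  ultimately show ?case by (intro bexI[where x = "\<lambda>s. 2 * pi * cos (2 * pi * s + (a + pi/2))"]) auto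
next
  case (flat n a \<kappa>)
  let ?c = "\<lambda>s. cos (2 * pi * s + a) - \<kappa>"
  let ?f' = "\<lambda>s. (flat (n + 2) (?c s) + (- real n) * flat (n + 1) (?c s)) *
    (2 * pi * cos (2 * pi * s + (a + pi/2)))"
  have "?f' \<in> bump_algebra"
    by (intro bump_algebra.intros)
  moreover have *: "cos (2 * pi * s + (a + pi/2)) = - sin (2 * pi * s + a)" for s
    by (simp add: minus_sin_cos_eq add.assoc)
  have "((\<lambda>s. flat n (?c s)) has_real_derivative ?f' s) (at s)" for s
  proof -
    have "(?c has_real_derivative 2 * pi * cos (2 * pi * s + (a + pi/2))) (at s)"
      unfolding * by (auto intro!: derivative_eq_intros)
    from DERIV_chain2[OF has_real_derivative_flat this] show ?thesis by simp
  qed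
  ultimately show ?case by (intro bexI[where x = ?f']) auto
next
  case (add f g)
  then obtain f' g' where "f' \<in> bump_algebra" "\<forall>s. (f has_real_derivative f' s) (at s)"
    "g' \<in> bump_algebra" "\<forall>s. (g has_real_derivative g' s) (at s)" by blast
  then show ?case
    by (intro bexI[of _ "\<lambda>s. f' s + g' s"] allI DERIV_add bump_algebra.add) auto
next
  case (mult f g)
  then obtain f' g' where "f' \<in> bump_algebra" "\<forall>s. (f has_real_derivative f' s) (at s)"
    "g' \<in> bump_algebra" "\<forall>s. (g has_real_derivative g' s) (at s)" by blast
  with mult.hyps show ?case
    by (intro bexI[of _ "\<lambda>s. f' s * g s + g' s * f s"] allI DERIV_mult
        bump_algebra.add bump_algebra.mult) auto
qed

lemma
  assumes "f \<in> bump_algebra"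
  shows bump_algebra_deriv: "deriv f \<in> bump_algebra"
    and bump_algebra_DERIV: "(f has_real_derivative deriv f s) (at s)"
proof -
  obtain f' where f': "f' \<in> bump_algebra" "\<And>s. (f has_real_derivative f' s) (at s)"
    using bump_algebra_deriv_ex[OF assms] by blast
  then have "deriv f = f'" by (simp add: DERIV_imp_deriv fun_eq_iff)
  with f' show "deriv f \<in> bump_algebra" "(f has_real_derivative deriv f s) (at s)" by simp_all
qed

lemma bump_algebra_continuous: "f \<in> bump_algebra \<Longrightarrow> continuous_on S f"
  by (rule DERIV_continuous_on[OF has_field_derivative_at_within[OF bump_algebra_DERIV]])

lemma bump_algebra_periodic: "f \<in> bump_algebra \<Longrightarrow> k \<in> \<int> \<Longrightarrow> f (s + k) = f s"
proof (induction arbitrary: s rule: bump_algebra.induct)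
  have *: "cos (2 * pi * (s + k) + a) = cos (2 * pi * s + a)" if k: "k \<in> \<int>" for s k a
  proof -
    obtain n where n: "k = of_int n" using Ints_cases[OF k] by metis
    have "cos (2 * pi * (s + k) + a) = cos (2 * pi * s + a + 2 * pi * of_int n)"
      by (simp add: n algebra_simps)
    also have "cos (2 * pi * s + a + 2 * pi * of_int n) = cos (2 * pi * s + a)"
      by (subst cos_add) (simp only: cos_int_2pin sin_int_2pin mult_1_right mult_zero_right diff_zero)
    finally show ?thesis .
  qed
  case (cos a) then show ?case using * by simp
  case (flat n a \<kappa>) then show ?case using * by simp
qed auto

lemma bump_algebra_bounded:
  assumes "f \<in> bump_algebra"
  obtains B where "0 \<le> B" "\<And>s. \<bar>f s\<bar> \<le> B"
proof -
  have "compact (f ` {0..1})"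
    by (intro compact_continuous_image bump_algebra_continuous assms compact_Icc)
  then have "bounded (f ` {0..1})" by (rule compact_imp_bounded)
  then obtain B where "\<forall>y\<in>f ` {0..1}. norm y \<le> B" unfolding bounded_iff by blast
  then have B: "\<bar>f s\<bar> \<le> B" if "s \<in> {0..1}" for s using that by simp
  have "\<bar>f s\<bar> \<le> B" for s
  proof -
    have "f s = f (frac s)"
      using bump_algebra_periodic[OF assms, of "of_int \<lfloor>s\<rfloor>" "frac s"] by (simp add: frac_def)
    then show ?thesis using B[of "frac s"] by (simp add: frac_lt_1 less_imp_le)
  qed
  moreover from this[of 0] have "0 \<le> B" by linarith
  ultimately show ?thesis using that by blast
qed

text \<open>One factor per coordinate: a partial derivative replaces a single factor by its
  derivative (\<open>dprod\<close>), so these products inherit closure under differentiation from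
  \<open>bump_algebra\<close>.\<close>

definition tprod :: "(3 \<Rightarrow> real \<Rightarrow> real) \<Rightarrow> real^3 \<Rightarrow> real"
  where "tprod f x = (\<Prod>j\<in>UNIV. f j (x $ j))"

lemma tprod_3: "tprod f x = f 1 (x $ 1) * (f 2 (x $ 2) * f 3 (x $ 3))"
  unfolding tprod_def UNIV_3 by simp

lemma tprod_bounded:
  assumes "\<And>j. f j \<in> bump_algebra"
  obtains B where "0 \<le> B" "\<And>x. \<bar>tprod f x\<bar> \<le> B"
proof -
  have "\<forall>j. \<exists>B. 0 \<le> B \<and> (\<forall>s. \<bar>f j s\<bar> \<le> B)"
    using bump_algebra_bounded[OF assms] by metis
  then obtain B where B: "\<And>j. 0 \<le> B j" "\<And>j s. \<bar>f j s\<bar> \<le> B j" by metis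
  show ?thesis
  proof
    show "0 \<le> (\<Prod>j\<in>UNIV. B j)" by (simp add: prod_nonneg B)
    show "\<bar>tprod f x\<bar> \<le> (\<Prod>j\<in>UNIV. B j)" for x
      unfolding tprod_def abs_prod by (intro prod_mono) (simp add: B)
  qed
qed

lemma tprod_periodic:
  assumes "\<And>j. f j \<in> bump_algebra"
  shows "periodic (tprod f)"
  using bump_algebra_periodic[OF assms] by (simp add: periodic_def tprod_def lattice_def)

abbreviation dprod :: "3 \<Rightarrow> (3 \<Rightarrow> real \<Rightarrow> real) \<Rightarrow> 3 \<Rightarrow> real \<Rightarrow> real"
  where "dprod i f \<equiv> f(i := deriv (f i))"

lemma dprod_bump_algebra:
  "(\<And>j. f j \<in> bump_algebra) \<Longrightarrow> dprod i f j \<in> bump_algebra"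
  by (simp add: bump_algebra_deriv)

lemma has_derivative_tprod:
  assumes "\<And>j. f j \<in> bump_algebra"
  shows "(tprod f has_derivative (\<lambda>h. \<Sum>i\<in>UNIV. tprod (dprod i f) x * h $ i)) (at x within S)"
proof -
  have *: "((\<lambda>x::real^3. f j (x $ j)) has_derivative (\<lambda>h. h $ j * deriv (f j) (x $ j))) (at x within S)" for j
    by (rule DERIV_compose_FDERIV[OF bump_algebra_DERIV[OF assms[of j]]
          bounded_linear_imp_has_derivative[OF bounded_linear_vec_nth[of j]]])
  have "(\<Sum>i\<in>UNIV. tprod (dprod i f) x * h $ i) =
      f 1 (x $ 1) * (f 2 (x $ 2) * (h $ 3 * deriv (f 3) (x $ 3)) +
        h $ 2 * deriv (f 2) (x $ 2) * f 3 (x $ 3)) +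
      h $ 1 * deriv (f 1) (x $ 1) * (f 2 (x $ 2) * f 3 (x $ 3))" for h :: "real^3"
  proof -
    have "tprod (dprod 1 f) x = deriv (f 1) (x $ 1) * (f 2 (x $ 2) * f 3 (x $ 3))"
      "tprod (dprod 2 f) x = f 1 (x $ 1) * (deriv (f 2) (x $ 2) * f 3 (x $ 3))"
      "tprod (dprod 3 f) x = f 1 (x $ 1) * (f 2 (x $ 2) * deriv (f 3) (x $ 3))"
      by (simp_all add: tprod_3)
    then show ?thesis unfolding sum_3 by (simp only: algebra_simps)
  qed
  then have D: "(\<lambda>h. \<Sum>i\<in>UNIV. tprod (dprod i f) x * h $ i) =
      (\<lambda>h. f 1 (x $ 1) * (f 2 (x $ 2) * (h $ 3 * deriv (f 3) (x $ 3)) +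
        h $ 2 * deriv (f 2) (x $ 2) * f 3 (x $ 3)) +
      h $ 1 * deriv (f 1) (x $ 1) * (f 2 (x $ 2) * f 3 (x $ 3)))"
    by (rule ext)
  have eq: "tprod f = (\<lambda>x. f 1 (x $ 1) * (f 2 (x $ 2) * f 3 (x $ 3)))"
    by (rule ext) (rule tprod_3)
  show ?thesis unfolding D unfolding eq
    by (rule has_derivative_mult[OF *[of 1] has_derivative_mult[OF *[of 2] *[of 3]]])
qed

lemma continuous_on_tprod: "(\<And>j. f j \<in> bump_algebra) \<Longrightarrow> continuous_on S (tprod f)"
  by (rule has_derivative_continuous_on[OF has_derivative_tprod])

lemma borel_measurable_tprod: "(\<And>j. f j \<in> bump_algebra) \<Longrightarrow> tprod f \<in> borel_measurable borel"
  by (intro borel_measurable_continuous_onI continuous_on_tprod)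

lemma partial_deriv_eq: "(f has_derivative D) (at x) \<Longrightarrow> partial_deriv i f x = D (axis i 1)"
  using frechet_derivative_at[of f D x] by (simp add: partial_deriv_def)

lemma sum_mult_axis: "(\<Sum>j\<in>UNIV. c j * axis i (1::real) $ j) = c (i::3)"
proof -
  have "c j * axis i (1::real) $ j = (if j = i then c j else 0)" for j
    by (simp add: axis_def)
  then show ?thesis by simp
qed

lemma partial_deriv_tprod:
  assumes "\<And>j. f j \<in> bump_algebra"
  shows "partial_deriv i (tprod f) = tprod (dprod i f)"
proof
  fix x
  have "partial_deriv i (tprod f) x = (\<Sum>j\<in>UNIV. tprod (dprod j f) x * axis i 1 $ j)"
    by (rule partial_deriv_eq[OF has_derivative_tprod[OF assms]])
  then show "partial_deriv i (tprod f) x = tprod (dprod i f) x"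
    by (simp only: sum_mult_axis)
qed

text \<open>\<open>smooth\<close> asks for differentiability of all iterated partial derivatives. An
  invariant class of differentiable functions contains them all, by induction on the list of
  directions.\<close>

lemma smoothI:
  assumes "f \<in> F"
    and "\<And>f. f \<in> F \<Longrightarrow> f differentiable_on UNIV"
    and "\<And>f i. f \<in> F \<Longrightarrow> partial_deriv i f \<in> F"
  shows "smooth f"
proof -
  have "foldr partial_deriv is f \<in> F" for "is"
    by (induction "is") (auto simp: assms)
  then show ?thesis by (simp add: smooth_def assms)
qed

lemma smooth_tprod:
  assumes "\<And>j. f j \<in> bump_algebra"
  shows "smooth (tprod f)"
proof (rule smoothI)
  let ?F = "{tprod f |f. \<forall>j. f j \<in> bump_algebra}"
  show "tprod f \<in> ?F" using assms by blast
  show "g differentiable_on UNIV" if g: "g \<in> ?F" for g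
  proof -
    obtain f where f: "g = tprod f" "\<And>j. f j \<in> bump_algebra" using g by blast
    show ?thesis unfolding differentiable_on_def differentiable_def f(1)
      by (intro ballI exI, rule has_derivative_tprod) (rule f(2))
  qed
  show "partial_deriv i g \<in> ?F" if g: "g \<in> ?F" for g i
  proof -
    obtain f where f: "g = tprod f" "\<And>j. f j \<in> bump_algebra" using g by blast
    have "partial_deriv i g = tprod (dprod i f)" unfolding f(1) by (rule partial_deriv_tprod) (rule f(2))
    moreover have "\<forall>j. dprod i f j \<in> bump_algebra" using f(2) dprod_bump_algebra by blast
    ultimately show ?thesis by blast
  qed
qed

lemma abs_sum_nth_le:
  assumes "\<And>i. \<bar>c i\<bar> \<le> B i"
  shows "norm (\<Sum>i\<in>UNIV. c i * (h::real^3) $ i) \<le> (\<Sum>i\<in>UNIV. B i) * norm h"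
proof -
  have "norm (\<Sum>i\<in>UNIV. c i * h $ i) \<le> (\<Sum>i\<in>UNIV. B i * norm h)"
    using assms component_le_norm_cart[of h]
    by (intro sum_norm_le) (auto simp: abs_mult intro!: mult_mono order_trans[OF abs_ge_zero assms])
  then show ?thesis by (simp add: sum_distrib_right)
qed

lemma tprod_Lipschitz:
  assumes "\<And>j. f j \<in> bump_algebra"
  obtains L where "0 \<le> L" "\<And>x y. \<bar>tprod f x - tprod f y\<bar> \<le> L * norm (x - y)"
proof -
  have "\<exists>B. 0 \<le> B \<and> (\<forall>x. \<bar>tprod (dprod i f) x\<bar> \<le> B)" for i
    by (rule tprod_bounded[of "dprod i f"]) (use assms in \<open>auto simp: bump_algebra_deriv\<close>)
  then obtain B where B: "\<And>i. 0 \<le> B i" "\<And>i x. \<bar>tprod (dprod i f) x\<bar> \<le> B i" by metis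
  have "norm (tprod f x - tprod f y) \<le> (\<Sum>i\<in>UNIV. B i) * norm (x - y)" for x y
    by (rule differentiable_bound[OF convex_UNIV has_derivative_tprod[OF assms]])
      (auto intro!: onorm_le abs_sum_nth_le B)
  then show ?thesis using that[of "\<Sum>i\<in>UNIV. B i"] by (simp add: sum_nonneg B)
qed

text \<open>The quadratic remainder is uniform in both points because the first derivatives are
  globally Lipschitz. This uniformity allows differentiation under the integral sign against a
  merely integrable weight.\<close>

lemma tprod_Taylor:
  assumes f: "\<And>j. f j \<in> bump_algebra"
  obtains C where "0 \<le> C" "\<And>x y. \<bar>tprod f y - tprod f x -
    (\<Sum>i\<in>UNIV. tprod (dprod i f) x * (y - x) $ i)\<bar> \<le> C * (norm (y - x))\<^sup>2"
proof -
  have "\<exists>L. 0 \<le> L \<and> (\<forall>x y. \<bar>tprod (dprod i f) x - tprod (dprod i f) y\<bar> \<le> L * norm (x - y))" for i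
    by (rule tprod_Lipschitz[of "dprod i f"]) (use f in \<open>auto simp: bump_algebra_deriv\<close>)
  then obtain L where L: "\<And>i. 0 \<le> L i"
    "\<And>i x y. \<bar>tprod (dprod i f) x - tprod (dprod i f) y\<bar> \<le> L i * norm (x - y)" by metis
  have "norm (tprod f y - tprod f x - (\<Sum>i\<in>UNIV. tprod (dprod i f) x * (y - x) $ i))
      \<le> norm (y - x) * ((\<Sum>i\<in>UNIV. L i) * norm (y - x))" for x y
  proof (rule differentiable_bound_linearization[where S = "cball x (norm (y - x))" and ?x0.0 = x
        and f' = "\<lambda>x h. \<Sum>i\<in>UNIV. tprod (dprod i f) x * h $ i"])
    show "x + t *\<^sub>R (y - x) \<in> cball x (norm (y - x))" if "t \<in> {0..1}" for t
      using that by (simp add: dist_norm mult_left_le_one_le)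
    show "(tprod f has_derivative (\<lambda>h. \<Sum>i\<in>UNIV. tprod (dprod i f) z * h $ i))
        (at z within cball x (norm (y - x)))" for z
      by (rule has_derivative_tprod[OF f])
    show "onorm ((\<lambda>h. \<Sum>i\<in>UNIV. tprod (dprod i f) z * h $ i) -
        (\<lambda>h. \<Sum>i\<in>UNIV. tprod (dprod i f) x * h $ i)) \<le> (\<Sum>i\<in>UNIV. L i) * norm (y - x)"
      if "z \<in> cball x (norm (y - x))" for z
      unfolding fun_diff_def
    proof (rule onorm_le)
      fix h :: "real^3"
      have "norm (\<Sum>i\<in>UNIV. (tprod (dprod i f) z - tprod (dprod i f) x) * h $ i)
          \<le> (\<Sum>i\<in>UNIV. L i * norm (z - x)) * norm h"
        by (rule abs_sum_nth_le) (rule L)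
      also have "\<dots> \<le> (\<Sum>i\<in>UNIV. L i * norm (y - x)) * norm h"
        using that by (intro mult_right_mono sum_mono mult_left_mono L)
          (auto simp: dist_norm norm_minus_commute)
      finally show "norm ((\<Sum>i\<in>UNIV. tprod (dprod i f) z * h $ i) -
          (\<Sum>i\<in>UNIV. tprod (dprod i f) x * h $ i)) \<le> (\<Sum>i\<in>UNIV. L i) * norm (y - x) * norm h"
        by (simp add: sum_subtractf left_diff_distrib sum_distrib_right)
    qed
  qed simp
  then show ?thesis using that[of "\<Sum>i\<in>UNIV. L i"]
    by (simp add: sum_nonneg L power2_eq_square mult_ac)
qed

text \<open>For periodic \<open>w\<close> this is the convolution on the torus. All derivatives fall
  on the smooth factor \<open>f\<close>, so an integrable \<open>w\<close> suffices for
  smoothness.\<close>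

definition cell_conv :: "(real^3 \<Rightarrow> real) \<Rightarrow> (3 \<Rightarrow> real \<Rightarrow> real) \<Rightarrow> real^3 \<Rightarrow> real"
  where "cell_conv w f z = (LINT x|lcell. w x * tprod f (z - x))"

lemma integrable_mult_bounded:
  fixes w g :: "'a \<Rightarrow> real"
  assumes "integrable M w" "g \<in> borel_measurable M" "\<And>x. \<bar>g x\<bar> \<le> B"
  shows "integrable M (\<lambda>x. w x * g x)"
proof (rule Bochner_Integration.integrable_bound)
  show "integrable M (\<lambda>x. B * w x)" using assms by simp
  show "AE x in M. norm (w x * g x) \<le> norm (B * w x)"
  proof (rule AE_I2)
    fix x
    have "\<bar>w x\<bar> * \<bar>g x\<bar> \<le> \<bar>w x\<bar> * \<bar>B\<bar>"
      using assms(3)[of x] by (intro mult_left_mono) auto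
    then show "norm (w x * g x) \<le> norm (B * w x)" by (simp add: abs_mult mult.commute)
  qed
qed (use assms in measurable)

lemma integrable_mult_tprod:
  assumes "integrable lcell w" and f: "\<And>j. f j \<in> bump_algebra"
  shows "integrable lcell (\<lambda>x. w x * tprod f (z - x))"
proof -
  obtain B where "\<And>x. \<bar>tprod f x\<bar> \<le> B" by (rule tprod_bounded[of f]) (use f in auto)
  moreover have "(\<lambda>x. tprod f (z - x)) \<in> borel_measurable lcell"
    using measurable_compose[OF _ borel_measurable_tprod[of f, OF f]] by measurable
  ultimately show ?thesis using assms by (intro integrable_mult_bounded)
qed

text \<open>Integrating the uniform Taylor remainder against \<bar>w\<bar> leaves an error that is
  quadratic in the increment, so the derivative passes under the integral without a limit
  theorem.\<close>

lemma has_derivative_cell_conv: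
  assumes w: "integrable lcell w" and f: "\<And>j. f j \<in> bump_algebra"
  shows "(cell_conv w f has_derivative (\<lambda>h. \<Sum>i\<in>UNIV. cell_conv w (dprod i f) z * h $ i)) (at z)"
proof -
  obtain C where C: "0 \<le> C" "\<And>x y. \<bar>tprod f y - tprod f x -
    (\<Sum>i\<in>UNIV. tprod (dprod i f) x * (y - x) $ i)\<bar> \<le> C * (norm (y - x))\<^sup>2"
    by (rule tprod_Taylor[of f]) (use f in auto)
  let ?W = "LINT x|lcell. \<bar>w x\<bar>"
  let ?D = "\<lambda>h. \<Sum>i\<in>UNIV. cell_conv w (dprod i f) z * (h :: real^3) $ i"
  have int: "integrable lcell (\<lambda>x. w x * tprod f (z - x))"
    "integrable lcell (\<lambda>x. w x * tprod (dprod i f) (z - x))" for i z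
    using f by (intro integrable_mult_tprod[OF w]; simp add: bump_algebra_deriv)+
  have bound: "norm (cell_conv w f y - cell_conv w f z - ?D (y - z)) \<le> ?W * (C * (norm (y - z))\<^sup>2)" for y
  proof -
    let ?r = "\<lambda>x. tprod f (y - x) - tprod f (z - x) - (\<Sum>i\<in>UNIV. tprod (dprod i f) (z - x) * (y - z) $ i)"
    have "cell_conv w f y - cell_conv w f z - ?D (y - z) = (LINT x|lcell. w x * tprod f (y - x) -
        w x * tprod f (z - x) - (\<Sum>i\<in>UNIV. w x * tprod (dprod i f) (z - x) * (y - z) $ i))"
      unfolding cell_conv_def using int by simp
    also have "\<dots> = (LINT x|lcell. w x * ?r x)"
      by (simp add: right_diff_distrib sum_distrib_left mult.assoc)
    also have "norm \<dots> \<le> (LINT x|lcell. \<bar>w x\<bar> * (C * (norm (y - z))\<^sup>2))"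
    proof (rule Bochner_Integration.integral_norm_bound_integral)
      have "integrable lcell (\<lambda>x. w x * tprod f (y - x) -
        w x * tprod f (z - x) - (\<Sum>i\<in>UNIV. w x * tprod (dprod i f) (z - x) * (y - z) $ i))"
        using int by simp
      then show "integrable lcell (\<lambda>x. w x * ?r x)"
        by (simp add: right_diff_distrib sum_distrib_left mult.assoc)
      show "norm (w x * ?r x) \<le> \<bar>w x\<bar> * (C * (norm (y - z))\<^sup>2)" for x
        using C(2)[of "y - x" "z - x"] by (simp add: abs_mult mult_left_mono)
    qed (use w in simp)
    finally show ?thesis by simp
  qed
  show ?thesis
  proof (rule has_derivativeI_sandwich[where e = 1 and H = "\<lambda>y. ?W * C * norm (y - z)"])
    show "bounded_linear ?D"
      by (intro bounded_linear_sum bounded_linear_const_mult bounded_linear_vec_nth)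
    show "norm (cell_conv w f y - cell_conv w f z - ?D (y - z)) / norm (y - z) \<le> ?W * C * norm (y - z)"
      if "y \<noteq> z" for y
      using bound[of y] that by (simp add: divide_simps power2_eq_square mult_ac)
    show "((\<lambda>y. ?W * C * norm (y - z)) \<longlongrightarrow> 0) (at z)"
      by (auto intro!: tendsto_eq_intros)
  qed simp
qed

lemma partial_deriv_cell_conv:
  assumes "integrable lcell w" and "\<And>j. f j \<in> bump_algebra"
  shows "partial_deriv i (cell_conv w f) = cell_conv w (dprod i f)"
proof
  fix x
  have "partial_deriv i (cell_conv w f) x = (\<Sum>j\<in>UNIV. cell_conv w (dprod j f) x * axis i 1 $ j)"
    by (rule partial_deriv_eq[OF has_derivative_cell_conv[OF assms]])
  then show "partial_deriv i (cell_conv w f) x = cell_conv w (dprod i f) x"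
    by (simp only: sum_mult_axis)
qed

lemma smooth_cell_conv:
  assumes w: "integrable lcell w" and "\<And>j. f j \<in> bump_algebra"
  shows "smooth (cell_conv w f)"
proof (rule smoothI)
  let ?F = "{cell_conv w f |f. \<forall>j. f j \<in> bump_algebra}"
  show "cell_conv w f \<in> ?F" using assms by blast
  show "g differentiable_on UNIV" if g: "g \<in> ?F" for g
  proof -
    obtain f where f: "g = cell_conv w f" "\<And>j. f j \<in> bump_algebra" using g by blast
    show ?thesis unfolding differentiable_on_def differentiable_def f(1)
      by (intro ballI exI, rule has_derivative_cell_conv[OF w]) (rule f(2))
  qed
  show "partial_deriv i g \<in> ?F" if g: "g \<in> ?F" for g i
  proof -
    obtain f where f: "g = cell_conv w f" "\<And>j. f j \<in> bump_algebra" using g by blast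
    have "partial_deriv i g = cell_conv w (dprod i f)" unfolding f(1) by (rule partial_deriv_cell_conv[OF w]) (rule f(2))
    moreover have "\<forall>j. dprod i f j \<in> bump_algebra" using f(2) dprod_bump_algebra by blast
    ultimately show ?thesis by blast
  qed
qed

lemma periodic_cell_conv:
  assumes f: "\<And>j. f j \<in> bump_algebra"
  shows "periodic (cell_conv w f)"
proof -
  have "tprod f (x + m - y) = tprod f (x - y)" if "m \<in> lattice" for x m y
    using tprod_periodic[of f, OF f] that by (simp add: periodic_def diff_add_eq[symmetric])
  then show ?thesis by (simp add: periodic_def cell_conv_def)
qed

section \<open>Continuity of translations in mean square\<close>

lemma square_add_le: "((a::real) + b)\<^sup>2 \<le> 2 * a\<^sup>2 + 2 * b\<^sup>2"
  using zero_le_power2[of "a - b"] by (simp add: power2_eq_square algebra_simps)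

lemma young_ineq:
  fixes a b :: real
  assumes "0 < c"
  shows "\<bar>a * b\<bar> \<le> (c * a\<^sup>2 + b\<^sup>2 / c) / 2"
proof -
  have "0 \<le> (c * \<bar>a\<bar> - \<bar>b\<bar>)\<^sup>2 / c" using assms by simp
  also have "\<dots> = c * a\<^sup>2 + b\<^sup>2 / c - 2 * \<bar>a * b\<bar>"
    using assms by (simp add: power2_diff power_mult_distrib abs_mult field_simps power2_eq_square)
  finally show ?thesis by simp
qed

text \<open>Cauchy-Schwarz in the form of Young's inequality with a free weight \<open>c\<close>. It
  avoids square roots, and a large \<open>c\<close> lets a small first factor compensate a fixed
  second one.\<close>

lemma
  fixes f g :: "'a \<Rightarrow> real"
  assumes [measurable]: "f \<in> borel_measurable M" "g \<in> borel_measurable M"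
    and int: "integrable M (\<lambda>x. (f x)\<^sup>2)" "integrable M (\<lambda>x. (g x)\<^sup>2)"
  shows integrable_mult_L2: "integrable M (\<lambda>x. f x * g x)"
    and integral_mult_L2_le: "0 < c \<Longrightarrow>
      \<bar>LINT x|M. f x * g x\<bar> \<le> (c * (LINT x|M. (f x)\<^sup>2) + (LINT x|M. (g x)\<^sup>2) / c) / 2"
proof -
  have *: "integrable M (\<lambda>x. (c * (f x)\<^sup>2 + (g x)\<^sup>2 / c) / 2)" for c
    using int by simp
  show "integrable M (\<lambda>x. f x * g x)"
  proof (rule Bochner_Integration.integrable_bound[OF *[of 1]])
    show "AE x in M. norm (f x * g x) \<le> norm ((1 * (f x)\<^sup>2 + (g x)\<^sup>2 / 1) / 2)"
      using young_ineq[of 1 "f x" "g x" for x] by (intro AE_I2) (auto intro: order_trans)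
  qed measurable
  note i = this
  show "\<bar>LINT x|M. f x * g x\<bar> \<le> (c * (LINT x|M. (f x)\<^sup>2) + (LINT x|M. (g x)\<^sup>2) / c) / 2" if "0 < c"
  proof -
    have "\<bar>LINT x|M. f x * g x\<bar> \<le> (LINT x|M. \<bar>f x * g x\<bar>)"
      by (rule integral_abs_bound)
    also have "\<dots> \<le> (LINT x|M. (c * (f x)\<^sup>2 + (g x)\<^sup>2 / c) / 2)"
      using young_ineq[OF that] by (intro integral_mono integrable_abs i *)
    also have "\<dots> = (c * (LINT x|M. (f x)\<^sup>2) + (LINT x|M. (g x)\<^sup>2) / c) / 2"
      using int by simp
    finally show ?thesis .
  qed
qed

section \<open>Truncation and density of continuous functions\<close>

definition clamp_real :: "real \<Rightarrow> real \<Rightarrow> real"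
  where "clamp_real n y = max (- n) (min n y)"

lemma clamp_real_bound: "0 \<le> n \<Longrightarrow> \<bar>clamp_real n y\<bar> \<le> n"
  by (auto simp: clamp_real_def)

lemma clamp_real_diff: "0 \<le> n \<Longrightarrow> \<bar>y - clamp_real n y\<bar> \<le> \<bar>y\<bar>"
  by (auto simp: clamp_real_def)

lemma clamp_real_id: "\<bar>y\<bar> \<le> n \<Longrightarrow> clamp_real n y = y"
  by (auto simp: clamp_real_def)

lemma continuous_on_clamp_real: "continuous_on S (clamp_real n)"
  unfolding clamp_real_def by (intro continuous_intros)

lemma borel_measurable_clamp_real [measurable]: "clamp_real n \<in> borel_measurable borel"
  by (intro borel_measurable_continuous_onI continuous_on_clamp_real)

lemma clamp_real_L2:
  fixes f :: "'a \<Rightarrow> real"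
  assumes [measurable]: "f \<in> borel_measurable M" and int: "integrable M (\<lambda>x. (f x)\<^sup>2)" and "0 < e"
  obtains n :: nat where "(LINT x|M. (f x - clamp_real (real n) (f x))\<^sup>2) < e"
proof -
  have "(\<lambda>n. LINT x|M. (f x - clamp_real (real n) (f x))\<^sup>2) \<longlonglongrightarrow> (LINT x|M. 0)"
  proof (rule integral_dominated_convergence[OF _ _ int])
    show "AE x in M. (\<lambda>n. (f x - clamp_real (real n) (f x))\<^sup>2) \<longlonglongrightarrow> 0"
    proof (rule AE_I2)
      fix x
      have "\<forall>\<^sub>F n in sequentially. \<bar>f x\<bar> \<le> real n"
        using filterlim_real_sequentially by (simp add: filterlim_at_top)
      then have "\<forall>\<^sub>F n in sequentially. 0 = (f x - clamp_real (real n) (f x))\<^sup>2"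
        by eventually_elim (simp add: clamp_real_id)
      then show "(\<lambda>n. (f x - clamp_real (real n) (f x))\<^sup>2) \<longlonglongrightarrow> 0"
        by (rule Lim_transform_eventually[OF tendsto_const])
    qed
    show "AE x in M. norm ((f x - clamp_real (real n) (f x))\<^sup>2) \<le> (f x)\<^sup>2" for n
      using clamp_real_diff[of "real n" "f x" for x] by (intro AE_I2) (simp add: abs_le_square_iff)
  qed measurable
  then have "\<forall>\<^sub>F n in sequentially. (LINT x|M. (f x - clamp_real (real n) (f x))\<^sup>2) < e"
    using \<open>0 < e\<close> by (intro order_tendstoD) auto
  then show ?thesis using that eventually_happens'[OF sequentially_bot] by blast
qed

lemma AE_lcell: "(AE x in lborel. P x) \<Longrightarrow> (AE x in lcell. P x)"
  unfolding lcell_def by (subst AE_density) (auto elim: AE_mp)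

text \<open>Lebesgue measurability yields continuous functions that converge to f off a null set,
  but without a majorant. Clamping f and these functions at the same level supplies a constant one,
  and the cell has finite measure, so dominated convergence applies.\<close>

lemma continuous_dense_L2:
  fixes f :: "real^3 \<Rightarrow> real"
  assumes [measurable]: "f \<in> borel_measurable borel"
    and int: "integrable lcell (\<lambda>x. (f x)\<^sup>2)" and "0 < e"
  obtains g B where "continuous_on UNIV g" "\<And>x. \<bar>g x\<bar> \<le> B"
    "(LINT x|lcell. (f x - g x)\<^sup>2) < e"
proof -
  have mf [measurable]: "f \<in> borel_measurable lcell"
    by simp
  \<comment> \<open>The errors of truncation and of approximation both enter with the factor 2 of
    \<open>square_add_le\<close>, hence a quarter of e for each.\<close>
  obtain n :: nat where n: "(LINT x|lcell. (f x - clamp_real (real n) (f x))\<^sup>2) < e / 4"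
    using clamp_real_L2[OF mf int, of "e / 4"] \<open>0 < e\<close> by auto
  let ?c = "clamp_real (real n)"
  have "f \<in> borel_measurable lebesgue"
    by (rule measurable_completion) simp
  then have "f measurable_on UNIV"
    by (rule lebesgue_measurable_imp_measurable_on) simp
  then obtain N g where N: "negligible N" and g: "\<And>k. continuous_on UNIV (g k)"
    and lim: "\<And>x. x \<notin> N \<Longrightarrow> (\<lambda>k. g k x) \<longlonglongrightarrow> f x"
    unfolding measurable_on_def by auto
  have "AE x in lebesgue. x \<notin> N"
    using N by (intro AE_not_in) (simp add: negligible_iff_null_sets)
  then have AE: "AE x in lcell. x \<notin> N"
    by (intro AE_lcell) (simp add: AE_completion_iff)
  have gm [measurable]: "g k \<in> borel_measurable lcell" for k
    using borel_measurable_continuous_onI[OF g] by simp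
  have le: "(?c (f x) - ?c (g k x))\<^sup>2 \<le> (2 * real n)\<^sup>2" for k x
  proof -
    have "\<bar>?c (f x) - ?c (g k x)\<bar> \<le> \<bar>2 * real n\<bar>"
      using clamp_real_bound[of "real n" "f x"] clamp_real_bound[of "real n" "g k x"] by linarith
    then show ?thesis by (simp only: abs_le_square_iff)
  qed
  have "(\<lambda>k. LINT x|lcell. (?c (f x) - ?c (g k x))\<^sup>2) \<longlonglongrightarrow> (LINT x|lcell. 0)"
  proof (rule integral_dominated_convergence)
    show "integrable lcell (\<lambda>x. (2 * real n)\<^sup>2)" by simp
    show "AE x in lcell. (\<lambda>k. (?c (f x) - ?c (g k x))\<^sup>2) \<longlonglongrightarrow> 0"
      using AE
    proof eventually_elim
      case (elim x)
      have "(\<lambda>k. ?c (g k x)) \<longlonglongrightarrow> ?c (f x)"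
        by (rule continuous_on_tendsto_compose[OF continuous_on_clamp_real[of UNIV] lim[OF elim]]) auto
      then have "(\<lambda>k. (?c (f x) - ?c (g k x))\<^sup>2) \<longlonglongrightarrow> (?c (f x) - ?c (f x))\<^sup>2"
        by (intro tendsto_intros)
      then show ?case by simp
    qed
    show "AE x in lcell. norm ((?c (f x) - ?c (g k x))\<^sup>2) \<le> (2 * real n)\<^sup>2" for k
      using le by (intro AE_I2) simp
  qed measurable
  then have "\<forall>\<^sub>F k in sequentially. (LINT x|lcell. (?c (f x) - ?c (g k x))\<^sup>2) < e / 4"
    using \<open>0 < e\<close> by (intro order_tendstoD) auto
  then obtain k where k: "(LINT x|lcell. (?c (f x) - ?c (g k x))\<^sup>2) < e / 4"
    using eventually_happens'[OF sequentially_bot] by blast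
  have bd: "integrable lcell (\<lambda>x. (?c (f x) - ?c (g k x))\<^sup>2)"
  proof (rule cell.integrable_const_bound[of _ "(2 * real n)\<^sup>2"])
    show "AE x in lcell. norm ((?c (f x) - ?c (g k x))\<^sup>2) \<le> (2 * real n)\<^sup>2"
      using le by (intro AE_I2) simp
  qed measurable
  have fc: "integrable lcell (\<lambda>x. (f x - ?c (f x))\<^sup>2)"
    by (rule Bochner_Integration.integrable_bound[OF int])
      (use clamp_real_diff[of "real n"] in \<open>auto simp: abs_le_square_iff\<close>)
  have "(LINT x|lcell. (f x - ?c (g k x))\<^sup>2)
      \<le> (LINT x|lcell. 2 * (f x - ?c (f x))\<^sup>2 + 2 * (?c (f x) - ?c (g k x))\<^sup>2)"
  proof (rule integral_mono')
    show "integrable lcell (\<lambda>x. 2 * (f x - ?c (f x))\<^sup>2 + 2 * (?c (f x) - ?c (g k x))\<^sup>2)"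
      using bd fc by simp
    show "(f x - ?c (g k x))\<^sup>2 \<le> 2 * (f x - ?c (f x))\<^sup>2 + 2 * (?c (f x) - ?c (g k x))\<^sup>2" for x
      using square_add_le[of "f x - ?c (f x)" "?c (f x) - ?c (g k x)"] by simp
  qed simp
  also have "\<dots> < e" using bd fc n k by simp
  finally have "(LINT x|lcell. (f x - ?c (g k x))\<^sup>2) < e" .
  moreover have "continuous_on UNIV (\<lambda>x. ?c (g k x))"
    by (rule continuous_on_compose2[OF continuous_on_clamp_real[of UNIV] g]) simp
  moreover have "\<bar>?c (g k x)\<bar> \<le> real n" for x by (rule clamp_real_bound) simp
  ultimately show ?thesis by (intro that)
qed

lemma integral_lborel_shift:
  fixes f :: "real^3 \<Rightarrow> real"
  assumes [measurable]: "f \<in> borel_measurable borel"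
  shows "(LINT x|lborel. f (x + w)) = (LINT x|lborel. f x)"
proof -
  have "(LINT x|lborel. f x) = (LINT x|distr lborel borel ((+) w). f x)"
    by (simp add: lborel_distr_plus)
  also have "\<dots> = (LINT x|lborel. f (w + x))"
    by (subst integral_distr) auto
  finally show ?thesis by (simp add: add.commute)
qed

lemma integral_lcell:
  fixes f :: "real^3 \<Rightarrow> real"
  assumes "f \<in> borel_measurable borel"
  shows "(LINT x|lcell. f x) = (LINT x|lborel. indicator unit_cell x * f x)"
  unfolding lcell_def using assms by (subst integral_density) auto

lemma unit_cell_norm: "x \<in> unit_cell \<Longrightarrow> norm x \<le> 2"
proof -
  assume x: "x \<in> unit_cell"
  have "norm x \<le> (\<Sum>i\<in>UNIV. \<bar>x $ i\<bar>)" by (rule norm_le_l1_cart)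
  also have "\<dots> \<le> (\<Sum>i\<in>(UNIV :: 3 set). 1/2)" using x by (intro sum_mono) (simp add: unit_cell_def)
  finally show ?thesis by simp
qed

text \<open>The substitution moves the translation from the rough factor v to the continuous factor
  g and to the indicator of the cell. The indicator is continuous off the frontier of the cell, a
  null set, so dominated convergence along sequences gives the limit.\<close>

lemma tendsto_integral_shift_bounded:
  fixes g v :: "real^3 \<Rightarrow> real"
  assumes g: "continuous_on UNIV g" "\<And>x. \<bar>g x\<bar> \<le> B"
    and [measurable]: "v \<in> borel_measurable borel" and v: "\<And>x. \<bar>v x\<bar> \<le> C"
  shows "((\<lambda>w. LINT x|lcell. g x * v (x + w)) \<longlongrightarrow> (LINT x|lcell. g x * v x)) (at 0)"
proof -
  let ?I = "indicator unit_cell :: real^3 \<Rightarrow> real"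
  have [measurable]: "g \<in> borel_measurable borel" using g(1) by (rule borel_measurable_continuous_onI)
  have "0 \<le> B" using g(2)[of 0] by linarith
  have "0 \<le> C" using v[of 0] by linarith
  have shift: "(LINT x|lcell. g x * v (x + w)) = (LINT x|lborel. ?I (x - w) * g (x - w) * v x)" for w
    using integral_lcell[of "\<lambda>x. g x * v (x + w)"] integral_lborel_shift[of "\<lambda>x. ?I (x - w) * g (x - w) * v x" w] by (simp add: mult_ac)
  have "((\<lambda>w. LINT x|lcell. g x * v (x + w)) \<longlongrightarrow> (LINT x|lcell. g x * v x))
      (at 0 within cball 0 1)"
    unfolding tendsto_at_iff_sequentially
  proof (intro allI impI)
    fix X :: "nat \<Rightarrow> real^3"
    assume X: "\<forall>i. X i \<in> cball 0 1 - {0}" "X \<longlonglongrightarrow> 0"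
    have "(\<lambda>i. LINT x|lborel. ?I (x - X i) * g (x - X i) * v x) \<longlonglongrightarrow> (LINT x|lborel. ?I x * g x * v x)"
    proof (rule integral_dominated_convergence)
      \<comment> \<open>Points of the cell have norm at most 2 and the shifts have norm at most 1,
        so all integrands live in the ball of radius 3.\<close>
      show "integrable lborel (\<lambda>x::real^3. B * C * indicator (cball 0 3) x)"
        by (intro integrable_mult_right integrable_real_indicator)
          (simp_all add: emeasure_bounded_finite flip: infinity_ennreal_def)
      show "AE x in lborel. norm (?I (x - X i) * g (x - X i) * v x) \<le> B * C * indicator (cball 0 3) x" for i
      proof (rule AE_I2)
        fix x
        have "norm x \<le> 3" if "x - X i \<in> unit_cell"
        proof -
          have "norm (X i) \<le> 1" using X(1) by simp
          then show ?thesis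
            using unit_cell_norm[OF that] norm_triangle_ineq[of "x - X i" "X i"] by simp
        qed
        moreover have "\<bar>g (x - X i)\<bar> * \<bar>v x\<bar> \<le> B * C"
          using g(2) v \<open>0 \<le> B\<close> by (intro mult_mono) auto
        ultimately show "norm (?I (x - X i) * g (x - X i) * v x) \<le> B * C * indicator (cball 0 3) x"
          using \<open>0 \<le> B\<close> \<open>0 \<le> C\<close> by (auto simp: indicator_def abs_mult)
      qed
      have fr: "AE x in lborel. x \<in> interior unit_cell \<or> x \<notin> unit_cell"
        using AE_frontier_unit_cell by (auto simp: frontier_def compact_imp_closed[OF compact_unit_cell])
      show "AE x in lborel. (\<lambda>i. ?I (x - X i) * g (x - X i) * v x) \<longlonglongrightarrow> ?I x * g x * v x"
        using fr
      proof eventually_elim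
        case (elim x)
        have lim: "(\<lambda>i. x - X i) \<longlonglongrightarrow> x" using tendsto_diff[OF tendsto_const X(2), of x] by simp
        have "(\<lambda>i. ?I (x - X i)) \<longlonglongrightarrow> ?I x"
        proof (rule Lim_transform_eventually[OF tendsto_const])
          show "\<forall>\<^sub>F i in sequentially. ?I x = ?I (x - X i)"
            using elim
          proof
            assume x: "x \<in> interior unit_cell"
            from topological_tendstoD[OF lim open_interior this]
            have "\<forall>\<^sub>F i in sequentially. x - X i \<in> interior unit_cell" .
            then show ?thesis
              by eventually_elim (use x interior_subset[of unit_cell] in \<open>auto simp: indicator_def\<close>)
          next
            assume x: "x \<notin> unit_cell"
            then have "\<forall>\<^sub>F i in sequentially. x - X i \<in> - unit_cell"
              using compact_imp_closed[OF compact_unit_cell]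
              by (intro topological_tendstoD[OF lim]) auto
            then show ?thesis by eventually_elim (use x in \<open>auto simp: indicator_def\<close>)
          qed
        qed
        moreover have "(\<lambda>i. g (x - X i)) \<longlonglongrightarrow> g x"
          by (rule continuous_on_tendsto_compose[OF g(1) lim]) auto
        ultimately show ?case by (intro tendsto_intros)
      qed
    qed measurable
    then show "((\<lambda>w. LINT x|lcell. g x * v (x + w)) \<circ> X) \<longlonglongrightarrow> (LINT x|lcell. g x * v x)"
      using shift[of 0] by (simp add: o_def shift)
  qed
  moreover have "at (0::real^3) within cball 0 1 = at 0"
    by (rule at_within_interior) (simp add: interior_cball)
  ultimately show ?thesis by (simp only:)
qed

text \<open>F is replaced by a bounded continuous function and u by a truncation, which reduces the
  claim to the bounded case. Periodicity of u makes the replacement errors independent of the shift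
  w.\<close>

lemma tendsto_integral_shift:
  fixes F u :: "real^3 \<Rightarrow> real"
  assumes [measurable]: "F \<in> borel_measurable borel" "u \<in> borel_measurable borel"
    and F: "integrable lcell (\<lambda>x. (F x)\<^sup>2)" and u: "integrable lcell (\<lambda>x. (u x)\<^sup>2)"
    and p: "periodic u"
  shows "((\<lambda>w. LINT x|lcell. F x * u (x + w)) \<longlongrightarrow> (LINT x|lcell. F x * u x)) (at 0)"
proof (rule tendstoI)
  fix e :: real assume "0 < e"
  define U where "U = (LINT x|lcell. (u x)\<^sup>2)"
  have "0 \<le> U" by (simp add: U_def)
  \<comment> \<open>Young weight for the error in F: large enough to make U / c harmless, after
    which \<open>g\<close> is chosen fine enough to beat \<open>c\<close>. The summand 1 keeps the
    weight positive when U = 0.\<close>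
  define c where "c = 8 * (U + 1) / e"
  have c: "0 < c" "U / c \<le> e / 8" using \<open>0 < e\<close> \<open>0 \<le> U\<close> by (auto simp: c_def field_simps)
  obtain g B where g: "continuous_on UNIV g" "\<And>x. \<bar>g x\<bar> \<le> B"
    "(LINT x|lcell. (F x - g x)\<^sup>2) < e / (8 * c)"
    by (rule continuous_dense_L2[OF _ F, of "e / (8 * c)"]) (use \<open>0 < e\<close> c in auto)
  have gm [measurable]: "g \<in> borel_measurable borel" using g(1) by (rule borel_measurable_continuous_onI)
  define V where "V = (LINT x|lcell. (g x)\<^sup>2)"
  have "0 \<le> V" by (simp add: V_def)
  \<comment> \<open>The second weight must absorb the square integral of \<open>g\<close>, so it can
    only be fixed now; the truncation level of u comes last.\<close>
  define d where "d = 8 * (V + 1) / e"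
  have d: "0 < d" "V / d \<le> e / 8" using \<open>0 < e\<close> \<open>0 \<le> V\<close> by (auto simp: d_def field_simps)
  have um: "u \<in> borel_measurable lcell" by simp
  obtain n :: nat where n: "(LINT x|lcell. (u x - clamp_real (real n) (u x))\<^sup>2) < e / (8 * d)"
    by (rule clamp_real_L2[OF um u, of "e / (8 * d)"]) (use \<open>0 < e\<close> d in auto)
  define v where "v x = clamp_real (real n) (u x)" for x
  have vm [measurable]: "v \<in> borel_measurable borel" unfolding v_def by measurable
  have vb: "\<bar>v x\<bar> \<le> real n" for x by (simp add: v_def clamp_real_bound)
  have pv: "periodic v" using p by (simp add: periodic_def v_def)
  have gint: "integrable lcell (\<lambda>x. (g x)\<^sup>2)"
  proof (rule cell.integrable_const_bound[of _ "B\<^sup>2"])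
    show "AE x in lcell. norm ((g x)\<^sup>2) \<le> B\<^sup>2"
    proof (rule AE_I2)
      fix x
      have "\<bar>g x\<bar> \<le> \<bar>B\<bar>" using g(2)[of x] by linarith
      then show "norm ((g x)\<^sup>2) \<le> B\<^sup>2" by (simp add: abs_le_square_iff)
    qed
  qed measurable
  have vint: "integrable lcell (\<lambda>x. (u x - v x)\<^sup>2)"
    by (rule Bochner_Integration.integrable_bound[OF u])
      (use clamp_real_diff[of "real n"] in \<open>auto simp: abs_le_square_iff v_def\<close>)
  have Fgint: "integrable lcell (\<lambda>x. (F x - g x)\<^sup>2)"
  proof (rule Bochner_Integration.integrable_bound)
    show "integrable lcell (\<lambda>x. 2 * (F x)\<^sup>2 + 2 * (g x)\<^sup>2)" using F gint by simp
    show "AE x in lcell. norm ((F x - g x)\<^sup>2) \<le> norm (2 * (F x)\<^sup>2 + 2 * (g x)\<^sup>2)"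
      using square_add_le[of "F x" "- g x" for x] by (intro AE_I2) simp
  qed measurable
  have us: "integrable lcell (\<lambda>x. (u (x + w))\<^sup>2)" "(LINT x|lcell. (u (x + w))\<^sup>2) = U" for w
    using integrable_cell_shift[of "\<lambda>x. (u x)\<^sup>2" w] integral_cell_shift[of "\<lambda>x. (u x)\<^sup>2" w] p u
    by (auto simp: periodic_def U_def)
  have vs: "integrable lcell (\<lambda>x. (u (x + w) - v (x + w))\<^sup>2)"
    "(LINT x|lcell. (u (x + w) - v (x + w))\<^sup>2) = (LINT x|lcell. (u x - v x)\<^sup>2)" for w
    using integrable_cell_shift[of "\<lambda>x. (u x - v x)\<^sup>2" w] integral_cell_shift[of "\<lambda>x. (u x - v x)\<^sup>2" w]
      p pv vint by (auto simp: periodic_def)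
  have approx: "\<bar>(LINT x|lcell. F x * u (x + w)) - (LINT x|lcell. g x * v (x + w))\<bar> < 3 * e / 8" for w
  proof -
    have [measurable]: "(\<lambda>x. u (x + w)) \<in> borel_measurable lcell"
      "(\<lambda>x. v (x + w)) \<in> borel_measurable lcell"
      by measurable
    have i1: "integrable lcell (\<lambda>x. (F x - g x) * u (x + w))"
      by (rule integrable_mult_L2) (simp_all add: Fgint us)
    have i2: "integrable lcell (\<lambda>x. g x * (u (x + w) - v (x + w)))"
      by (rule integrable_mult_L2) (simp_all add: gint vs)
    have i3: "integrable lcell (\<lambda>x. F x * u (x + w))"
      by (rule integrable_mult_L2) (simp_all add: F us)
    have i4: "integrable lcell (\<lambda>x. g x * u (x + w))"
      by (rule integrable_mult_L2) (simp_all add: gint us)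
    have i5: "integrable lcell (\<lambda>x. g x * v (x + w))"
      using Bochner_Integration.integrable_diff[OF i4 i2] by (simp add: right_diff_distrib)
    have "(LINT x|lcell. F x * u (x + w)) - (LINT x|lcell. g x * v (x + w)) =
       (LINT x|lcell. (F x - g x) * u (x + w)) + (LINT x|lcell. g x * (u (x + w) - v (x + w)))"
      using i3 i4 i5 by (simp add: left_diff_distrib right_diff_distrib)
    moreover have "\<bar>LINT x|lcell. (F x - g x) * u (x + w)\<bar>
        \<le> (c * (LINT x|lcell. (F x - g x)\<^sup>2) + U / c) / 2"
      unfolding us(2)[of w, symmetric]
      by (rule integral_mult_L2_le) (simp_all add: Fgint us c)
    moreover have "c * (LINT x|lcell. (F x - g x)\<^sup>2) < e / 8"
      using g(3) c by (simp add: field_simps)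
    moreover have "\<bar>LINT x|lcell. g x * (u (x + w) - v (x + w))\<bar> =
        \<bar>LINT x|lcell. (u (x + w) - v (x + w)) * g x\<bar>"
      by (simp add: mult.commute)
    moreover have "\<bar>LINT x|lcell. (u (x + w) - v (x + w)) * g x\<bar>
        \<le> (d * (LINT x|lcell. (u x - v x)\<^sup>2) + V / d) / 2"
      unfolding vs(2)[of w, symmetric] V_def
      by (rule integral_mult_L2_le) (simp_all add: gint vs d)
    moreover have "d * (LINT x|lcell. (u x - v x)\<^sup>2) < e / 8"
      using n d by (simp add: field_simps v_def)
    moreover have "\<bar>X\<bar> < 3 * e / 8"
      if "X = P + Q" "\<bar>P\<bar> \<le> (a1 + a2) / 2" "a1 < e / 8" "\<bar>Q\<bar> = Q'" "Q' \<le> (a3 + a4) / 2" "a3 < e / 8"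
        "a2 \<le> e / 8" "a4 \<le> e / 8"
      for X P Q Q' a1 a2 a3 a4 :: real
      using that \<open>0 < e\<close> by argo
    ultimately show ?thesis using c(2) d(2) by blast
  qed
  have "\<forall>\<^sub>F w in at 0. dist (LINT x|lcell. g x * v (x + w)) (LINT x|lcell. g x * v x) < e / 8"
    using \<open>0 < e\<close> by (intro tendstoD[OF tendsto_integral_shift_bounded[OF g(1,2) vm vb]]) simp
  then show "\<forall>\<^sub>F w in at 0. dist (LINT x|lcell. F x * u (x + w)) (LINT x|lcell. F x * u x) < e"
  proof eventually_elim
    case (elim w)
    then show ?case using approx[of w] approx[of 0] \<open>0 < e\<close> unfolding dist_real_def add_0_right by argo
  qed
qed

section \<open>Periodic bumps\<close>

lemma periodic_diff:
  assumes "periodic f" "m \<in> lattice"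
  shows "f (x + m - y) = f (x - y)"
proof -
  have "f (x - y + m) = f (x - y)" using assms by (simp add: periodic_def)
  then show ?thesis by (simp add: diff_add_eq)
qed

text \<open>The periodic substitute for a compactly supported bump: nonzero exactly where the cosine
  exceeds \<kappa>, which for \<kappa> close to 1 means close to the integer translates of
  \<open>a\<close>.\<close>

definition bump :: "real \<Rightarrow> real \<Rightarrow> real \<Rightarrow> real"
  where "bump \<kappa> a s = flat 0 (cos (2 * pi * (s - a)) - \<kappa>)"

lemma bump_in_bump_algebra: "bump \<kappa> a \<in> bump_algebra"
proof -
  have "bump \<kappa> a = (\<lambda>s. flat 0 (cos (2 * pi * s + (- 2 * pi * a)) - \<kappa>))"
    by (simp add: bump_def fun_eq_iff algebra_simps)
  then show ?thesis by (simp only: bump_algebra.flat)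
qed

text \<open>By evenness of the cosine a convolution kernel, read as a function of the integration
  variable, is again a bump. Hence the test functions of \<open>conv_potential_deriv\<close> are
  products of bumps.\<close>

lemma bump_reflect: "bump \<kappa> (- y) (z - x) = bump \<kappa> (z + y) x"
proof -
  have "cos (2 * pi * (z - x - - y)) = cos (2 * pi * (x - (z + y)))"
    using cos_minus[of "2 * pi * (z - x - - y)"] by (simp add: algebra_simps)
  then show ?thesis by (simp add: bump_def)
qed

lemma bump_shift: "bump \<kappa> a s = bump \<kappa> 0 (s - a)"
  by (simp add: bump_def)

text \<open>The non-strict inequality makes the set closed, so it can serve as the closed carrier
  that \<open>cell_test\<close> demands.\<close>

definition bump_set :: "real \<Rightarrow> real^3 \<Rightarrow> (real^3) set"
  where "bump_set \<kappa> a = {x. \<forall>j. \<kappa> \<le> cos (2 * pi * (x $ j - a $ j))}"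

definition bumps :: "real \<Rightarrow> real^3 \<Rightarrow> 3 \<Rightarrow> real \<Rightarrow> real"
  where "bumps \<kappa> a j = bump \<kappa> (a $ j)"

lemma bumps_in_bump_algebra: "bumps \<kappa> a j \<in> bump_algebra"
  by (simp add: bumps_def bump_in_bump_algebra)

lemma tprod_bumps_nonneg: "0 \<le> tprod (bumps \<kappa> a) x"
  unfolding tprod_def by (intro prod_nonneg) (simp add: bumps_def bump_def flat_nonneg)

lemma tprod_bumps_pos_iff:
  "0 < tprod (bumps \<kappa> a) x \<longleftrightarrow> (\<forall>j. \<kappa> < cos (2 * pi * (x $ j - a $ j)))"
proof -
  have "0 < tprod (bumps \<kappa> a) x \<longleftrightarrow> tprod (bumps \<kappa> a) x \<noteq> 0"
    using tprod_bumps_nonneg[of \<kappa> a x] by linarith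
  also have "\<dots> \<longleftrightarrow> (\<forall>j. flat 0 (cos (2 * pi * (x $ j - a $ j)) - \<kappa>) \<noteq> 0)"
    by (simp add: tprod_def bumps_def bump_def)
  also have "\<dots> \<longleftrightarrow> (\<forall>j. \<kappa> < cos (2 * pi * (x $ j - a $ j)))"
    by (simp add: flat_def)
  finally show ?thesis .
qed

lemma tprod_bumps_support: "tprod (bumps \<kappa> a) x \<noteq> 0 \<Longrightarrow> x \<in> bump_set \<kappa> a"
  using tprod_bumps_pos_iff[of \<kappa> a x] tprod_bumps_nonneg[of \<kappa> a x]
  by (auto simp: bump_set_def less_imp_le)

lemma tprod_bumps_shift: "tprod (bumps \<kappa> a) x = tprod (bumps \<kappa> 0) (x - a)"
  by (simp add: tprod_def bumps_def bump_shift[of \<kappa> "a $ _"])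

lemma closed_bump_set: "closed (bump_set \<kappa> a)"
  unfolding bump_set_def Collect_all_eq
  by (intro closed_INT ballI closed_Collect_le continuous_intros)

lemma bump_set_lattice:
  assumes "m \<in> lattice" "x \<in> bump_set \<kappa> a"
  shows "x + m \<in> bump_set \<kappa> a"
proof -
  have "cos (2 * pi * ((x + m) $ j - a $ j)) = cos (2 * pi * (x $ j - a $ j))" for j
    using bump_algebra_periodic[OF bump_algebra.cos[of "- 2 * pi * a $ j"], of "m $ j" "x $ j"] assms(1)
    by (simp add: lattice_def algebra_simps)
  then show ?thesis using assms(2) by (simp add: bump_set_def)
qed

lemma cos_near_one_imp_near_int:
  assumes "0 < e"
  obtains \<kappa> where "\<kappa> < 1" "\<And>t. \<kappa> \<le> cos (2 * pi * t) \<Longrightarrow> \<exists>k\<in>\<int>. \<bar>t - k\<bar> < e"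
proof
  \<comment> \<open>Capping at 1/2 keeps 2 pi h within [0, pi], where the cosine is decreasing;
    halving makes h strictly smaller than e.\<close>
  define h where "h = min e 1 / 2"
  have h: "0 < h" "h \<le> 1/2" "h < e" using assms by (auto simp: h_def)
  show "cos (2 * pi * h) < 1"
    using cos_mono_less_eq[of "2 * pi * h" 0] h by simp
  show "\<exists>k\<in>\<int>. \<bar>t - k\<bar> < e" if t: "cos (2 * pi * h) \<le> cos (2 * pi * t)" for t
  proof
    let ?r = "t - of_int (round t)"
    have r: "\<bar>?r\<bar> \<le> 1/2" using of_int_round_abs_le[of t] by (simp add: abs_minus_commute)
    have "cos (2 * pi * t) = cos (2 * pi * ?r)"
      using bump_algebra_periodic[OF bump_algebra.cos[of 0], of "of_int (round t)" ?r] by simp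
    also have "\<dots> = cos (2 * pi * \<bar>?r\<bar>)"
      using cos_abs_real[of "2 * pi * ?r"] by (simp add: abs_mult)
    finally have "2 * pi * \<bar>?r\<bar> \<le> 2 * pi * h"
      using t r h cos_mono_le_eq[of "2 * pi * h" "2 * pi * \<bar>?r\<bar>"] by simp
    then show "\<bar>?r\<bar> < e" using h by simp
  qed simp
qed

lemma bump_set_small:
  assumes "0 < e"
  obtains \<kappa> where "\<kappa> < 1" "\<And>a x. x \<in> bump_set \<kappa> a \<Longrightarrow> \<exists>m\<in>lattice. norm (x - a - m) < e"
proof -
  obtain \<kappa> where \<kappa>: "\<kappa> < 1" "\<And>t. \<kappa> \<le> cos (2 * pi * t) \<Longrightarrow> \<exists>k\<in>\<int>. \<bar>t - k\<bar> < e / 3"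
    by (rule cos_near_one_imp_near_int[of "e / 3"]) (use assms in auto)
  have "\<exists>m\<in>lattice. norm (x - a - m) < e" if "x \<in> bump_set \<kappa> a" for x a
  proof -
    have "\<forall>j. \<exists>k. k \<in> \<int> \<and> \<bar>x $ j - a $ j - k\<bar> < e / 3"
      using that \<kappa>(2) unfolding bump_set_def by blast
    then obtain k where k: "\<And>j. k j \<in> \<int>" "\<And>j. \<bar>x $ j - a $ j - k j\<bar> < e / 3" by metis
    let ?m = "\<chi> j. k j"
    have "norm (x - a - ?m) \<le> (\<Sum>j\<in>UNIV. \<bar>(x - a - ?m) $ j\<bar>)" by (rule norm_le_l1_cart)
    also have "\<dots> < (\<Sum>j\<in>(UNIV :: 3 set). e / 3)" using k(2) by (intro sum_strict_mono) auto
    finally show ?thesis using k(1) by (intro bexI[of _ ?m]) (auto simp: lattice_def)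
  qed
  then show ?thesis using that \<kappa>(1) by blast
qed

definition bump_mass :: "real \<Rightarrow> real"
  where "bump_mass \<kappa> = (LINT x|lcell. tprod (bumps \<kappa> 0) x)"

lemma integrable_tprod:
  assumes "\<And>j. f j \<in> bump_algebra"
  shows "integrable lcell (tprod f)"
proof -
  obtain B where "\<And>x. \<bar>tprod f x\<bar> \<le> B" by (rule tprod_bounded[of f]) (use assms in auto)
  moreover have "tprod f \<in> borel_measurable lcell"
    using borel_measurable_tprod[of f, OF assms] by simp
  ultimately show ?thesis by (intro cell.integrable_const_bound[of _ B]) auto
qed

lemma integral_tprod_shift:
  assumes f: "\<And>j. f j \<in> bump_algebra"
  shows "(LINT x|lcell. tprod f (x + w)) = (LINT x|lcell. tprod f x)"
  using borel_measurable_tprod[of f, OF f] tprod_periodic[of f, OF f] by (rule integral_cell_shift)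

lemma bump_mass_eq: "(LINT x|lcell. tprod (bumps \<kappa> a) x) = bump_mass \<kappa>"
  unfolding bump_mass_def
  using integral_tprod_shift[of "bumps \<kappa> 0" "- a"] bumps_in_bump_algebra[of \<kappa> 0]
  by (simp add: tprod_bumps_shift[of \<kappa> a])

lemma bump_mass_pos:
  assumes "\<kappa> < 1"
  shows "0 < bump_mass \<kappa>"
proof -
  let ?f = "tprod (bumps \<kappa> 0)"
  have int: "integrable lcell ?f" by (intro integrable_tprod bumps_in_bump_algebra)
  have "bump_mass \<kappa> \<noteq> 0"
  proof
    assume "bump_mass \<kappa> = 0"
    then have "AE x in lcell. ?f x = 0"
      using integral_nonneg_eq_0_iff_AE[OF int] tprod_bumps_nonneg by (simp add: bump_mass_def)
    then have ae: "AE x in lborel. x \<in> unit_cell \<longrightarrow> ?f x = 0"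
      unfolding lcell_def by (subst (asm) AE_density) (auto elim!: AE_mp simp: indicator_def)
    let ?W = "{x. 0 < ?f x} \<inter> interior unit_cell"
    have op: "open ?W"
      using continuous_on_tprod[of "bumps \<kappa> 0" UNIV, OF bumps_in_bump_algebra]
      by (intro open_Int open_interior open_Collect_less continuous_on_const)
    have "AE x in lborel. x \<notin> ?W"
      using ae by eventually_elim (use interior_subset in auto)
    then have "?W \<in> null_sets lborel"
      using op by (subst (asm) AE_iff_null_sets[symmetric]) auto
    then have "negligible ?W"
      using null_sets_completionI by (auto simp: negligible_iff_null_sets)
    moreover have "0 \<in> ?W"
      using assms by (simp add: tprod_bumps_pos_iff unit_cell_cbox interior_cbox mem_box_cart)
    ultimately show False using open_not_negligible[OF op] by blast
  qed
  moreover have "0 \<le> bump_mass \<kappa>" unfolding bump_mass_def by (simp add: tprod_bumps_nonneg)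
  ultimately show ?thesis by linarith
qed

text \<open>An integrable majorant \<open>D\<close> of the inner absolute integrals gives
  integrability on the product space, so applications have to estimate inner integrals only.\<close>

lemma Fubini_cell:
  fixes f :: "real^3 \<Rightarrow> real^3 \<Rightarrow> real"
  assumes [measurable]: "(\<lambda>p. f (fst p) (snd p)) \<in> borel_measurable (lcell \<Otimes>\<^sub>M lcell)"
    and "\<And>x. integrable lcell (f x)"
    and D: "\<And>x. (LINT y|lcell. \<bar>f x y\<bar>) \<le> D x" "integrable lcell D"
  shows "(LINT x|lcell. LINT y|lcell. f x y) = (LINT y|lcell. LINT x|lcell. f x y)"
proof -
  interpret pair_sigma_finite lcell lcell ..
  have "integrable lcell (\<lambda>x. LINT y|lcell. \<bar>f x y\<bar>)"
  proof (rule Bochner_Integration.integrable_bound[OF D(2)])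
    show "AE x in lcell. norm (LINT y|lcell. \<bar>f x y\<bar>) \<le> norm (D x)"
      using D(1) by (intro AE_I2) (simp add: integral_nonneg_AE order_trans[OF _ abs_ge_self])
    have "(\<lambda>(x, y). \<bar>f x y\<bar>) \<in> borel_measurable (lcell \<Otimes>\<^sub>M lcell)"
      unfolding case_prod_beta by measurable
    then show "(\<lambda>x. LINT y|lcell. \<bar>f x y\<bar>) \<in> borel_measurable lcell"
      by (rule cell.borel_measurable_lebesgue_integral)
  qed
  then have "integrable (lcell \<Otimes>\<^sub>M lcell) (\<lambda>(x, y). f x y)"
    using assms(1,2) by (intro Fubini_integrable) (auto simp: case_prod_beta)
  from Fubini_integral[OF this] show ?thesis by simp
qed

text \<open>Fubini twice, with the substitution z = x + w in between. It turns the integral of u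
  against a convolution into an average, weighted by the kernel, of the pairings of k with
  translates of u.\<close>

lemma integral_conv_swap:
  fixes u k :: "real^3 \<Rightarrow> real"
  assumes [measurable]: "u \<in> borel_measurable borel" "k \<in> borel_measurable borel"
    and u: "integrable lcell u" and k: "integrable lcell k" and p: "periodic u"
    and f: "\<And>j. f j \<in> bump_algebra"
  shows "(LINT z|lcell. u z * cell_conv k f z) =
    (LINT w|lcell. tprod f w * (LINT x|lcell. k x * u (x + w)))"
proof -
  have fm [measurable]: "tprod f \<in> borel_measurable borel" by (rule borel_measurable_tprod[of f, OF f])
  obtain B where B: "0 \<le> B" "\<And>x. \<bar>tprod f x\<bar> \<le> B" by (rule tprod_bounded[of f]) (use f in auto)
  have us: "integrable lcell (\<lambda>w. u (x + w))" for x
    using integrable_cell_shift[OF assms(1) p, of x] u by (simp add: add.commute)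
  have up: "(LINT w|lcell. \<bar>u (x + w)\<bar>) = (LINT w|lcell. \<bar>u w\<bar>)" for x
    using integral_cell_shift[of "\<lambda>x. \<bar>u x\<bar>" x] p by (simp add: add.commute periodic_def)
  have fb: "\<bar>c * d * tprod f x\<bar> \<le> B * (\<bar>c\<bar> * \<bar>d\<bar>)" for c d x
    using mult_left_mono[OF B(2)[of x], of "\<bar>c\<bar> * \<bar>d\<bar>"] by (simp add: abs_mult mult_ac)
  let ?\<mu> = "lcell"
  have i1: "integrable ?\<mu> (\<lambda>x. u z * k x * tprod f (z - x))" for z
    using integrable_mult_tprod[OF k, of f z] f by (simp add: mult.assoc)
  have i2: "integrable ?\<mu> (\<lambda>w. k x * u (x + w) * tprod f w)" for x
    using integrable_mult_bounded[OF us[of x] _ B(2)] by (simp add: mult.assoc)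
  have "(LINT z|?\<mu>. u z * cell_conv k f z) = (LINT z|?\<mu>. LINT x|?\<mu>. u z * k x * tprod f (z - x))"
    by (simp add: cell_conv_def mult.assoc)
  also have "\<dots> = (LINT x|?\<mu>. LINT z|?\<mu>. u z * k x * tprod f (z - x))"
  proof (rule Fubini_cell[OF _ i1])
    show "(LINT x|?\<mu>. \<bar>u z * k x * tprod f (z - x)\<bar>) \<le> B * (\<bar>u z\<bar> * (LINT x|?\<mu>. \<bar>k x\<bar>))" for z
    proof -
      have "(LINT x|?\<mu>. \<bar>u z * k x * tprod f (z - x)\<bar>) \<le> (LINT x|?\<mu>. B * (\<bar>u z\<bar> * \<bar>k x\<bar>))"
        using i1 k fb by (intro integral_mono) auto
      then show ?thesis by simp
    qed
  qed (use u in auto)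
  also have "\<dots> = (LINT x|?\<mu>. LINT w|?\<mu>. k x * u (x + w) * tprod f w)"
  proof (rule Bochner_Integration.integral_cong[OF refl])
    fix x
    have "periodic (\<lambda>z. u z * k x * tprod f (z - x))"
      using p periodic_diff[OF tprod_periodic[of f, OF f]] unfolding periodic_def by simp
    then have "(LINT z|?\<mu>. u z * k x * tprod f (z - x)) =
        (LINT w|?\<mu>. u (w + x) * k x * tprod f (w + x - x))"
      by (intro integral_cell_shift[symmetric]) simp_all
    also have "\<dots> = (LINT w|?\<mu>. k x * u (x + w) * tprod f w)"
      by (rule Bochner_Integration.integral_cong[OF refl]) (simp add: add.commute mult.commute)
    finally show "(LINT z|?\<mu>. u z * k x * tprod f (z - x)) = (LINT w|?\<mu>. k x * u (x + w) * tprod f w)" .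
  qed
  also have "\<dots> = (LINT w|?\<mu>. LINT x|?\<mu>. k x * u (x + w) * tprod f w)"
  proof (rule Fubini_cell[OF _ i2])
    show "(LINT w|?\<mu>. \<bar>k x * u (x + w) * tprod f w\<bar>) \<le> B * (\<bar>k x\<bar> * (LINT w|?\<mu>. \<bar>u w\<bar>))" for x
    proof -
      have "(LINT w|?\<mu>. \<bar>k x * u (x + w) * tprod f w\<bar>) \<le> (LINT w|?\<mu>. B * (\<bar>k x\<bar> * \<bar>u (x + w)\<bar>))"
        using i2 us fb by (intro integral_mono) auto
      then show ?thesis by (simp add: up)
    qed
  qed (use k in auto)
  also have "\<dots> = (LINT w|?\<mu>. tprod f w * (LINT x|?\<mu>. k x * u (x + w)))"
    by (simp add: mult.commute[of _ "tprod f _"])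
  finally show ?thesis .
qed

section \<open>Pairing divergence-free fields with gradients\<close>

lemma borel_measurable_lcell [simp]: "borel_measurable lcell = borel_measurable borel"
  by (rule measurable_cong_sets) simp_all

lemma AE_lcell_iff: "(AE x in lcell. P x) \<longleftrightarrow> (AE x in lborel. x \<in> unit_cell \<longrightarrow> P x)"
  unfolding lcell_def by (subst AE_density) (simp_all add: indicator_def)

lemma integral_partial_eq_0:
  fixes H :: "real^3 \<Rightarrow> real"
  assumes H: "\<And>x. (H has_derivative D x) (at x)" and p: "periodic H"
    and m [measurable]: "(\<lambda>x. D x (axis i 1)) \<in> borel_measurable borel"
    and B: "\<And>x. \<bar>D x (axis i 1)\<bar> \<le> B"
  shows "(LINT x|lcell. D x (axis i 1)) = 0"
proof -
  let ?e = "axis i (1::real) :: real^3"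
  let ?h = "\<lambda>n. inverse (real (Suc n))"
  have cont: "continuous_on UNIV H"
    using H by (intro has_derivative_continuous_on) (auto intro: has_derivative_at_withinI)
  have [measurable]: "H \<in> borel_measurable borel" using cont by (rule borel_measurable_continuous_onI)
  have HD: "((\<lambda>t. H (x + t *\<^sub>R ?e)) has_real_derivative D (x + t *\<^sub>R ?e) ?e) (at t)" for x t
  proof -
    have "((\<lambda>t. x + t *\<^sub>R ?e) has_derivative (\<lambda>s. s *\<^sub>R ?e)) (at t)"
      by (auto intro!: derivative_eq_intros)
    from has_derivative_compose[OF this H]
    have "((\<lambda>t. H (x + t *\<^sub>R ?e)) has_derivative (\<lambda>s. D (x + t *\<^sub>R ?e) (s *\<^sub>R ?e))) (at t)" .
    moreover have "D (x + t *\<^sub>R ?e) (s *\<^sub>R ?e) = s * D (x + t *\<^sub>R ?e) ?e" for s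
      using linear_scale[OF has_derivative_linear[OF H]] by simp
    ultimately show ?thesis by (simp add: has_field_derivative_def mult.commute[of _ "D _ _"])
  qed
  have "(\<lambda>n. LINT x|lcell. (H (x + ?h n *\<^sub>R ?e) - H x) / ?h n) \<longlonglongrightarrow>
      (LINT x|lcell. D x ?e)"
  proof (rule integral_dominated_convergence)
    show "integrable lcell (\<lambda>x. B)" by simp
    show "AE x in lcell. (\<lambda>n. (H (x + ?h n *\<^sub>R ?e) - H x) / ?h n) \<longlonglongrightarrow> D x ?e"
    proof (rule AE_I2)
      fix x
      have "((\<lambda>h. (H (x + h *\<^sub>R ?e) - H x) / h) \<longlongrightarrow> D x ?e) (at 0)"
        using HD[of x 0] by (simp add: DERIV_def)
      moreover have "filterlim ?h (at 0) sequentially"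
        using LIMSEQ_inverse_real_of_nat by (simp add: filterlim_at)
      ultimately show "(\<lambda>n. (H (x + ?h n *\<^sub>R ?e) - H x) / ?h n) \<longlonglongrightarrow> D x ?e"
        by (rule filterlim_compose)
    qed
    show "AE x in lcell. norm ((H (x + ?h n *\<^sub>R ?e) - H x) / ?h n) \<le> B" for n
    proof (rule AE_I2)
      fix x
      obtain t where "H (x + ?h n *\<^sub>R ?e) - H (x + 0 *\<^sub>R ?e) = (?h n - 0) * D (x + t *\<^sub>R ?e) ?e"
        using MVT2[of 0 "?h n" "\<lambda>t. H (x + t *\<^sub>R ?e)" "\<lambda>t. D (x + t *\<^sub>R ?e) ?e"] HD by force
      then show "norm ((H (x + ?h n *\<^sub>R ?e) - H x) / ?h n) \<le> B"
        using B[of "x + t *\<^sub>R ?e"] by simp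
    qed
  qed measurable
  moreover have "(LINT x|lcell. (H (x + ?h n *\<^sub>R ?e) - H x) / ?h n) = 0" for n
  proof -
    have "compact (H ` unit_cell)"
      by (intro compact_continuous_image continuous_on_subset[OF cont] compact_unit_cell) simp
    then obtain C where C: "\<And>y. y \<in> H ` unit_cell \<Longrightarrow> norm y \<le> C"
      using compact_imp_bounded bounded_iff by metis
    have "integrable lcell H"
      by (rule cell.integrable_const_bound[of _ C])
        (simp_all add: AE_lcell_iff C flip: real_norm_def)
    then show ?thesis
      using integrable_cell_shift[OF _ p, of "?h n *\<^sub>R ?e"] integral_cell_shift[OF _ p, of "?h n *\<^sub>R ?e"]
      by simp
  qed
  ultimately have "(\<lambda>n::nat. 0) \<longlonglongrightarrow> (LINT x|lcell. D x ?e)" by (simp only:)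
  then show ?thesis by (simp add: LIMSEQ_const_iff)
qed

lemma integral_tprod_dprod:
  assumes f: "\<And>j. f j \<in> bump_algebra"
  shows "(LINT x|lcell. tprod (dprod i f) x) = 0"
proof -
  have d: "dprod i f j \<in> bump_algebra" for j using f by (simp add: bump_algebra_deriv)
  obtain B where B: "\<And>x. \<bar>tprod (dprod i f) x\<bar> \<le> B"
    by (rule tprod_bounded[of "dprod i f"]) (use d in auto)
  have "(LINT x|lcell. (\<Sum>k\<in>UNIV. tprod (dprod k f) x * axis i 1 $ k)) = 0"
    by (rule integral_partial_eq_0[OF has_derivative_tprod[of f, OF f] tprod_periodic[of f, OF f], of i B])
      (use B borel_measurable_tprod[of "dprod i f", OF d] in \<open>simp_all only: sum_mult_axis\<close>)
  then show ?thesis by (simp only: sum_mult_axis)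
qed

definition cell_L2 :: "(real^3 \<Rightarrow> real) \<Rightarrow> bool"
  where "cell_L2 f \<longleftrightarrow> f \<in> borel_measurable borel \<and> periodic f \<and> integrable lcell (\<lambda>x. (f x)\<^sup>2)"

lemma cell_L2_borel: "cell_L2 f \<Longrightarrow> f \<in> borel_measurable borel"
  and cell_L2_periodic: "cell_L2 f \<Longrightarrow> periodic f"
  and cell_L2_square: "cell_L2 f \<Longrightarrow> integrable lcell (\<lambda>x. (f x)\<^sup>2)"
  by (simp_all add: cell_L2_def)

lemma cell_L2_mult_integrable: "cell_L2 f \<Longrightarrow> cell_L2 g \<Longrightarrow> integrable lcell (\<lambda>x. f x * g x)"
  by (intro integrable_mult_L2) (simp_all add: cell_L2_def)

lemma cell_L2_const: "cell_L2 (\<lambda>x. c)"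
  by (simp add: cell_L2_def periodic_def)

lemma cell_L2_integrable: "cell_L2 f \<Longrightarrow> integrable lcell f"
  using cell_L2_mult_integrable[OF _ cell_L2_const[of 1]] by simp

lemma cell_L2_mult_bounded:
  assumes f: "cell_L2 f" and [measurable]: "h \<in> borel_measurable borel" and h: "periodic h" "\<And>x. \<bar>h x\<bar> \<le> B"
  shows "cell_L2 (\<lambda>x. f x * h x)"
proof -
  have [measurable]: "f \<in> borel_measurable borel" using f by (rule cell_L2_borel)
  have "(h x)\<^sup>2 \<le> B\<^sup>2" for x
    using h(2)[of x] by (metis abs_ge_zero abs_le_square_iff abs_of_nonneg order_trans)
  then have "integrable lcell (\<lambda>x. (f x)\<^sup>2 * (h x)\<^sup>2)"
    using f by (intro integrable_mult_bounded[where B = "B\<^sup>2"]) (auto simp: cell_L2_def)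
  then show ?thesis using f h by (simp add: cell_L2_def periodic_def power_mult_distrib)
qed

lemma cell_L2_diff:
  assumes "cell_L2 f" "cell_L2 h"
  shows "cell_L2 (\<lambda>x. f x - h x)"
proof -
  have [measurable]: "f \<in> borel_measurable borel" "h \<in> borel_measurable borel"
    using assms by (auto simp: cell_L2_def)
  have "integrable lcell (\<lambda>x. (f x - h x)\<^sup>2)"
  proof (rule Bochner_Integration.integrable_bound)
    show "integrable lcell (\<lambda>x. 2 * (f x)\<^sup>2 + 2 * (h x)\<^sup>2)" using assms by (simp add: cell_L2_def)
    show "AE x in lcell. norm ((f x - h x)\<^sup>2) \<le> norm (2 * (f x)\<^sup>2 + 2 * (h x)\<^sup>2)"
      using square_add_le[of "f x" "- h x" for x] by (intro AE_I2) simp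
  qed measurable
  then show ?thesis using assms by (simp add: cell_L2_def periodic_def)
qed

lemma cell_L2_mult_tprod:
  assumes "cell_L2 h" and f: "\<And>j. f j \<in> bump_algebra"
  shows "cell_L2 (\<lambda>x. h x * tprod f (a - x))"
proof -
  obtain B where "\<And>x. \<bar>tprod f x\<bar> \<le> B" by (rule tprod_bounded[of f]) (use f in auto)
  moreover have "(\<lambda>x. tprod f (a - x)) \<in> borel_measurable borel"
    using borel_measurable_tprod[of f, OF f] by measurable
  moreover have "periodic (\<lambda>x. tprod f (a - x))"
  proof -
    have "tprod f (a - (x + m)) = tprod f (a - x)" if "m \<in> lattice" for x m
    proof -
      have "tprod f (a - x + - m) = tprod f (a - x)"
        using tprod_periodic[of f, OF f] lattice_uminus[OF that] unfolding periodic_def by blast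
      then show ?thesis by (simp add: algebra_simps)
    qed
    then show ?thesis by (simp add: periodic_def)
  qed
  ultimately show ?thesis using assms(1) by (intro cell_L2_mult_bounded) auto
qed

lemma cell_conv_bounded:
  assumes w: "integrable lcell w" and f: "\<And>j. f j \<in> bump_algebra"
  obtains B where "\<And>z. \<bar>cell_conv w f z\<bar> \<le> B"
proof -
  obtain B where B: "0 \<le> B" "\<And>x. \<bar>tprod f x\<bar> \<le> B" by (rule tprod_bounded[of f]) (use f in auto)
  have "\<bar>cell_conv w f z\<bar> \<le> (LINT x|lcell. \<bar>w x\<bar> * B)" for z
  proof -
    have "\<bar>cell_conv w f z\<bar> \<le> (LINT x|lcell. \<bar>w x * tprod f (z - x)\<bar>)"
      unfolding cell_conv_def by (rule integral_abs_bound)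
    also have "\<dots> \<le> (LINT x|lcell. \<bar>w x\<bar> * B)"
    proof (rule integral_mono)
      show "integrable lcell (\<lambda>x. \<bar>w x * tprod f (z - x)\<bar>)"
        by (intro integrable_abs integrable_mult_tprod[of w f] w f)
      show "\<bar>w x * tprod f (z - x)\<bar> \<le> \<bar>w x\<bar> * B" for x
        using B(2)[of "z - x"] by (simp add: abs_mult mult_left_mono)
    qed (use w in simp)
    finally show ?thesis .
  qed
  then show ?thesis by (rule that)
qed

lemma borel_measurable_cell_conv:
  assumes w: "integrable lcell w" and f: "\<And>j. f j \<in> bump_algebra"
  shows "cell_conv w f \<in> borel_measurable borel"
proof (rule borel_measurable_continuous_onI)
  show "continuous_on UNIV (cell_conv w f)"
    using has_derivative_cell_conv[OF w, of f] f
    by (intro has_derivative_continuous_on) (auto intro: has_derivative_at_withinI)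
qed

lemma cell_L2_shift:
  assumes "cell_L2 u"
  shows "cell_L2 (\<lambda>x. u (x + w))" "(LINT x|lcell. (u (x + w))\<^sup>2) = (LINT x|lcell. (u x)\<^sup>2)"
proof -
  have m [measurable]: "u \<in> borel_measurable borel" and p: "periodic u"
    using assms by (auto simp: cell_L2_def)
  have p2: "periodic (\<lambda>x. (u x)\<^sup>2)" using p by (simp add: periodic_def)
  show "(LINT x|lcell. (u (x + w))\<^sup>2) = (LINT x|lcell. (u x)\<^sup>2)"
    by (rule integral_cell_shift[OF _ p2]) measurable
  have "integrable lcell (\<lambda>x. (u (x + w))\<^sup>2)"
    using integrable_cell_shift[OF _ p2, of w] assms by (simp add: cell_L2_def)
  moreover have "periodic (\<lambda>x. u (x + w))"
  proof -
    have "u (x + m + w) = u (x + w)" if "m \<in> lattice" for x m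
      using periodic_diff[OF p that, of x "- w"] by simp
    then show ?thesis by (simp add: periodic_def)
  qed
  ultimately show "cell_L2 (\<lambda>x. u (x + w))" by (simp add: cell_L2_def)
qed

lemma cell_L2_shift_pairing:
  assumes K: "cell_L2 K" and u: "cell_L2 u"
  shows "(\<lambda>w. LINT x|lcell. K x * u (x + w)) \<in> borel_measurable borel"
    and "\<bar>LINT x|lcell. K x * u (x + w)\<bar> \<le>
      ((LINT x|lcell. (K x)\<^sup>2) + (LINT x|lcell. (u x)\<^sup>2)) / 2"
proof -
  have [measurable]: "K \<in> borel_measurable borel" "u \<in> borel_measurable borel"
    using K u by (auto simp: cell_L2_def)
  have "(\<lambda>(w, x). K x * u (x + w)) \<in> borel_measurable (borel \<Otimes>\<^sub>M lcell)"
    by measurable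
  then show "(\<lambda>w. LINT x|lcell. K x * u (x + w)) \<in> borel_measurable borel"
    by (rule cell.borel_measurable_lebesgue_integral)
  show "\<bar>LINT x|lcell. K x * u (x + w)\<bar> \<le>
      ((LINT x|lcell. (K x)\<^sup>2) + (LINT x|lcell. (u x)\<^sup>2)) / 2"
    using integral_mult_L2_le[of K lcell "\<lambda>x. u (x + w)" 1] K cell_L2_shift[OF u, of w]
    by (simp add: cell_L2_def)
qed

definition cell_test :: "(real^3) set \<Rightarrow> (real^3 \<Rightarrow> real) set"
  where "cell_test U = {F. smooth F \<and> periodic F \<and>
    (\<exists>K. closed K \<and> K \<subseteq> U \<and> (\<forall>x\<in>K. \<forall>m\<in>lattice. x + m \<in> K) \<and> (\<forall>x. F x \<noteq> 0 \<longrightarrow> x \<in> K))}"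

text \<open>The only property of a Lipschitz boundary that the mollification argument uses: near \<open>a\<close>, the
  complement of \<open>U\<close> is pushed into \<open>S\<close> by arbitrarily small translations that may be perturbed.\<close>

definition pushes_into :: "(real^3) set \<Rightarrow> (real^3) set \<Rightarrow> real^3 \<Rightarrow> real \<Rightarrow> bool"
  where "pushes_into S U a d \<longleftrightarrow> (\<forall>e>0. \<exists>y\<^sub>0 r. r > 0 \<and> norm y\<^sub>0 < e \<and>
    (\<forall>x y. dist a x < d \<and> x \<notin> U \<and> dist y\<^sub>0 y < r \<longrightarrow> x - y \<in> S))"

locale div_free_pairing =
  fixes S U :: "(real^3) set" and u g :: "3 \<Rightarrow> real^3 \<Rightarrow> real" and \<psi> :: "real^3 \<Rightarrow> real"
  assumes S_lattice: "x \<in> S \<Longrightarrow> m \<in> lattice \<Longrightarrow> x + m \<in> S"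
    and U_lattice: "x \<in> U \<Longrightarrow> m \<in> lattice \<Longrightarrow> x + m \<in> U"
    and pushes: "\<exists>d>0. pushes_into S U a d"
    and u_L2: "cell_L2 (u i)" and g_L2: "cell_L2 (g i)" and \<psi>_L2: "cell_L2 \<psi>"
    and u_0: "AE x in lcell. x \<in> S \<longrightarrow> u i x = 0"
    and div_0: "smooth F \<Longrightarrow> periodic F \<Longrightarrow>
      (LINT x|lcell. (\<Sum>i\<in>UNIV. u i x * partial_deriv i F x)) = 0"
    and grad: "F \<in> cell_test U \<Longrightarrow>
      (LINT x|lcell. partial_deriv i F x * \<psi> x) = - (LINT x|lcell. F x * g i x)"
begin

lemma conv_potential_deriv:
  assumes \<kappa>: "\<And>a x. x \<in> bump_set \<kappa> a \<Longrightarrow> \<exists>m\<in>lattice. norm (x - a - m) < d"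
    and \<kappa>': "\<And>a x. x \<in> bump_set \<kappa>' a \<Longrightarrow> \<exists>m\<in>lattice. norm (x - a - m) < r"
    and push: "\<And>x y. dist a x < d \<Longrightarrow> x \<notin> U \<Longrightarrow> dist y\<^sub>0 y < r \<Longrightarrow> x - y \<in> S"
    and "z \<notin> S"
  defines "f \<equiv> bumps \<kappa> 0" and "k \<equiv> bumps \<kappa>' (- y\<^sub>0)"
  shows "cell_conv (\<lambda>x. \<psi> x * tprod f (a - x)) (dprod i k) z =
    cell_conv (\<lambda>x. g i x * tprod f (a - x) - \<psi> x * tprod (dprod i f) (a - x)) k z"
proof -
  let ?F = "\<lambda>x. tprod f (a - x) * tprod k (z - x)"
  have f: "f j \<in> bump_algebra" and k: "k j \<in> bump_algebra" for j
    by (simp_all add: f_def k_def bumps_in_bump_algebra)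
  have df: "dprod i f j \<in> bump_algebra" and dk: "dprod i k j \<in> bump_algebra" for j
    using f k by (simp_all add: bump_algebra_deriv)
  have F1: "tprod f (a - x) = tprod (bumps \<kappa> a) x" for x
    using bump_reflect[of \<kappa> 0] by (simp add: tprod_def f_def bumps_def)
  have F2: "tprod k (z - x) = tprod (bumps \<kappa>' (z + y\<^sub>0)) x" for x
    by (simp add: tprod_def k_def bumps_def bump_reflect)
  have F_eq: "?F = tprod (\<lambda>j s. bumps \<kappa> a j s * bumps \<kappa>' (z + y\<^sub>0) j s)"
    unfolding F1 F2 by (rule ext) (simp add: tprod_def prod.distrib)
  have alg: "(\<lambda>s. bumps \<kappa> a j s * bumps \<kappa>' (z + y\<^sub>0) j s) \<in> bump_algebra" for j
    by (intro bump_algebra.mult bumps_in_bump_algebra)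
  have "?F \<in> cell_test U"
  proof -
    let ?K = "bump_set \<kappa> a \<inter> bump_set \<kappa>' (z + y\<^sub>0)"
    have "?K \<subseteq> U"
    proof
      fix x assume x: "x \<in> ?K"
      obtain m where m: "m \<in> lattice" "norm (x - a - m) < d" using \<kappa> x by blast
      obtain n where n: "n \<in> lattice" "norm (x - (z + y\<^sub>0) - n) < r" using \<kappa>' x by blast
      show "x \<in> U"
      proof (rule ccontr)
        assume "x \<notin> U"
        then have "x - m \<notin> U" using U_lattice[of "x - m" m] m by auto
        moreover have "dist a (x - m) < d" using m by (simp add: dist_norm norm_minus_commute algebra_simps)
        moreover have "dist y\<^sub>0 (x - z - n) < r" using n by (simp add: dist_norm norm_minus_commute algebra_simps)
        ultimately have "(x - m) - (x - z - n) \<in> S" by (intro push)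
        then have "(x - m) - (x - z - n) + (m - n) \<in> S" using m n by (intro S_lattice lattice_diff)
        then show False using \<open>z \<notin> S\<close> by simp
      qed
    qed
    moreover have "smooth ?F" unfolding F_eq by (rule smooth_tprod) (rule alg)
    moreover have "periodic ?F" unfolding F_eq by (rule tprod_periodic) (rule alg)
    moreover have "closed ?K" by (intro closed_Int closed_bump_set)
    moreover have "\<forall>x\<in>?K. \<forall>m\<in>lattice. x + m \<in> ?K" by (auto intro: bump_set_lattice)
    moreover have "\<forall>x. ?F x \<noteq> 0 \<longrightarrow> x \<in> ?K" by (auto simp: F1 F2 tprod_bumps_support)
    ultimately show ?thesis unfolding cell_test_def by blast
  qed
  from grad[OF this, of i]
  have "(LINT x|lcell. partial_deriv i ?F x * \<psi> x) = - (LINT x|lcell. ?F x * g i x)" .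
  moreover have "partial_deriv i ?F x =
      - (tprod (dprod i f) (a - x) * tprod k (z - x) + tprod f (a - x) * tprod (dprod i k) (z - x))" for x
  proof -
    have r: "((\<lambda>x. tprod h (b - x)) has_derivative (\<lambda>v. \<Sum>i\<in>UNIV. tprod (dprod i h) (b - x) * (- v) $ i)) (at x)"
      if "\<And>j. h j \<in> bump_algebra" for h b
    proof -
      have "((\<lambda>x. b - x) has_derivative (\<lambda>v. - v)) (at x)" by (auto intro!: derivative_eq_intros)
      from has_derivative_compose[OF this has_derivative_tprod[of h, OF that]] show ?thesis .
    qed
    have s: "(\<Sum>i'\<in>UNIV. c i' * (- axis i 1) $ i') = - c i" for c :: "3 \<Rightarrow> real"
      using sum_mult_axis[of c i] by (simp add: sum_negf)
    show ?thesis
      using partial_deriv_eq[OF has_derivative_mult[OF r[of f a, OF f] r[of k z, OF k]], of i]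
      by (simp only: s)
  qed
  ultimately have "(LINT x|lcell. - (tprod (dprod i f) (a - x) * tprod k (z - x) +
      tprod f (a - x) * tprod (dprod i k) (z - x)) * \<psi> x) = - (LINT x|lcell. ?F x * g i x)"
    by (simp only:)
  moreover have "- (tprod (dprod i f) (a - x) * tprod k (z - x) + tprod f (a - x) * tprod (dprod i k) (z - x)) * \<psi> x =
      - (\<psi> x * tprod (dprod i f) (a - x) * tprod k (z - x) + \<psi> x * tprod f (a - x) * tprod (dprod i k) (z - x))" for x
    by (simp add: algebra_simps)
  moreover have "?F x * g i x = g i x * tprod f (a - x) * tprod k (z - x)" for x
    by (simp add: mult_ac)
  ultimately have *: "(LINT x|lcell. \<psi> x * tprod (dprod i f) (a - x) * tprod k (z - x) +
      \<psi> x * tprod f (a - x) * tprod (dprod i k) (z - x)) =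
      (LINT x|lcell. g i x * tprod f (a - x) * tprod k (z - x))"
    by (simp only: integral_minus neg_equal_iff_equal)
  have i1: "integrable lcell (\<lambda>x. \<psi> x * tprod (dprod i f) (a - x) * tprod k (z - x))"
    by (intro integrable_mult_tprod[of _ k] cell_L2_integrable cell_L2_mult_tprod \<psi>_L2 df k)
  have i2: "integrable lcell (\<lambda>x. \<psi> x * tprod f (a - x) * tprod (dprod i k) (z - x))"
    by (intro integrable_mult_tprod[of _ "dprod i k"] cell_L2_integrable cell_L2_mult_tprod \<psi>_L2 f dk)
  have i3: "integrable lcell (\<lambda>x. g i x * tprod f (a - x) * tprod k (z - x))"
    by (intro integrable_mult_tprod[of _ k] cell_L2_integrable cell_L2_mult_tprod g_L2 f k)
  show ?thesis
    unfolding cell_conv_def left_diff_distrib using * i1 i2 i3 by simp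
qed

text \<open>\<open>J w\<close> below pairs the translate of the field by \<open>w\<close> with the gradient of the localized potential.
  Testing the divergence with the convolution of that potential with a kernel \<open>k\<close> gives
  \<open>\<integral> k J = 0\<close> for kernels concentrated arbitrarily close to 0, and \<open>J\<close> is continuous at 0.\<close>

lemma local_pairing_eq_0:
  assumes \<kappa>: "\<And>a x. x \<in> bump_set \<kappa> a \<Longrightarrow> \<exists>m\<in>lattice. norm (x - a - m) < d"
    and push: "pushes_into S U a d"
  defines "f \<equiv> bumps \<kappa> 0"
  shows "(\<Sum>i\<in>UNIV. cell_conv (\<lambda>x. u i x * g i x) f a - cell_conv (\<lambda>x. u i x * \<psi> x) (dprod i f) a) = 0"
proof -
  have f: "f j \<in> bump_algebra" for j by (simp add: f_def bumps_in_bump_algebra)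
  have df: "dprod i f j \<in> bump_algebra" for i j using f by (simp add: bump_algebra_deriv)
  define K where "K i x = g i x * tprod f (a - x) - \<psi> x * tprod (dprod i f) (a - x)" for i x
  have K: "cell_L2 (K i)" for i
    unfolding K_def by (intro cell_L2_diff cell_L2_mult_tprod g_L2 \<psi>_L2 f df)
  define J where "J w = (\<Sum>i\<in>UNIV. LINT x|lcell. K i x * u i (x + w))" for w
  have J_lim: "(J \<longlongrightarrow> J 0) (at 0)"
    unfolding J_def using K u_L2 by (intro tendsto_sum) (simp add: tendsto_integral_shift cell_L2_def)
  have J_per: "J (w + m) = J w" if "m \<in> lattice" for w m
    using u_L2 that unfolding J_def cell_L2_def periodic_def by (simp add: add.assoc[symmetric])
  have weighted: "(LINT w|lcell. tprod k w * J w) = 0 \<and> 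
      integrable lcell (\<lambda>w. tprod k w * J w)"
    if \<kappa>': "\<And>a x. x \<in> bump_set \<kappa>' a \<Longrightarrow> \<exists>m\<in>lattice. norm (x - a - m) < r"
      and push: "\<And>x y. dist a x < d \<Longrightarrow> x \<notin> U \<Longrightarrow> dist y\<^sub>0 y < r \<Longrightarrow> x - y \<in> S"
      and k_def: "k = bumps \<kappa>' (- y\<^sub>0)" for \<kappa>' r y\<^sub>0 k
  proof -
    have k: "k j \<in> bump_algebra" for j by (simp add: k_def bumps_in_bump_algebra)
    have dk: "dprod i k j \<in> bump_algebra" for i j using k by (simp add: bump_algebra_deriv)
    let ?w = "\<lambda>x. \<psi> x * tprod f (a - x)"
    have w: "integrable lcell ?w"
      by (intro cell_L2_integrable cell_L2_mult_tprod \<psi>_L2 f)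
    have Ki: "integrable lcell (K i)" for i using K by (rule cell_L2_integrable)
    have [measurable]: "u i \<in> borel_measurable borel" for i using u_L2 by (rule cell_L2_borel)
    note [measurable] = borel_measurable_cell_conv[OF w dk] borel_measurable_cell_conv[OF Ki k]
    have "(LINT z|lcell. (\<Sum>i\<in>UNIV. u i z * cell_conv (K i) k z)) =
        (LINT z|lcell. (\<Sum>i\<in>UNIV. u i z * cell_conv ?w (dprod i k) z))"
    proof (rule integral_cong_AE)
      have "AE z in lcell. \<forall>i. z \<in> S \<longrightarrow> u i z = 0"
        by (rule eventually_all_finite) (rule u_0)
      then show "AE z in lcell. (\<Sum>i\<in>UNIV. u i z * cell_conv (K i) k z) =
          (\<Sum>i\<in>UNIV. u i z * cell_conv ?w (dprod i k) z)"
      proof eventually_elim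
        case (elim z)
        show ?case
        proof (cases "z \<in> S")
          case False
          have "cell_conv ?w (dprod i k) z = cell_conv (K i) k z" for i
            using conv_potential_deriv[OF \<kappa> \<kappa>' push False, where i = i and a = a]
            by (simp add: f_def k_def K_def[abs_def])
          then show ?thesis by simp
        qed (use elim in simp)
      qed
    qed measurable
    also have "\<dots> = 0"
      using div_0[OF smooth_cell_conv[OF w k] periodic_cell_conv[of k, OF k]]
      by (simp add: partial_deriv_cell_conv[OF w k])
    finally have "(LINT z|lcell. (\<Sum>i\<in>UNIV. u i z * cell_conv (K i) k z)) = 0" .
    moreover have "(LINT z|lcell. (\<Sum>i\<in>UNIV. u i z * cell_conv (K i) k z)) =
        (\<Sum>i\<in>UNIV. LINT z|lcell. u i z * cell_conv (K i) k z)"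
    proof (rule Bochner_Integration.integral_sum)
      fix i
      obtain B where "\<And>z. \<bar>cell_conv (K i) k z\<bar> \<le> B" by (rule cell_conv_bounded[OF Ki[of i], of k]) (use k in auto)
      then show "integrable lcell (\<lambda>z. u i z * cell_conv (K i) k z)"
        by (intro integrable_mult_bounded cell_L2_integrable u_L2) simp_all
    qed
    moreover have "(LINT z|lcell. u i z * cell_conv (K i) k z) =
        (LINT w|lcell. tprod k w * (LINT x|lcell. K i x * u i (x + w)))" for i
      using K u_L2 k
      by (intro integral_conv_swap cell_L2_integrable cell_L2_borel cell_L2_periodic)
    moreover have i: "integrable lcell (\<lambda>w. tprod k w * (LINT x|lcell. K i x * u i (x + w)))" for i
      by (rule integrable_mult_bounded[OF integrable_tprod[of k, OF k] _ cell_L2_shift_pairing(2)[OF K u_L2]])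
        (simp add: cell_L2_shift_pairing(1)[OF K u_L2])
    moreover have "(LINT w|lcell. tprod k w * J w) =
        (\<Sum>i\<in>UNIV. LINT w|lcell. tprod k w * (LINT x|lcell. K i x * u i (x + w)))"
      unfolding J_def sum_distrib_left using i by (intro Bochner_Integration.integral_sum)
    moreover have "integrable lcell (\<lambda>w. tprod k w * J w)"
      unfolding J_def sum_distrib_left using i by (intro Bochner_Integration.integrable_sum)
    ultimately show ?thesis by (simp only:)
  qed
  have "J 0 = 0"
  proof (rule ccontr)
    assume "J 0 \<noteq> 0"
    define s where "s = sgn (J 0)"
    have "((\<lambda>w. s * J w) \<longlongrightarrow> s * J 0) (at 0)" by (intro tendsto_intros J_lim)
    moreover have "0 < s * J 0" using \<open>J 0 \<noteq> 0\<close> by (simp add: s_def abs_sgn[symmetric] mult.commute)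
    ultimately have "\<forall>\<^sub>F w in at 0. 0 < s * J w" by (rule order_tendstoD)
    then obtain e where e: "0 < e" "\<And>w. w \<noteq> 0 \<Longrightarrow> norm w < e \<Longrightarrow> 0 < s * J w"
      unfolding eventually_at by auto
    have J_pos: "0 < s * J w" if "norm w < e" for w
      using e(2)[OF _ that] \<open>0 < s * J 0\<close> by (cases "w = 0") auto
    obtain y\<^sub>0 r where y0: "r > 0" "norm y\<^sub>0 < e / 2"
      "\<And>x y. dist a x < d \<Longrightarrow> x \<notin> U \<Longrightarrow> dist y\<^sub>0 y < r \<Longrightarrow> x - y \<in> S"
      using push e(1) unfolding pushes_into_def by (meson half_gt_zero)
    obtain \<kappa>' where k1: "\<kappa>' < 1" and k2: "\<And>a x. x \<in> bump_set \<kappa>' a \<Longrightarrow> \<exists>m\<in>lattice. norm (x - a - m) < min r (e / 2)"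
      by (rule bump_set_small[of "min r (e / 2)"]) (use y0 e in auto)
    define k where "k = bumps \<kappa>' (- y\<^sub>0)"
    have "\<And>a x. x \<in> bump_set \<kappa>' a \<Longrightarrow> \<exists>m\<in>lattice. norm (x - a - m) < r" using k2 by force
    from weighted[OF this y0(3) k_def]
    have int: "(LINT w|lcell. tprod k w * J w) = 0" "integrable lcell (\<lambda>w. tprod k w * J w)"
      by auto
    have pos: "0 < s * J w" if w: "tprod k w \<noteq> 0" for w
    proof -
      obtain m where m: "m \<in> lattice" "norm (w - - y\<^sub>0 - m) < min r (e / 2)"
        using k2[OF tprod_bumps_support[OF w[unfolded k_def]]] by blast
      have "norm (w - m) \<le> norm (w - - y\<^sub>0 - m) + norm y\<^sub>0"
        using norm_triangle_ineq4[of "w - - y\<^sub>0 - m" y\<^sub>0] by simp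
      then have "norm (w - m) < e" using m y0(2) by simp
      then show ?thesis using J_pos[of "w - m"] J_per[OF m(1), of "w - m"] by simp
    qed
    have "(LINT w|lcell. s * (tprod k w * J w)) = 0" using int by simp
    moreover have "0 \<le> s * (tprod k w * J w)" for w
    proof (cases "tprod k w = 0")
      case False
      then have "0 \<le> tprod k w * (s * J w)"
        using pos[of w] tprod_bumps_nonneg[of \<kappa>' "- y\<^sub>0" w] by (simp add: k_def)
      then show ?thesis by (simp add: mult_ac)
    qed simp
    ultimately have "AE w in lcell. s * (tprod k w * J w) = 0"
      using integral_nonneg_eq_0_iff_AE[of lcell "\<lambda>w. s * (tprod k w * J w)"] int(2) by simp
    then have "AE w in lcell. tprod k w = 0"
    proof eventually_elim
      case (elim w)
      then show ?case using pos[of w] by (cases "tprod k w = 0") auto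
    qed
    then have "(LINT w|lcell. tprod k w) = 0"
      by (rule integral_eq_zero_AE)
    then show False using bump_mass_pos[OF k1] by (simp add: k_def bump_mass_eq)
  qed
  moreover have "(LINT x|lcell. K i x * u i x) =
      cell_conv (\<lambda>x. u i x * g i x) f a - cell_conv (\<lambda>x. u i x * \<psi> x) (dprod i f) a" for i
  proof -
    have "integrable lcell (\<lambda>x. u i x * g i x * tprod f (a - x))"
      by (intro integrable_mult_tprod[of _ f] cell_L2_mult_integrable u_L2 g_L2 f)
    moreover have "integrable lcell (\<lambda>x. u i x * \<psi> x * tprod (dprod i f) (a - x))"
      by (intro integrable_mult_tprod[of _ "dprod i f"] cell_L2_mult_integrable u_L2 \<psi>_L2 df)
    ultimately have "cell_conv (\<lambda>x. u i x * g i x) f a - cell_conv (\<lambda>x. u i x * \<psi> x) (dprod i f) a =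
        (LINT x|lcell. u i x * g i x * tprod f (a - x) - u i x * \<psi> x * tprod (dprod i f) (a - x))"
      by (simp add: cell_conv_def)
    also have "\<dots> = (LINT x|lcell. K i x * u i x)"
      by (rule Bochner_Integration.integral_cong[OF refl]) (simp add: K_def algebra_simps)
    finally show ?thesis by simp
  qed
  ultimately show ?thesis by (simp add: J_def)
qed

text \<open>Averaging the local identity over the center \<open>a\<close> of the bump replaces a partition of unity: the
  bump averages to a positive constant and its derivatives average to 0.\<close>

theorem pairing_eq_0: "(LINT x|lcell. (\<Sum>i\<in>UNIV. u i x * g i x)) = 0"
proof -
  obtain \<G> where \<G>: "\<G> = {ball a d | a d. pushes_into S U a d}" by blast
  have "unit_cell \<subseteq> \<Union>\<G>"
  proof
    fix a obtain d where "d > 0" "pushes_into S U a d" using pushes by blast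
    then show "a \<in> \<Union>\<G>" unfolding \<G> using centre_in_ball by blast
  qed
  then obtain d where d: "0 < d" "\<And>a. a \<in> unit_cell \<Longrightarrow> \<exists>G\<in>\<G>. ball a d \<subseteq> G"
    by (rule Heine_Borel_lemma[OF compact_unit_cell]) (auto simp: \<G>)
  have push: "pushes_into S U a d" if a: "a \<in> unit_cell" for a
  proof -
    obtain b e where b: "pushes_into S U b e" "ball a d \<subseteq> ball b e" using d(2)[OF a] by (auto simp: \<G>)
    then have "dist b x < e" if "dist a x < d" for x using that by auto
    then show ?thesis using b(1) unfolding pushes_into_def by meson
  qed
  obtain \<kappa> where \<kappa>: "\<kappa> < 1" "\<And>a x. x \<in> bump_set \<kappa> a \<Longrightarrow> \<exists>m\<in>lattice. norm (x - a - m) < d"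
    by (rule bump_set_small[OF d(1)]) blast
  define f where "f = bumps \<kappa> 0"
  have f: "f j \<in> bump_algebra" for j by (simp add: f_def bumps_in_bump_algebra)
  have df: "dprod i f j \<in> bump_algebra" for i j using f by (simp add: bump_algebra_deriv)
  have ug: "integrable lcell (\<lambda>x. u i x * g i x)" and up: "integrable lcell (\<lambda>x. u i x * \<psi> x)" for i
    by (intro cell_L2_mult_integrable u_L2 g_L2 \<psi>_L2)+
  have [measurable]: "u i \<in> borel_measurable borel" "g i \<in> borel_measurable borel" "\<psi> \<in> borel_measurable borel" for i
    using u_L2 g_L2 \<psi>_L2 by (auto simp: cell_L2_def)
  have ci: "integrable lcell (cell_conv k h)"
    if k: "integrable lcell k" and h: "\<And>j. h j \<in> bump_algebra" for k h
  proof -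
    obtain B where "\<And>z. \<bar>cell_conv k h z\<bar> \<le> B" by (rule cell_conv_bounded[OF k, of h]) (use h in auto)
    then show ?thesis
      using borel_measurable_cell_conv[OF k, of h] h by (intro cell.integrable_const_bound[of _ B]) auto
  qed
  have mass: "(LINT a|lcell. cell_conv k h a) = (LINT x|lcell. tprod h x) * (LINT x|lcell. k x)"
    if "k \<in> borel_measurable borel" "integrable lcell k" "\<And>j. h j \<in> bump_algebra" for k h
    using integral_conv_swap[of "\<lambda>x. 1" k h] that by (simp add: periodic_def)
  have i1: "integrable lcell (cell_conv (\<lambda>x. u i x * g i x) f)"
    and i2: "integrable lcell (cell_conv (\<lambda>x. u i x * \<psi> x) (dprod i f))" for i
    by (intro ci ug up f df)+
  have m1: "(LINT a|lcell. cell_conv (\<lambda>x. u i x * g i x) f a) =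
      bump_mass \<kappa> * (LINT x|lcell. u i x * g i x)"
    and m2: "(LINT a|lcell. cell_conv (\<lambda>x. u i x * \<psi> x) (dprod i f) a) = 0" for i
    using mass[OF _ ug[of i], of f] mass[OF _ up[of i], of "dprod i f"] f df integral_tprod_dprod[of f i]
    by (simp_all add: bump_mass_def f_def)
  have "0 = (LINT a|lcell. (\<Sum>i\<in>UNIV. cell_conv (\<lambda>x. u i x * g i x) f a -
      cell_conv (\<lambda>x. u i x * \<psi> x) (dprod i f) a))"
    by (rule integral_eq_zero_AE[symmetric])
      (simp add: AE_lcell_iff local_pairing_eq_0[OF \<kappa>(2) push] f_def)
  also have "\<dots> = (\<Sum>i\<in>UNIV. (LINT a|lcell. cell_conv (\<lambda>x. u i x * g i x) f a) -
      (LINT a|lcell. cell_conv (\<lambda>x. u i x * \<psi> x) (dprod i f) a))"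
    using i1 i2 by simp
  also have "\<dots> = bump_mass \<kappa> * (\<Sum>i\<in>UNIV. LINT x|lcell. u i x * g i x)"
    by (simp add: m1 m2 sum_distrib_left)
  finally show ?thesis using bump_mass_pos[OF \<kappa>(1)] ug by simp
qed

end

section \<open>Lipschitz boundaries\<close>

lemma open_image_torus_proj:
  assumes "open N"
  shows "open (torus_proj ` N)"
proof -
  have "torus_proj -` torus_proj ` N = (\<Union>m\<in>lattice. (\<lambda>x. m + x) ` N)"
  proof (intro equalityI subsetI)
    fix x assume "x \<in> torus_proj -` torus_proj ` N"
    then obtain n where n: "n \<in> N" "torus_proj x = torus_proj n" by blast
    then have "x - n \<in> lattice" by (simp add: torus_proj_eq_lattice)
    moreover have "x = (x - n) + n" by simp
    ultimately show "x \<in> (\<Union>m\<in>lattice. (\<lambda>x. m + x) ` N)" using n(1) by blast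
  next
    fix x assume "x \<in> (\<Union>m\<in>lattice. (\<lambda>x. m + x) ` N)"
    then obtain m n where "m \<in> lattice" "n \<in> N" "x = m + n" by blast
    then have "torus_proj x = torus_proj n" by (simp add: torus_proj_eq_lattice)
    then show "x \<in> torus_proj -` torus_proj ` N" using \<open>n \<in> N\<close> by blast
  qed
  moreover have "open (\<Union>m\<in>lattice. (\<lambda>x. m + x) ` N)"
    using assms by (intro open_UN ballI open_translation)
  ultimately show ?thesis by (simp add: open_torus3_def)
qed

lemma open_vimage_torus_proj: "open V \<Longrightarrow> open (torus_proj -` V)"
  by (simp add: open_torus3_def)

lemma torus_proj_in_closure_iff: "torus_proj x \<in> closure V \<longleftrightarrow> x \<in> closure (torus_proj -` V)"
proof
  assume "torus_proj x \<in> closure V"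
  show "x \<in> closure (torus_proj -` V)"
  proof (rule ccontr)
    let ?N = "- closure (torus_proj -` V)"
    assume "x \<notin> closure (torus_proj -` V)"
    then have "torus_proj x \<in> torus_proj ` ?N" by blast
    moreover have "open (torus_proj ` ?N)" by (rule open_image_torus_proj) auto
    moreover have "V \<inter> torus_proj ` ?N = {}" using closure_subset[of "torus_proj -` V"] by auto
    ultimately show False
      using \<open>torus_proj x \<in> closure V\<close> open_Int_closure_eq_empty[of "torus_proj ` ?N" V] by blast
  qed
next
  have "closed (torus_proj -` closure V)"
    using open_vimage_torus_proj[OF open_Compl[OF closed_closure, of V]]
    by (simp add: closed_def vimage_Compl)
  moreover have "torus_proj -` V \<subseteq> torus_proj -` closure V" using closure_subset by blast
  moreover assume "x \<in> closure (torus_proj -` V)"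
  ultimately show "torus_proj x \<in> closure V" using closure_minimal by blast
qed

lemma image_outer_cell: "torus_proj ` outer_cell \<Sigma> = - closure (torus_proj ` \<Sigma>)"
proof
  show "torus_proj ` outer_cell \<Sigma> \<subseteq> - closure (torus_proj ` \<Sigma>)"
    by (auto simp: outer_cell_def)
  show "- closure (torus_proj ` \<Sigma>) \<subseteq> torus_proj ` outer_cell \<Sigma>"
  proof
    fix p assume p: "p \<in> - closure (torus_proj ` \<Sigma>)"
    have "p \<in> torus_proj ` unit_cell" by (simp add: torus_proj_unit_cell)
    then obtain y where "y \<in> unit_cell" "p = torus_proj y" by blast
    then show "p \<in> torus_proj ` outer_cell \<Sigma>" using p by (auto simp: outer_cell_def)
  qed
qed

lemma norm_pair_le: "norm (y $ 1, y $ 2) \<le> norm (y :: real^3)"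
  unfolding norm_Pair norm_vec_def L2_set_def sum_3 by (intro real_sqrt_le_mono) simp

lemma lipschitz_boundary_chart:
  assumes lip: "lipschitz_boundary V" and a: "torus_proj a \<in> frontier V"
  obtains T :: "real^3 \<Rightarrow> real^3" and g C d
  where "orthogonal_transformation T" "C-lipschitz_on UNIV g" "0 < d"
    "\<And>z. dist a z < d \<Longrightarrow> torus_proj z \<in> V \<longleftrightarrow> T (z - a) $ 3 < g (T (z - a) $ 1, T (z - a) $ 2)"
proof -
  from lip a obtain T :: "real^3 \<Rightarrow> real^3" and g :: "real \<times> real \<Rightarrow> real" and C r h
    where T: "orthogonal_transformation T" and g: "C-lipschitz_on UNIV g" and rh: "0 < r" "0 < h"
      and chart: "\<And>z. let y = T (z - a) in norm (y $ 1, y $ 2) < r \<and> \<bar>y $ 3\<bar> < h \<longrightarrow>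
          (torus_proj z \<in> V \<longleftrightarrow> y $ 3 < g (y $ 1, y $ 2))"
    unfolding lipschitz_boundary_def by blast
  have "torus_proj z \<in> V \<longleftrightarrow> T (z - a) $ 3 < g (T (z - a) $ 1, T (z - a) $ 2)"
    if "dist a z < min r h" for z
  proof -
    have "norm (T (z - a)) < min r h"
      using that orthogonal_transformation_norm[OF T] by (simp add: dist_norm norm_minus_commute)
    then show ?thesis
      using chart[of z] norm_pair_le[of "T (z - a)"] component_le_norm_cart[of "T (z - a)" 3]
      by (simp add: Let_def)
  qed
  then show ?thesis using that[OF T g, of "min r h"] rh by simp
qed

lemma lipschitz_graph_negligible:
  fixes T :: "real^3 \<Rightarrow> real^3" and g :: "real \<times> real \<Rightarrow> real"
  assumes T: "orthogonal_transformation T" and g: "C-lipschitz_on UNIV g"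
  shows "negligible {z. T (z - a) $ 3 = g (T (z - a) $ 1, T (z - a) $ 2)}"
proof -
  let ?P = "{y :: real^3. y $ 3 = 0}"
  let ?\<phi> = "\<lambda>y :: real^3. vector [y $ 1, y $ 2, g (y $ 1, y $ 2)] :: real^3"
  let ?f = "\<lambda>y. a + inv T (?\<phi> y)"
  have inv: "orthogonal_transformation (inv T)" by (rule orthogonal_transformation_inv[OF T])
  have "negligible ?P"
    by (rule negligible_standard_hyperplane_cart)
  moreover have "norm (?f y - ?f x) \<le> (2 + C) * norm (y - x)" for x y
  proof -
    have "?f y - ?f x = inv T (?\<phi> y - ?\<phi> x)"
      using linear_diff[OF orthogonal_transformation_linear[OF inv]] by simp
    then have "norm (?f y - ?f x) = norm (?\<phi> y - ?\<phi> x)"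
      using orthogonal_transformation_norm[OF inv] by simp
    also have "\<dots> \<le> (\<Sum>i\<in>UNIV. \<bar>(?\<phi> y - ?\<phi> x) $ i\<bar>)" by (rule norm_le_l1_cart)
    also have "\<dots> = \<bar>(y - x) $ 1\<bar> + \<bar>(y - x) $ 2\<bar> + \<bar>g (y $ 1, y $ 2) - g (x $ 1, x $ 2)\<bar>"
      by (simp add: sum_3)
    also have "\<bar>g (y $ 1, y $ 2) - g (x $ 1, x $ 2)\<bar> \<le> C * norm ((y - x) $ 1, (y - x) $ 2)"
      using lipschitz_onD[OF g, of "(y $ 1, y $ 2)" "(x $ 1, x $ 2)"] by (simp add: dist_norm)
    also have "\<dots> \<le> C * norm (y - x)"
      using norm_pair_le lipschitz_on_nonneg[OF g] by (rule mult_left_mono)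
    also have "\<bar>(y - x) $ 1\<bar> + \<bar>(y - x) $ 2\<bar> + C * norm (y - x) \<le> (2 + C) * norm (y - x)"
      using component_le_norm_cart[of "y - x" 1] component_le_norm_cart[of "y - x" 2]
      by (simp add: distrib_right)
    finally show ?thesis by simp
  qed
  ultimately have "negligible (?f ` ?P)"
    by (intro negligible_locally_Lipschitz_image) (auto intro!: exI[of _ UNIV])
  moreover have "{z. T (z - a) $ 3 = g (T (z - a) $ 1, T (z - a) $ 2)} \<subseteq> ?f ` ?P"
  proof
    fix z assume z: "z \<in> {z. T (z - a) $ 3 = g (T (z - a) $ 1, T (z - a) $ 2)}"
    let ?Y = "T (z - a)"
    let ?y = "vector [?Y $ 1, ?Y $ 2, 0] :: real^3"
    have "?\<phi> ?y = ?Y" using z by (simp add: vec_eq_iff forall_3)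
    moreover have "inv T ?Y = z - a"
      using orthogonal_transformation_inj[OF T] by (simp add: inv_f_f)
    ultimately have "z = ?f ?y" by simp
    then show "z \<in> ?f ` ?P" by (rule image_eqI) simp
  qed
  ultimately show ?thesis by (rule negligible_subset)
qed

lemma above_chart_not_in_closure:
  fixes T :: "real^3 \<Rightarrow> real^3" and g :: "real \<times> real \<Rightarrow> real"
  assumes T: "orthogonal_transformation T" and g: "C-lipschitz_on UNIV g"
    and chart: "\<And>z. dist a z < d \<Longrightarrow>
      torus_proj z \<in> V \<longleftrightarrow> T (z - a) $ 3 < g (T (z - a) $ 1, T (z - a) $ 2)"
    and z: "dist a z < d" "g (T (z - a) $ 1, T (z - a) $ 2) < T (z - a) $ 3"
  shows "torus_proj z \<notin> closure V"
proof -
  let ?N = "ball a d \<inter> {z. g (T (z - a) $ 1, T (z - a) $ 2) < T (z - a) $ 3}"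
  have T_cont: "continuous_on UNIV (\<lambda>z. T (z - a))"
    using linear_continuous_on_compose[OF _ orthogonal_transformation_linear[OF T], of UNIV "\<lambda>z. z - a"]
    by (simp add: continuous_intros)
  have "continuous_on UNIV (\<lambda>z. g (T (z - a) $ 1, T (z - a) $ 2))"
    by (rule continuous_on_compose2[OF lipschitz_on_continuous_on[OF g]])
      (auto intro!: continuous_intros T_cont)
  then have "open ?N"
    by (intro open_Int open_ball open_Collect_less continuous_intros T_cont)
  moreover have "?N \<inter> torus_proj -` V = {}" using chart by force
  moreover have "z \<in> ?N" using z by simp
  ultimately have "z \<notin> closure (torus_proj -` V)"
    using open_Int_closure_eq_empty[of ?N "torus_proj -` V"] by blast
  then show ?thesis by (simp add: torus_proj_in_closure_iff)
qed

lemma frontier_negligible: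
  assumes lip: "lipschitz_boundary V" and "open V"
  shows "negligible (torus_proj -` frontier V)"
proof (subst locally_negligible_alt, intro ballI)
  let ?F = "torus_proj -` frontier V"
  fix a assume a: "a \<in> ?F"
  obtain T :: "real^3 \<Rightarrow> real^3" and g C d
    where c: "orthogonal_transformation T" "C-lipschitz_on UNIV g" "0 < d"
      "\<And>z. dist a z < d \<Longrightarrow> torus_proj z \<in> V \<longleftrightarrow> T (z - a) $ 3 < g (T (z - a) $ 1, T (z - a) $ 2)"
    by (rule lipschitz_boundary_chart[OF lip, of a]) (use a in simp, rule that)
  have "?F \<inter> ball a d \<subseteq> {z. T (z - a) $ 3 = g (T (z - a) $ 1, T (z - a) $ 2)}"
  proof
    fix z assume z: "z \<in> ?F \<inter> ball a d"
    then have "torus_proj z \<in> closure V" "torus_proj z \<notin> V"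
      using \<open>open V\<close> by (auto simp: frontier_def interior_open)
    moreover have "dist a z < d" using z by simp
    ultimately show "z \<in> {z. T (z - a) $ 3 = g (T (z - a) $ 1, T (z - a) $ 2)}"
      using above_chart_not_in_closure[OF c(1,2,4)] c(4)[of z] by force
  qed
  then have "negligible (?F \<inter> ball a d)"
    using lipschitz_graph_negligible[OF c(1,2)] negligible_subset by blast
  moreover have "openin (top_of_set ?F) (?F \<inter> ball a d)" by (intro openin_open_Int open_ball)
  moreover have "a \<in> ?F \<inter> ball a d" using a c(3) by simp
  ultimately show "\<exists>N. openin (top_of_set ?F) N \<and> a \<in> N \<and> negligible N" by blast
qed

lemma pushes_into_frontier:
  assumes lip: "lipschitz_boundary V" and a: "torus_proj a \<in> frontier V"
  shows "\<exists>d>0. pushes_into (torus_proj -` V) (torus_proj -` (- closure V)) a d"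
proof -
  obtain T :: "real^3 \<Rightarrow> real^3" and g C d
    where T: "orthogonal_transformation T" and g: "C-lipschitz_on UNIV g" and d: "0 < d"
      and chart: "\<And>z. dist a z < d \<Longrightarrow>
        torus_proj z \<in> V \<longleftrightarrow> T (z - a) $ 3 < g (T (z - a) $ 1, T (z - a) $ 2)"
    by (rule lipschitz_boundary_chart[OF lip a]) (rule that)
  have lin: "linear T" by (rule orthogonal_transformation_linear[OF T])
  have C: "0 \<le> C" by (rule lipschitz_on_nonneg[OF g])
  have "pushes_into (torus_proj -` V) (torus_proj -` (- closure V)) a (d / 2)"
    unfolding pushes_into_def
  proof (intro allI impI)
    fix e :: real assume "0 < e"
    define t where "t = min e (d / 2) / 2"
    have t: "0 < t" "t < e" "t \<le> d / 4" using \<open>0 < e\<close> d by (auto simp: t_def)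
    obtain y\<^sub>0 where y0: "T y\<^sub>0 = t *\<^sub>R axis 3 1"
      using orthogonal_transformation_surj[OF T] by (metis surjD)
    have "norm y\<^sub>0 = t"
      using orthogonal_transformation_norm[OF T, of y\<^sub>0] t(1) by (simp add: y0)
    define r where "r = t / (2 + C)"
    have r0: "0 < r" using t C by (simp add: r_def)
    have "r * (2 + C) = t" using C by (simp add: r_def)
    moreover have "0 \<le> C * r" using C r0 by simp
    ultimately have r: "0 < r" "r \<le> t / 2" "r + C * r < t"
      using r0 by (simp_all add: algebra_simps)
    have "x - y \<in> torus_proj -` V"
      if x: "dist a x < d / 2" "x \<notin> torus_proj -` (- closure V)" and y: "dist y\<^sub>0 y < r" for x y
    proof -
      let ?X = "T (x - a)"
      let ?E = "T (y - y\<^sub>0)"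
      let ?Z = "T (x - y - a)"
      have nE: "norm ?E < r"
        using y orthogonal_transformation_norm[OF T] by (simp add: dist_norm norm_minus_commute)
      have Z: "?Z = ?X - t *\<^sub>R axis 3 1 - ?E"
      proof -
        have "x - y - a = (x - a) - y\<^sub>0 - (y - y\<^sub>0)" by simp
        then show ?thesis by (simp only: linear_diff[OF lin] y0[symmetric])
      qed
      have "?X $ 3 \<le> g (?X $ 1, ?X $ 2)"
        using above_chart_not_in_closure[OF T g chart] x d by force
      moreover have "\<bar>g (?Z $ 1, ?Z $ 2) - g (?X $ 1, ?X $ 2)\<bar> \<le> C * norm (?E $ 1, ?E $ 2)"
        using lipschitz_onD[OF g, of "(?Z $ 1, ?Z $ 2)" "(?X $ 1, ?X $ 2)"]
        by (simp add: dist_norm Z axis_def norm_Pair)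
      moreover have "C * norm (?E $ 1, ?E $ 2) \<le> C * r"
        using norm_pair_le[of ?E] nE C by (intro mult_left_mono) auto
      moreover have "?Z $ 3 = ?X $ 3 - t - ?E $ 3" by (simp add: Z axis_def)
      moreover have "\<bar>?E $ 3\<bar> < r" using component_le_norm_cart[of ?E 3] nE by linarith
      ultimately have "?Z $ 3 < g (?Z $ 1, ?Z $ 2)" using r by linarith
      moreover have "dist a (x - y) < d"
      proof -
        have "dist a (x - y) = norm ((x - a) - y\<^sub>0 - (y - y\<^sub>0))" by (simp add: dist_norm norm_minus_commute algebra_simps)
        also have "\<dots> \<le> norm (x - a) + norm y\<^sub>0 + norm (y - y\<^sub>0)"
          by (meson add_right_mono norm_triangle_ineq4 order_trans)
        also have "\<dots> < d / 2 + t + r"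
          using x(1) y \<open>norm y\<^sub>0 = t\<close> by (simp add: dist_norm norm_minus_commute)
        also have "\<dots> \<le> d" using t r by simp
        finally show ?thesis .
      qed
      ultimately show ?thesis using chart[of "x - y"] by simp
    qed
    then show "\<exists>y\<^sub>0 r. 0 < r \<and> norm y\<^sub>0 < e \<and> (\<forall>x y. dist a x < d / 2 \<and>
        x \<notin> torus_proj -` (- closure V) \<and> dist y\<^sub>0 y < r \<longrightarrow> x - y \<in> torus_proj -` V)"
      using r(1) t(2) \<open>norm y\<^sub>0 = t\<close> by blast
  qed
  then show ?thesis using d half_gt_zero by blast
qed

lemma lipschitz_boundary_pushes:
  assumes lip: "lipschitz_boundary V" and "open V"
  shows "\<exists>d>0. pushes_into (torus_proj -` V) (torus_proj -` (- closure V)) a d"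
proof -
  let ?S = "torus_proj -` V" and ?U = "torus_proj -` (- closure V)"
  consider "a \<in> ?U" | "a \<in> ?S" | "torus_proj a \<in> frontier V"
    using \<open>open V\<close> by (auto simp: frontier_def interior_open)
  then show ?thesis
  proof cases
    case 1
    have "open ?U" by (intro open_vimage_torus_proj open_Compl closed_closure)
    then obtain d where d: "d > 0" "ball a d \<subseteq> ?U" using 1 openE by blast
    then have "pushes_into ?S ?U a d"
      unfolding pushes_into_def
      by (intro allI impI exI[of _ "0::real^3"] exI[of _ "1::real"]) auto
    then show ?thesis using d(1) by blast
  next
    case 2
    have "open ?S" by (rule open_vimage_torus_proj) fact
    then obtain d where d: "d > 0" "ball a d \<subseteq> ?S" using 2 openE by blast
    have "pushes_into ?S ?U a (d / 2)"
      unfolding pushes_into_def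
    proof (intro allI impI)
      fix e :: real assume "0 < e"
      have "x - y \<in> ?S" if "dist a x < d / 2" "dist 0 y < d / 2" for x y
      proof -
        have "dist a (x - y) \<le> dist a x + norm y"
          using norm_triangle_ineq[of "a - x" y] by (simp add: dist_norm algebra_simps)
        then have "x - y \<in> ball a d" using that by simp
        then show ?thesis using d(2) by blast
      qed
      then show "\<exists>y\<^sub>0 r. 0 < r \<and> norm y\<^sub>0 < e \<and>
          (\<forall>x y. dist a x < d / 2 \<and> x \<notin> ?U \<and> dist y\<^sub>0 y < r \<longrightarrow> x - y \<in> ?S)"
        using \<open>0 < e\<close> d(1) by (intro exI[of _ 0] exI[of _ "d / 2"]) auto
    qed
    then show ?thesis using d(1) half_gt_zero by blast
  next
    case 3
    then show ?thesis by (rule pushes_into_frontier[OF lip])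
  qed
qed

section \<open>Potentials in the absence of loops\<close>

lemma connected_component_translate:
  assumes inv: "\<And>x. x \<in> U \<Longrightarrow> x + m \<in> U" and "connected_component U x y"
  shows "connected_component U (x + m) (y + (m :: 'a::real_normed_vector))"
proof -
  obtain T where T: "connected T" "T \<subseteq> U" "x \<in> T" "y \<in> T"
    using assms(2) by (auto simp: connected_component_def)
  have "connected ((+) m ` T)" using T(1) by (intro connected_continuous_image continuous_intros)
  moreover have "(+) m ` T \<subseteq> U" using T(2) inv by (auto simp: add.commute)
  moreover have "x + m \<in> (+) m ` T" "y + m \<in> (+) m ` T" using T(3,4) by (auto simp: add.commute)
  ultimately show ?thesis by (rule connected_componentI)
qed

locale cell_section =
  fixes U :: "(real^3) set" and s :: "real^3 \<Rightarrow> real^3"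
  assumes U_open: "open U" and U_lattice: "x \<in> U \<Longrightarrow> m \<in> lattice \<Longrightarrow> x + m \<in> U"
    and s_periodic: "x \<in> U \<Longrightarrow> m \<in> lattice \<Longrightarrow> s (x + m) = s x"
    and s_local: "x \<in> U \<Longrightarrow> \<exists>d>0. ball x d \<subseteq> U \<and> (\<forall>y\<in>ball x d. s y = y + (s x - x))"

text \<open>The lattice acts freely on the connected components of \<open>U\<close>; \<open>b x\<close> selects one component from
  the orbit of the component of \<open>x\<close>, and \<open>s x\<close> is the translate of \<open>x\<close> lying in it.\<close>

lemma lattice_section:
  assumes U_open: "open U" and U_lattice: "\<And>x m. x \<in> U \<Longrightarrow> m \<in> lattice \<Longrightarrow> x + m \<in> U"
    and free: "\<And>x m. m \<in> lattice \<Longrightarrow> connected_component U x (x + m) \<Longrightarrow> m = 0"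
  shows "\<exists>s. cell_section U s"
proof -
  let ?c = "connected_component U"
  define orb where "orb x = {y. \<exists>m\<in>lattice. ?c (x + m) y}" for x
  define b where "b x = (SOME y. y \<in> orb x)" for x
  define s where "s x = (THE z. z - x \<in> lattice \<and> ?c z (b x))" for x
  have trans: "?c (x + m) (y + m)" if "m \<in> lattice" "?c x y" for x y m
    using connected_component_translate[of U m] U_lattice that by blast
  have ex: "\<exists>z. z - x \<in> lattice \<and> ?c z (b x)" if "x \<in> U" for x
  proof -
    have "(0::real^3) \<in> lattice" by (simp add: lattice_def)
    moreover have "?c (x + 0) x" using that by (simp add: connected_component_refl)
    ultimately have "x \<in> orb x" unfolding orb_def by blast
    then have "b x \<in> orb x" unfolding b_def by (rule someI)
    then obtain m where "m \<in> lattice" "?c (x + m) (b x)" by (auto simp: orb_def)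
    then show ?thesis by (intro exI[of _ "x + m"]) simp
  qed
  have uniq: "z = z'" if "z - x \<in> lattice" "?c z (b x)" "z' - x \<in> lattice" "?c z' (b x)" for x z z'
  proof -
    have "?c z z'" using that connected_component_sym connected_component_trans by metis
    moreover have "z' - z \<in> lattice" using lattice_diff[OF that(3,1)] by simp
    ultimately have "z' - z = 0" using free[of "z' - z" z] by simp
    then show ?thesis by simp
  qed
  have s: "s x - x \<in> lattice" "?c (s x) (b x)" if "x \<in> U" for x
  proof -
    have "\<exists>!z. z - x \<in> lattice \<and> ?c z (b x)" using ex[OF that] uniq by blast
    then have "s x - x \<in> lattice \<and> ?c (s x) (b x)" unfolding s_def by (rule theI')
    then show "s x - x \<in> lattice" "?c (s x) (b x)" by auto
  qed
  have s_eq: "s x = z" if "x \<in> U" "z - x \<in> lattice" "?c z (b x)" for x z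
    using uniq[OF s[OF that(1)] that(2,3)] .
  show ?thesis
  proof (rule exI, rule cell_section.intro)
    fix x m :: "real^3" assume x: "x \<in> U" and m: "m \<in> lattice"
    have "orb (x + m) = orb x"
    proof (intro equalityI subsetI)
      fix y assume "y \<in> orb (x + m)"
      then obtain n where "n \<in> lattice" "?c (x + (m + n)) y" by (auto simp: orb_def add.assoc)
      then show "y \<in> orb x" using lattice_add[OF m] unfolding orb_def by blast
    next
      fix y assume "y \<in> orb x"
      then obtain n where "n \<in> lattice" "?c (x + m + (n - m)) y" by (auto simp: orb_def)
      then show "y \<in> orb (x + m)" using lattice_diff[OF _ m] unfolding orb_def by blast
    qed
    then have b: "b (x + m) = b x" by (simp add: b_def)
    show "s (x + m) = s x"
    proof (rule s_eq)
      show "x + m \<in> U" by (rule U_lattice[OF x m])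
      show "s x - (x + m) \<in> lattice" using lattice_diff[OF s(1)[OF x] m] by (simp add: algebra_simps)
      show "?c (s x) (b (x + m))" using s(2)[OF x] by (simp add: b)
    qed
  next
    fix x assume x: "x \<in> U"
    obtain d where d: "d > 0" "ball x d \<subseteq> U" using U_open x openE by blast
    have "s y = y + (s x - x)" if y: "y \<in> ball x d" for y
    proof -
      have "x \<in> ball x d" using d by simp
      then have xy: "?c x y" using d(2) y connected_ball connected_componentI by metis
      have "orb y = orb x"
      proof (intro equalityI subsetI)
        fix z assume "z \<in> orb y"
        then obtain n where "n \<in> lattice" "?c (y + n) z" by (auto simp: orb_def)
        then show "z \<in> orb x" using trans[OF _ xy] connected_component_trans unfolding orb_def by blast
      next
        fix z assume "z \<in> orb x"
        then obtain n where "n \<in> lattice" "?c (x + n) z" by (auto simp: orb_def)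
        then show "z \<in> orb y"
          using trans[OF _ connected_component_sym[OF xy]] connected_component_trans unfolding orb_def by blast
      qed
      then have b: "b y = b x" by (simp add: b_def)
      show ?thesis
      proof (rule s_eq)
        show "y \<in> U" using y d(2) by blast
        show "y + (s x - x) - y \<in> lattice" using s(1)[OF x] by simp
        have "?c (y + (s x - x)) (x + (s x - x))"
          by (rule trans[OF s(1)[OF x] connected_component_sym[OF xy]])
        then show "?c (y + (s x - x)) (b y)"
          using s(2)[OF x] connected_component_trans by (simp add: b) blast
      qed
    qed
    then show "\<exists>d>0. ball x d \<subseteq> U \<and> (\<forall>y\<in>ball x d. s y = y + (s x - x))" using d by blast
  qed (fact U_open, rule U_lattice)
qed

lemma no_loops_free:
  assumes "open (torus_proj ` Q)" and no_loops: "loop_directions Q = {}"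
    and m: "m \<in> lattice" and c: "connected_component (torus_proj -` (torus_proj ` Q)) x (x + m)"
  shows "m = 0"
proof (rule ccontr)
  let ?U = "torus_proj -` (torus_proj ` Q)"
  assume "m \<noteq> 0"
  then obtain k where k: "m $ k \<noteq> 0" by (auto simp: vec_eq_iff)
  have "open ?U" using assms(1) by (rule open_vimage_torus_proj)
  let ?C = "connected_component_set ?U x"
  have "open ?C" "connected ?C" "x \<in> ?C" "x + m \<in> ?C" "?C \<subseteq> ?U"
    using \<open>open ?U\<close> c connected_component_in[OF c] connected_component_subset[of ?U x]
    by (simp_all add: open_connected_component connected_component_refl)
  then obtain g where g: "polynomial_function g" "path_image g \<subseteq> ?U" "pathstart g = x" "pathfinish g = x + m"
    using connected_open_polynomial_connected[of ?C x "x + m"] by blast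
  have cont: "continuous_on {0..1} g" by (rule continuous_on_polymonial_function[OF g(1)])
  obtain g' where g': "polynomial_function g'" "\<And>t. (g has_vector_derivative g' t) (at t)"
    using has_vector_derivative_polynomial_function[OF g(1)] by blast
  have "g C1_differentiable_on {0..1}"
    unfolding C1_differentiable_on_def using g' continuous_on_polymonial_function by blast
  then have "g piecewise_C1_differentiable_on {0..1}" by (rule C1_differentiable_imp_piecewise)
  moreover have "path (torus_proj \<circ> g)"
    unfolding path_def by (rule continuous_on_compose[OF cont continuous_on_subset[OF continuous_on_torus_proj]]) simp
  moreover have "path_image (torus_proj \<circ> g) \<subseteq> torus_proj ` Q"
    using g(2) by (auto simp: path_image_def)
  moreover have "(torus_proj \<circ> g) 0 = (torus_proj \<circ> g) 1"
    using g(3,4) torus_proj_add_lattice[OF m] by (simp add: pathstart_def pathfinish_def)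
  moreover have "(g 1 - g 0) \<bullet> axis k 1 \<noteq> 0"
    using g(3,4) k by (simp add: pathstart_def pathfinish_def inner_axis)
  ultimately have "is_loop k Q (torus_proj \<circ> g)"
    unfolding is_loop_def using cont by (intro conjI exI[of _ g]) auto
  then show False using no_loops by (auto simp: loop_directions_def)
qed

lemma periodic_continuous_bounded:
  fixes f :: "real^3 \<Rightarrow> real"
  assumes "continuous_on UNIV f" and p: "periodic f"
  obtains B where "\<And>x. \<bar>f x\<bar> \<le> B"
proof -
  have "compact (f ` unit_cell)"
    by (intro compact_continuous_image continuous_on_subset[OF assms(1)] compact_unit_cell) simp
  then have "bounded (f ` unit_cell)" by (rule compact_imp_bounded)
  then obtain B where B: "\<forall>y\<in>f ` unit_cell. norm y \<le> B" unfolding bounded_iff by blast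
  have "\<bar>f x\<bar> \<le> B" for x
  proof -
    have "torus_proj x \<in> torus_proj ` unit_cell" by (simp add: torus_proj_unit_cell)
    then obtain y where y: "y \<in> unit_cell" "torus_proj x = torus_proj y" by blast
    then have "f (y + (x - y)) = f y"
      using p unfolding periodic_def by (metis torus_proj_eq_lattice)
    then show ?thesis using B y(1) by simp
  qed
  then show ?thesis by (rule that)
qed

lemma smooth_differentiable: "smooth F \<Longrightarrow> F differentiable (at x)"
  unfolding smooth_def by (drule spec[of _ "[]"]) (simp add: differentiable_on_def)

lemma smooth_partial_deriv_continuous: "smooth F \<Longrightarrow> continuous_on UNIV (partial_deriv i F)"
  unfolding smooth_def by (drule spec[of _ "[i]"]) (simp add: differentiable_imp_continuous_on)

lemma periodic_factor:
  assumes "periodic F"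
  shows "(F \<circ> torus_rep) \<circ> torus_proj = F"
proof
  fix x
  have "torus_proj (torus_rep (torus_proj x)) = torus_proj x"
    by (rule Quotient3_abs_rep[OF Quotient3_torus3])
  then have "torus_rep (torus_proj x) - x \<in> lattice" by (simp add: torus_proj_eq_lattice)
  then have "F (x + (torus_rep (torus_proj x) - x)) = F x"
    using assms unfolding periodic_def by blast
  then show "((F \<circ> torus_rep) \<circ> torus_proj) x = F x" by simp
qed

lemma partial_deriv_torus:
  assumes "periodic F"
  shows "partial_deriv i F x = torus_deriv i (F \<circ> torus_rep) (torus_proj x)"
  by (simp only: torus_deriv_torus_proj periodic_factor[OF assms])

lemma periodic_partial_deriv:
  assumes "periodic F"
  shows "periodic (partial_deriv i F)"
  unfolding periodic_def by (simp add: partial_deriv_torus[OF assms] torus_proj_add_lattice)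

lemma cell_L2_bounded:
  assumes "f \<in> borel_measurable borel" "periodic f" "\<And>x. \<bar>f x\<bar> \<le> B"
  shows "cell_L2 f"
  using cell_L2_mult_bounded[OF cell_L2_const[of 1] assms] by simp

context cell_section
begin

lemma U_lattice_iff: "m \<in> lattice \<Longrightarrow> x + m \<in> U \<longleftrightarrow> x \<in> U"
  using U_lattice[of x m] U_lattice[of "x + m" "- m"] lattice_uminus[of m] by auto

lemma U_borel [measurable]: "U \<in> sets borel"
  using U_open by simp

text \<open>The coordinate \<open>s x $ j\<close> is a potential of the constant field \<open>axis j 1\<close> on \<open>U\<close>, but it need not
  be square integrable; these bounded potentials approximate it as \<open>c\<close> tends to 0.\<close>

definition sine_potential :: "3 \<Rightarrow> real \<Rightarrow> real^3 \<Rightarrow> real"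
  where "sine_potential j c x = (if x \<in> U then sin (c * s x $ j) / c else 0)"

definition sine_gradient :: "3 \<Rightarrow> real \<Rightarrow> 3 \<Rightarrow> real^3 \<Rightarrow> real"
  where "sine_gradient j c i x = (if x \<in> U \<and> i = j then cos (c * s x $ j) else 0)"

lemma s_continuous: "continuous_on U s"
proof (rule continuous_at_imp_continuous_on, rule ballI)
  fix x assume "x \<in> U"
  then obtain d where d: "d > 0" "\<And>y. y \<in> ball x d \<Longrightarrow> s y = y + (s x - x)"
    using s_local by blast
  have "\<forall>\<^sub>F y in nhds x. y \<in> ball x d"
    using d(1) by (intro eventually_nhds_in_open) simp_all
  then have "\<forall>\<^sub>F y in nhds x. s y = y + (s x - x)"
    by (rule eventually_mono) (rule d(2))
  then have "isCont s x \<longleftrightarrow> isCont (\<lambda>y. y + (s x - x)) x" by (rule isCont_cong)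
  then show "isCont s x" by (simp add: continuous_intros)
qed

lemma sine_potential_L2:
  assumes "c \<noteq> 0"
  shows "cell_L2 (sine_potential j c)"
proof (rule cell_L2_bounded[where B = "1 / \<bar>c\<bar>"])
  show "sine_potential j c \<in> borel_measurable borel"
    unfolding sine_potential_def[abs_def] 
    using \<open>c \<noteq> 0\<close>
    by (intro borel_measurable_continuous_on_if continuous_intros s_continuous) simp_all
  show "periodic (sine_potential j c)"
    by (simp add: periodic_def sine_potential_def U_lattice_iff s_periodic)
  show "\<bar>sine_potential j c x\<bar> \<le> 1 / \<bar>c\<bar>" for x
    by (simp add: sine_potential_def divide_right_mono)
qed

lemma sine_gradient_L2: "cell_L2 (sine_gradient j c i)"
proof (rule cell_L2_bounded[where B = 1])
  have "(\<lambda>x. if x \<in> U then (if i = j then cos (c * s x $ j) else 0) else 0) \<in> borel_measurable borel"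
    by (intro borel_measurable_continuous_on_if, simp, cases "i = j")
      (simp_all add: continuous_intros s_continuous)
  then show "sine_gradient j c i \<in> borel_measurable borel"
    by (rule measurable_cong[THEN iffD1, rotated]) (simp add: sine_gradient_def)
  show "periodic (sine_gradient j c i)"
    by (auto simp: periodic_def sine_gradient_def U_lattice_iff s_periodic)
  show "\<bar>sine_gradient j c i x\<bar> \<le> 1" for x
    by (simp add: sine_gradient_def)
qed

lemma sine_potential_gradient:
  assumes "c \<noteq> 0" and F: "F \<in> cell_test U"
  shows "(LINT x|lcell. partial_deriv i F x * sine_potential j c x) =
    - (LINT x|lcell. F x * sine_gradient j c i x)"
proof -
  let ?\<psi> = "sine_potential j c"
  obtain K where sm: "smooth F" and p: "periodic F" and K: "closed K" "K \<subseteq> U" "\<And>x. F x \<noteq> 0 \<Longrightarrow> x \<in> K"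
    using F unfolding cell_test_def by blast
  define D where "D x h = frechet_derivative F (at x) h * ?\<psi> x +
    F x * (if x \<in> U then cos (c * s x $ j) * h $ j else 0)" for x h
  have DF: "(F has_derivative frechet_derivative F (at x)) (at x)" for x
    using smooth_differentiable[OF sm] by (simp add: frechet_derivative_works)
  have Daxis: "D x (axis i 1) = partial_deriv i F x * ?\<psi> x + F x * sine_gradient j c i x" for x
    by (simp add: D_def partial_deriv_def sine_gradient_def axis_def)
  have H: "((\<lambda>x. F x * ?\<psi> x) has_derivative D x) (at x)" for x
  proof (cases "x \<in> U")
    case True
    then obtain d where d: "d > 0" "ball x d \<subseteq> U" "\<And>y. y \<in> ball x d \<Longrightarrow> s y = y + (s x - x)"
      using s_local by blast
    have "((\<lambda>y. sin (c * (y + (s x - x)) $ j) / c) has_derivative (\<lambda>h. cos (c * s x $ j) * h $ j)) (at x)"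
      using \<open>c \<noteq> 0\<close>
      by (auto intro!: derivative_eq_intros bounded_linear.has_derivative[OF bounded_linear_vec_nth])
    then have "(?\<psi> has_derivative (\<lambda>h. cos (c * s x $ j) * h $ j)) (at x)"
    proof (rule has_derivative_transform_within_open[where s = "ball x d"])
      fix y assume y: "y \<in> ball x d"
      then have "y \<in> U" using d(2) by blast
      then show "sin (c * (y + (s x - x)) $ j) / c = ?\<psi> y"
        unfolding sine_potential_def by (simp only: d(3)[OF y] if_True)
    qed (use d(1) in simp_all)
    from has_derivative_mult[OF DF this] show ?thesis
      by (rule has_derivative_eq_rhs) (use True in \<open>auto simp: D_def fun_eq_iff\<close>)
  next
    case False
    then have x: "x \<in> - K" using K by blast
    have F0: "F y = 0" if "y \<in> - K" for y using that K(3) by blast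
    have "((\<lambda>_. 0) has_derivative (\<lambda>_. 0)) (at x)" by simp
    then have "((\<lambda>x. F x * ?\<psi> x) has_derivative (\<lambda>_. 0)) (at x)"
      by (rule has_derivative_transform_within_open[where s = "- K"]) (use K(1) x F0 in auto)
    moreover have "D x = (\<lambda>_. 0)"
      using False by (simp add: D_def sine_potential_def fun_eq_iff)
    ultimately show ?thesis by simp
  qed
  have contF: "continuous_on UNIV F"
    using DF by (intro has_derivative_continuous_on) (auto intro: has_derivative_at_withinI)
  obtain B1 where B1: "\<And>x. \<bar>F x\<bar> \<le> B1" by (rule periodic_continuous_bounded[OF contF p]) blast
  obtain B2 where B2: "\<And>x. \<bar>partial_deriv i F x\<bar> \<le> B2"
    by (rule periodic_continuous_bounded[OF smooth_partial_deriv_continuous[OF sm] periodic_partial_deriv[OF p]]) blast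
  have \<psi>b: "\<bar>?\<psi> x\<bar> \<le> 1 / \<bar>c\<bar>" and gb: "\<bar>sine_gradient j c i x\<bar> \<le> 1" for x
    by (simp_all add: sine_potential_def sine_gradient_def divide_right_mono)
  have [measurable]: "F \<in> borel_measurable borel" "partial_deriv i F \<in> borel_measurable borel"
    "?\<psi> \<in> borel_measurable borel" "sine_gradient j c i \<in> borel_measurable borel"
    using contF smooth_partial_deriv_continuous[OF sm] sine_potential_L2[OF \<open>c \<noteq> 0\<close>] sine_gradient_L2
    by (auto intro: borel_measurable_continuous_onI cell_L2_borel)
  have "(LINT x|lcell. D x (axis i 1)) = 0"
  proof (rule integral_partial_eq_0[OF H])
    show "periodic (\<lambda>x. F x * ?\<psi> x)"
      using p cell_L2_periodic[OF sine_potential_L2[OF \<open>c \<noteq> 0\<close>]] by (simp add: periodic_def)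
    show "(\<lambda>x. D x (axis i 1)) \<in> borel_measurable borel" unfolding Daxis by measurable
    show "\<bar>D x (axis i 1)\<bar> \<le> B2 * (1 / \<bar>c\<bar>) + B1 * 1" for x
    proof -
      have "\<bar>D x (axis i 1)\<bar> \<le> \<bar>partial_deriv i F x\<bar> * \<bar>?\<psi> x\<bar> + \<bar>F x\<bar> * \<bar>sine_gradient j c i x\<bar>"
        unfolding Daxis abs_mult[symmetric] by (rule abs_triangle_ineq)
      also have "\<dots> \<le> B2 * (1 / \<bar>c\<bar>) + B1 * 1"
        using B1 B2 \<psi>b gb order_trans[OF abs_ge_zero B1] order_trans[OF abs_ge_zero B2]
        by (intro add_mono mult_mono) auto
      finally show ?thesis .
    qed
  qed
  moreover have "integrable lcell (\<lambda>x. partial_deriv i F x * ?\<psi> x)"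
    "integrable lcell (\<lambda>x. F x * sine_gradient j c i x)"
    by (subst mult.commute, rule integrable_mult_bounded[OF cell_L2_integrable[OF sine_potential_L2[OF \<open>c \<noteq> 0\<close>]] _ B2]; simp)
      (subst mult.commute, rule integrable_mult_bounded[OF cell_L2_integrable[OF sine_gradient_L2] _ B1]; simp)
  ultimately show ?thesis unfolding Daxis by simp
qed

end

section \<open>Linear structure of the function spaces\<close>

lemma borel_measurable_torus_measure [simp]: "borel_measurable torus_measure = borel_measurable borel"
  by (rule measurable_cong_sets) simp_all

lemma continuous_on_torusI:
  fixes f :: "torus3 \<Rightarrow> 'b::topological_space"
  assumes "continuous_on UNIV (f \<circ> torus_proj)"
  shows "continuous_on UNIV f"
  using assms by (simp add: continuous_on_open_vimage open_torus3_def vimage_comp o_def)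

lemma torus_continuous_bounded:
  fixes a :: "torus3 \<Rightarrow> real"
  assumes "continuous_on UNIV a"
  obtains B where "\<And>p. \<bar>a p\<bar> \<le> B"
proof -
  have "continuous_on UNIV (\<lambda>x. a (torus_proj x))"
    by (rule continuous_on_compose2[OF assms continuous_on_torus_proj]) simp
  then obtain B where B: "\<And>x. \<bar>a (torus_proj x)\<bar> \<le> B"
    by (rule periodic_continuous_bounded[OF _ periodic_torus_proj]) blast
  have "\<bar>a p\<bar> \<le> B" for p
    using B[of "torus_rep p"] Quotient3_abs_rep[OF Quotient3_torus3, of p] by simp
  then show ?thesis by (rule that)
qed

lemma test_function_smooth: "\<phi> \<in> test_functions V \<Longrightarrow> smooth (\<phi> \<circ> torus_proj)"
  by (simp add: test_functions_def)

lemma test_function_continuous: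
  assumes "\<phi> \<in> test_functions V"
  shows "continuous_on UNIV \<phi>"
  using smooth_differentiable[OF test_function_smooth[OF assms]]
  by (intro continuous_on_torusI differentiable_imp_continuous_on) (simp add: differentiable_on_def)

lemma torus_deriv_continuous:
  assumes "\<phi> \<in> test_functions V"
  shows "continuous_on UNIV (torus_deriv i \<phi>)"
proof (rule continuous_on_torusI)
  have "torus_deriv i \<phi> \<circ> torus_proj = partial_deriv i (\<phi> \<circ> torus_proj)"
    by (simp add: fun_eq_iff torus_deriv_torus_proj)
  then show "continuous_on UNIV (torus_deriv i \<phi> \<circ> torus_proj)"
    using smooth_partial_deriv_continuous[OF test_function_smooth[OF assms]] by simp
qed

lemma L2_spaceD:
  fixes u :: "torus3 \<Rightarrow> 'b::euclidean_space"
  assumes "u \<in> L2_space W"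
  shows "(\<lambda>p. indicator W p *\<^sub>R u p) \<in> borel_measurable borel"
    and "integrable torus_measure (\<lambda>p. (norm (indicator W p *\<^sub>R u p))\<^sup>2)"
proof -
  show m: "(\<lambda>p. indicator W p *\<^sub>R u p) \<in> borel_measurable borel"
    using assms by (simp add: L2_space_def set_borel_measurable_def)
  have "(norm (indicator W p *\<^sub>R u p))\<^sup>2 = indicator W p *\<^sub>R (norm (u p))\<^sup>2" for p
    by (simp add: indicator_def)
  then show "integrable torus_measure (\<lambda>p. (norm (indicator W p *\<^sub>R u p))\<^sup>2)"
    using assms by (simp add: L2_space_def set_integrable_def)
qed

lemma L2_spaceI:
  fixes u :: "torus3 \<Rightarrow> 'b::euclidean_space"
  assumes "(\<lambda>p. indicator W p *\<^sub>R u p) \<in> borel_measurable borel"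
    and "integrable torus_measure (\<lambda>p. (norm (indicator W p *\<^sub>R u p))\<^sup>2)"
  shows "u \<in> L2_space W"
proof -
  have "(norm (indicator W p *\<^sub>R u p))\<^sup>2 = indicator W p *\<^sub>R (norm (u p))\<^sup>2" for p
    by (simp add: indicator_def)
  then show ?thesis
    using assms
    by (simp add: L2_space_def set_integrable_def set_borel_measurable_def)
qed

lemma L2_space_subset:
  assumes "u \<in> L2_space UNIV" "W \<in> sets borel"
  shows "u \<in> L2_space W"
proof (rule L2_spaceI)
  have [measurable]: "u \<in> borel_measurable borel" "W \<in> sets borel"
    using L2_spaceD(1)[OF assms(1)] assms(2) by simp_all
  show "(\<lambda>p. indicator W p *\<^sub>R u p) \<in> borel_measurable borel" by measurable
  show "integrable torus_measure (\<lambda>p. (norm (indicator W p *\<^sub>R u p))\<^sup>2)"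
  proof (rule Bochner_Integration.integrable_bound)
    show "integrable torus_measure (\<lambda>p. (norm (u p))\<^sup>2)" using L2_spaceD(2)[OF assms(1)] by simp
  qed (auto simp: indicator_def)
qed

lemma L2_space_bounded_linear:
  fixes u :: "torus3 \<Rightarrow> 'b::euclidean_space" and T :: "'b \<Rightarrow> 'c::euclidean_space"
  assumes u: "u \<in> L2_space W" and T: "bounded_linear T"
  shows "(\<lambda>p. T (u p)) \<in> L2_space W"
proof (rule L2_spaceI)
  have eq: "indicator W p *\<^sub>R T (u p) = T (indicator W p *\<^sub>R u p)" for p
    using T by (simp add: linear_simps)
  note [measurable] = L2_spaceD(1)[OF u]
  have [measurable]: "T \<in> borel_measurable borel"
    using T by (intro borel_measurable_continuous_onI linear_continuous_on)
  show m: "(\<lambda>p. indicator W p *\<^sub>R T (u p)) \<in> borel_measurable borel"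
    unfolding eq by measurable
  obtain K where K: "\<And>x. norm (T x) \<le> norm x * K" using bounded_linear.bounded[OF T] by blast
  show "integrable torus_measure (\<lambda>p. (norm (indicator W p *\<^sub>R T (u p)))\<^sup>2)"
  proof (rule Bochner_Integration.integrable_bound)
    show "integrable torus_measure (\<lambda>p. (norm (indicator W p *\<^sub>R u p))\<^sup>2 * K\<^sup>2)"
      using L2_spaceD(2)[OF u] by simp
    have "(norm (T x))\<^sup>2 \<le> (norm x)\<^sup>2 * K\<^sup>2" for x
      using power_mono[OF K[of x], of 2] by (simp add: power_mult_distrib)
    then show "AE p in torus_measure. norm ((norm (indicator W p *\<^sub>R T (u p)))\<^sup>2) \<le>
        norm ((norm (indicator W p *\<^sub>R u p))\<^sup>2 * K\<^sup>2)"
      unfolding eq by (intro AE_I2) (simp del: norm_scaleR)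
    show "(\<lambda>p. (norm (indicator W p *\<^sub>R T (u p)))\<^sup>2) \<in> borel_measurable torus_measure"
      using m by measurable
  qed
qed

lemma L2_space_add:
  fixes u v :: "torus3 \<Rightarrow> 'b::euclidean_space"
  assumes u: "u \<in> L2_space W" and v: "v \<in> L2_space W"
  shows "(\<lambda>p. u p + v p) \<in> L2_space W"
proof (rule L2_spaceI)
  note [measurable] = L2_spaceD(1)[OF u] L2_spaceD(1)[OF v]
  show m: "(\<lambda>p. indicator W p *\<^sub>R (u p + v p)) \<in> borel_measurable borel"
    unfolding scaleR_add_right by measurable
  show "integrable torus_measure (\<lambda>p. (norm (indicator W p *\<^sub>R (u p + v p)))\<^sup>2)"
  proof (rule Bochner_Integration.integrable_bound)
    show "integrable torus_measure (\<lambda>p. 2 * (norm (indicator W p *\<^sub>R u p))\<^sup>2 + 2 * (norm (indicator W p *\<^sub>R v p))\<^sup>2)"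
      using L2_spaceD(2)[OF u] L2_spaceD(2)[OF v] by simp
    have "(norm (x + y))\<^sup>2 \<le> 2 * (norm x)\<^sup>2 + 2 * (norm y)\<^sup>2" for x y :: 'b
      by (rule order_trans[OF power_mono[OF norm_triangle_ineq norm_ge_zero] square_add_le])
    then show "AE p in torus_measure. norm ((norm (indicator W p *\<^sub>R (u p + v p)))\<^sup>2) \<le>
        norm (2 * (norm (indicator W p *\<^sub>R u p))\<^sup>2 + 2 * (norm (indicator W p *\<^sub>R v p))\<^sup>2)"
      unfolding scaleR_add_right by (intro AE_I2) (simp del: norm_scaleR)
    show "(\<lambda>p. (norm (indicator W p *\<^sub>R (u p + v p)))\<^sup>2) \<in> borel_measurable torus_measure"
      using m by measurable
  qed
qed

lemma L2_space_nth: "u \<in> L2_space W \<Longrightarrow> (\<lambda>p. u p $ i) \<in> L2_space W"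
  for u :: "torus3 \<Rightarrow> complex^3"
  by (rule L2_space_bounded_linear[OF _ bounded_linear_vec_nth])

lemma set_integrable_mult_L2:
  fixes w :: "torus3 \<Rightarrow> 'b::euclidean_space"
  assumes a: "continuous_on UNIV a" and w: "w \<in> L2_space W"
  shows "set_integrable torus_measure W (\<lambda>p. a p *\<^sub>R w p)"
proof -
  note [measurable] = L2_spaceD(1)[OF w]
  have [measurable]: "a \<in> borel_measurable borel" using a by (rule borel_measurable_continuous_onI)
  obtain B where B: "\<And>p. \<bar>a p\<bar> \<le> B" using torus_continuous_bounded[OF a] by blast
  have "integrable torus_measure (\<lambda>p. norm (indicator W p *\<^sub>R w p))"
    by (rule torus.square_integrable_imp_integrable[OF _ L2_spaceD(2)[OF w]]) measurable
  then have i: "integrable torus_measure (\<lambda>p. B * norm (indicator W p *\<^sub>R w p))"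
    by (rule integrable_mult_right)
  have eq: "indicator W p *\<^sub>R a p *\<^sub>R w p = a p *\<^sub>R indicator W p *\<^sub>R w p" for p
    by simp
  show ?thesis
    unfolding set_integrable_def eq
  proof (rule Bochner_Integration.integrable_bound[OF i])
    show "AE p in torus_measure. norm (a p *\<^sub>R indicator W p *\<^sub>R w p) \<le> norm (B * norm (indicator W p *\<^sub>R w p))"
    proof (rule AE_I2)
      fix p
      have "\<bar>a p\<bar> * norm (indicator W p *\<^sub>R w p) \<le> \<bar>B\<bar> * norm (indicator W p *\<^sub>R w p)"
        using B[of p] by (intro mult_right_mono) auto
      then show "norm (a p *\<^sub>R indicator W p *\<^sub>R w p) \<le> norm (B * norm (indicator W p *\<^sub>R w p))"
        by (simp add: abs_mult)
    qed
  qed measurable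
qed

lemma set_integral_lincomb:
  fixes f g :: "torus3 \<Rightarrow> complex"
  assumes "set_integrable M W f" "set_integrable M W g"
  shows "(LINT p:W|M. c * f p + g p) = c * (LINT p:W|M. f p) + (LINT p:W|M. g p)"
  using assms by (subst set_integral_add(2)) (simp_all only: set_integrable_mult_right set_integral_mult_right)

lemma bounded_linear_vector_scalar: "bounded_linear ((*s) c :: complex^3 \<Rightarrow> complex^3)"
proof -
  have "linear ((*s) c :: complex^3 \<Rightarrow> complex^3)"
    by (rule linearI) (auto simp: vec_eq_iff algebra_simps scaleR_conv_of_real)
  then show ?thesis by (simp add: linear_conv_bounded_linear)
qed

lemma has_L2_gradient_lincomb:
  assumes "has_L2_gradient W \<Theta> g" "has_L2_gradient W \<Theta>' g'" "\<Theta> \<in> L2_space W" "\<Theta>' \<in> L2_space W"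
  shows "has_L2_gradient W (\<lambda>p. c * \<Theta> p + \<Theta>' p) (\<lambda>p. c *s g p + g' p)"
proof -
  have g: "g \<in> L2_space W" "g' \<in> L2_space W" using assms by (auto simp: has_L2_gradient_def)
  have "(LINT p:W|torus_measure. torus_deriv i \<phi> p *\<^sub>R (c * \<Theta> p + \<Theta>' p)) =
      - (LINT p:W|torus_measure. \<phi> p *\<^sub>R ((c *s g p + g' p) $ i))" if \<phi>: "\<phi> \<in> test_functions W" for \<phi> i
  proof -
    note i1 = set_integrable_mult_L2[OF torus_deriv_continuous[OF \<phi>, of i] assms(3)]
      set_integrable_mult_L2[OF torus_deriv_continuous[OF \<phi>, of i] assms(4)]
      set_integrable_mult_L2[OF test_function_continuous[OF \<phi>] L2_space_nth[OF g(1), of i]]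
      set_integrable_mult_L2[OF test_function_continuous[OF \<phi>] L2_space_nth[OF g(2), of i]]
    have "(LINT p:W|torus_measure. torus_deriv i \<phi> p *\<^sub>R (c * \<Theta> p + \<Theta>' p)) =
        (LINT p:W|torus_measure. c * (torus_deriv i \<phi> p *\<^sub>R \<Theta> p) + torus_deriv i \<phi> p *\<^sub>R \<Theta>' p)"
      by (simp add: scaleR_add_right)
    also have "\<dots> = c * (LINT p:W|torus_measure. torus_deriv i \<phi> p *\<^sub>R \<Theta> p) +
        (LINT p:W|torus_measure. torus_deriv i \<phi> p *\<^sub>R \<Theta>' p)"
      by (intro set_integral_lincomb i1)
    also have "\<dots> = - (c * (LINT p:W|torus_measure. \<phi> p *\<^sub>R (g p $ i)) +
        (LINT p:W|torus_measure. \<phi> p *\<^sub>R (g' p $ i)))"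
      using assms(1,2) \<phi> by (simp add: has_L2_gradient_def)
    also have "c * (LINT p:W|torus_measure. \<phi> p *\<^sub>R (g p $ i)) + (LINT p:W|torus_measure. \<phi> p *\<^sub>R (g' p $ i)) =
        (LINT p:W|torus_measure. c * (\<phi> p *\<^sub>R (g p $ i)) + \<phi> p *\<^sub>R (g' p $ i))"
      by (intro set_integral_lincomb[symmetric] i1)
    also have "\<dots> = (LINT p:W|torus_measure. \<phi> p *\<^sub>R ((c *s g p + g' p) $ i))"
      by (simp add: scaleR_add_right)
    finally show ?thesis .
  qed
  moreover have "(\<lambda>p. c *s g p + g' p) \<in> L2_space W"
    by (intro L2_space_add L2_space_bounded_linear[OF _ bounded_linear_vector_scalar] g)
  ultimately show ?thesis unfolding has_L2_gradient_def by blast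
qed

lemma is_decomposition_lincomb:
  assumes "is_decomposition U u \<Theta> a" "is_decomposition U v \<Theta>' b"
  shows "is_decomposition U (\<lambda>p. c *s u p + v p) (\<lambda>p. c * \<Theta> p + \<Theta>' p) (c *s a + b)"
proof -
  let ?W = "torus_proj ` U"
  obtain g g' where g: "has_L2_gradient ?W \<Theta> g" "AE p in torus_measure. p \<in> ?W \<longrightarrow> u p = g p + a"
    and g': "has_L2_gradient ?W \<Theta>' g'" "AE p in torus_measure. p \<in> ?W \<longrightarrow> v p = g' p + b"
    and \<Theta>: "\<Theta> \<in> L2_space ?W" "\<Theta>' \<in> L2_space ?W"
    using assms unfolding is_decomposition_def H1_space_def by blast
  have grad: "has_L2_gradient ?W (\<lambda>p. c * \<Theta> p + \<Theta>' p) (\<lambda>p. c *s g p + g' p)"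
    by (rule has_L2_gradient_lincomb[OF g(1) g'(1) \<Theta>])
  moreover have "(\<lambda>p. c * \<Theta> p + \<Theta>' p) \<in> L2_space ?W"
    by (intro L2_space_add L2_space_bounded_linear[OF _ bounded_linear_mult_right] \<Theta>)
  moreover have "AE p in torus_measure. p \<in> ?W \<longrightarrow> c *s u p + v p = (c *s g p + g' p) + (c *s a + b)"
    using g(2) g'(2) by eventually_elim (auto simp: vector_add_ldistrib)
  ultimately show ?thesis unfolding is_decomposition_def H1_space_def by blast
qed

lemma is_decomposition_cong:
  assumes "is_decomposition U u \<Theta> a" "AE p in torus_measure. u p = v p"
  shows "is_decomposition U v \<Theta> a"
proof -
  obtain g where "has_L2_gradient (torus_proj ` U) \<Theta> g"
    "AE p in torus_measure. p \<in> torus_proj ` U \<longrightarrow> u p = g p + a"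
    using assms(1) unfolding is_decomposition_def by blast
  moreover from this(2) assms(2) have "AE p in torus_measure. p \<in> torus_proj ` U \<longrightarrow> v p = g p + a"
    by eventually_elim auto
  ultimately show ?thesis using assms(1) unfolding is_decomposition_def by blast
qed

lemma is_decomposition_zero: "is_decomposition U (\<lambda>p. 0) (\<lambda>p. 0) 0"
proof -
  have "has_L2_gradient (torus_proj ` U) (\<lambda>p. 0) (\<lambda>p. 0)"
    by (simp add: has_L2_gradient_def L2_spaceI)
  then show ?thesis
    unfolding is_decomposition_def H1_space_def by (auto simp: L2_spaceI)
qed

lemma weak_curl_free_lincomb:
  assumes u: "u \<in> L2_space W" "weak_curl_free W u" and v: "v \<in> L2_space W" "weak_curl_free W v"
  shows "weak_curl_free W (\<lambda>p. c *s u p + v p)"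
proof -
  have "(LINT p:W|torus_measure. torus_deriv i \<phi> p *\<^sub>R ((c *s u p + v p) $ j) -
      torus_deriv j \<phi> p *\<^sub>R ((c *s u p + v p) $ i)) =
    c * (LINT p:W|torus_measure. torus_deriv i \<phi> p *\<^sub>R (u p $ j) - torus_deriv j \<phi> p *\<^sub>R (u p $ i)) +
    (LINT p:W|torus_measure. torus_deriv i \<phi> p *\<^sub>R (v p $ j) - torus_deriv j \<phi> p *\<^sub>R (v p $ i))"
    if \<phi>: "\<phi> \<in> test_functions W" for \<phi> i j
  proof -
    have i: "set_integrable torus_measure W (\<lambda>p. torus_deriv i \<phi> p *\<^sub>R (w p $ j))" if "w \<in> L2_space W"
      for i j and w :: "torus3 \<Rightarrow> complex^3"
      by (rule set_integrable_mult_L2[OF torus_deriv_continuous[OF \<phi>] L2_space_nth[OF that]])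
    have "(LINT p:W|torus_measure. torus_deriv i \<phi> p *\<^sub>R ((c *s u p + v p) $ j) -
        torus_deriv j \<phi> p *\<^sub>R ((c *s u p + v p) $ i)) =
      (LINT p:W|torus_measure. c * (torus_deriv i \<phi> p *\<^sub>R (u p $ j) - torus_deriv j \<phi> p *\<^sub>R (u p $ i)) +
        (torus_deriv i \<phi> p *\<^sub>R (v p $ j) - torus_deriv j \<phi> p *\<^sub>R (v p $ i)))"
      by (simp add: algebra_simps)
    also have "\<dots> = c * (LINT p:W|torus_measure. torus_deriv i \<phi> p *\<^sub>R (u p $ j) - torus_deriv j \<phi> p *\<^sub>R (u p $ i)) +
      (LINT p:W|torus_measure. torus_deriv i \<phi> p *\<^sub>R (v p $ j) - torus_deriv j \<phi> p *\<^sub>R (v p $ i))"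
      by (intro set_integral_lincomb set_integral_diff(1) i u v)
    finally show ?thesis .
  qed
  then show ?thesis using u(2) v(2) by (simp add: weak_curl_free_def)
qed

lemma weak_div_free_lincomb:
  assumes u: "u \<in> L2_space W" "weak_div_free W u" and v: "v \<in> L2_space W" "weak_div_free W v"
  shows "weak_div_free W (\<lambda>p. c *s u p + v p)"
proof -
  have "(LINT p:W|torus_measure. (\<Sum>i\<in>UNIV. torus_deriv i \<phi> p *\<^sub>R ((c *s u p + v p) $ i))) = 0"
    if \<phi>: "\<phi> \<in> test_functions W" for \<phi>
  proof -
    have i: "set_integrable torus_measure W (\<lambda>p. \<Sum>i\<in>UNIV. torus_deriv i \<phi> p *\<^sub>R (w p $ i))" if "w \<in> L2_space W"
      for w :: "torus3 \<Rightarrow> complex^3"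
      unfolding set_integrable_def scaleR_sum_right
      by (rule Bochner_Integration.integrable_sum)
        (rule set_integrable_mult_L2[unfolded set_integrable_def, OF torus_deriv_continuous[OF \<phi>] L2_space_nth[OF that]])
    have "(LINT p:W|torus_measure. (\<Sum>i\<in>UNIV. torus_deriv i \<phi> p *\<^sub>R ((c *s u p + v p) $ i))) =
        (LINT p:W|torus_measure. c * (\<Sum>i\<in>UNIV. torus_deriv i \<phi> p *\<^sub>R (u p $ i)) +
          (\<Sum>i\<in>UNIV. torus_deriv i \<phi> p *\<^sub>R (v p $ i)))"
      by (simp add: scaleR_add_right sum.distrib sum_distrib_left)
    also have "\<dots> = c * (LINT p:W|torus_measure. (\<Sum>i\<in>UNIV. torus_deriv i \<phi> p *\<^sub>R (u p $ i))) +
        (LINT p:W|torus_measure. (\<Sum>i\<in>UNIV. torus_deriv i \<phi> p *\<^sub>R (v p $ i)))"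
      by (intro set_integral_lincomb i u v)
    finally show ?thesis using u(2) v(2) \<phi> by (simp add: weak_div_free_def)
  qed
  then show ?thesis by (simp add: weak_div_free_def)
qed

lemma open_image_outer_cell: "open (torus_proj ` outer_cell \<Sigma>)"
  unfolding image_outer_cell by (intro open_Compl closed_closure)

lemma cell_solution_lincomb:
  assumes u: "cell_solution \<Sigma> u" and v: "cell_solution \<Sigma> v"
  shows "cell_solution \<Sigma> (\<lambda>p. c *s u p + v p)"
proof -
  let ?W = "torus_proj ` outer_cell \<Sigma>"
  have L2: "u \<in> L2_space UNIV" "v \<in> L2_space UNIV"
    using u v by (auto simp: cell_solution_def torus_proj_unit_cell)
  have L2W: "u \<in> L2_space ?W" "v \<in> L2_space ?W"
    using L2 by (simp_all add: L2_space_subset borel_open open_image_outer_cell)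
  have "(\<lambda>p. c *s u p + v p) \<in> L2_space UNIV"
    by (intro L2_add L2_scale L2)
  moreover have "weak_curl_free ?W (\<lambda>p. c *s u p + v p)"
    using u v L2W by (intro weak_curl_free_lincomb) (auto simp: cell_solution_def)
  moreover have "weak_div_free UNIV (\<lambda>p. c *s u p + v p)"
    using u v L2 by (intro weak_div_free_lincomb) (auto simp: cell_solution_def torus_proj_unit_cell)
  moreover have "AE p in torus_measure. p \<in> torus_proj ` \<Sigma> \<longrightarrow> u p = 0"
    "AE p in torus_measure. p \<in> torus_proj ` \<Sigma> \<longrightarrow> v p = 0"
    using u v by (auto simp: cell_solution_def)
  then have "AE p in torus_measure. p \<in> torus_proj ` \<Sigma> \<longrightarrow> c *s u p + v p = 0"
    by eventually_elim auto
  ultimately show ?thesis by (simp add: cell_solution_def torus_proj_unit_cell)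
qed

lemma cell_solution_zero: "cell_solution \<Sigma> (\<lambda>p. 0)"
  by (simp add: cell_solution_def weak_curl_free_def weak_div_free_def L2_spaceI)

section \<open>The cell problem without loops\<close>

lemma AE_cell_torusD: "(AE p in torus_measure. P p) \<Longrightarrow> (AE x in lcell. P (torus_proj x))"
  unfolding torus_measure_eq by (rule AE_distrD[of torus_proj lcell borel P]) simp_all

lemma L2_space_component_cell_L2:
  assumes w: "w \<in> L2_space W" and l: "bounded_linear (l :: complex \<Rightarrow> real)"
  shows "cell_L2 (\<lambda>x. indicator W (torus_proj x) * l (w (torus_proj x)))"
proof -
  let ?h = "\<lambda>p. indicator W p *\<^sub>R l (w p)"
  have h: "(\<lambda>p. l (w p)) \<in> L2_space W" by (rule L2_space_bounded_linear[OF w l])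
  have [measurable]: "?h \<in> borel_measurable borel" by (rule L2_spaceD(1)[OF h])
  have "integrable torus_measure (\<lambda>p. (norm (?h p))\<^sup>2)" by (rule L2_spaceD(2)[OF h])
  moreover have "(\<lambda>p. (norm (?h p))\<^sup>2) \<in> borel_measurable borel" by measurable
  ultimately have "integrable lcell (\<lambda>x. (norm (?h (torus_proj x)))\<^sup>2)"
    by (rule integrable_torus_measure[THEN iffD1, rotated])
  moreover have "(\<lambda>x. ?h (torus_proj x)) \<in> borel_measurable borel" by measurable
  ultimately show ?thesis
    using periodic_torus_proj[of ?h] by (simp add: cell_L2_def power_mult_distrib)
qed

lemma set_integral_component:
  assumes a: "continuous_on UNIV a" and w: "w \<in> L2_space W" and l: "bounded_linear (l :: complex \<Rightarrow> real)"
  shows "l (LINT p:W|torus_measure. a p *\<^sub>R w p) =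
    (LINT x|lcell. a (torus_proj x) * (indicator W (torus_proj x) * l (w (torus_proj x))))"
proof -
  have "(\<lambda>p. l (w p)) \<in> L2_space W" by (rule L2_space_bounded_linear[OF w l])
  note [measurable] = L2_spaceD(1)[OF this] borel_measurable_continuous_onI[OF a]
  have "l (LINT p:W|torus_measure. a p *\<^sub>R w p) =
      (LINT p|torus_measure. l (indicator W p *\<^sub>R (a p *\<^sub>R w p)))"
    using set_integrable_mult_L2[OF a w] unfolding set_integrable_def set_lebesgue_integral_def
    by (rule integral_bounded_linear[OF l, symmetric])
  also have "\<dots> = (LINT p|torus_measure. a p * (indicator W p *\<^sub>R l (w p)))"
    using l by (simp add: linear_simps mult_ac)
  also have "\<dots> = (LINT x|lcell. a (torus_proj x) * (indicator W (torus_proj x) *\<^sub>R l (w (torus_proj x))))"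
    by (rule integral_torus_measure) measurable
  finally show ?thesis by simp
qed

lemma test_functions_UNIV_I: "smooth F \<Longrightarrow> periodic F \<Longrightarrow> F \<circ> torus_rep \<in> test_functions UNIV"
  by (simp add: test_functions_def periodic_factor)

lemma test_functionsI:
  assumes F: "F \<in> cell_test (torus_proj -` W)"
  shows "F \<circ> torus_rep \<in> test_functions W"
proof -
  obtain K where sm: "smooth F" and p: "periodic F" and K: "closed K" "K \<subseteq> torus_proj -` W"
    "\<And>x m. x \<in> K \<Longrightarrow> m \<in> lattice \<Longrightarrow> x + m \<in> K" "\<And>x. F x \<noteq> 0 \<Longrightarrow> x \<in> K"
    using F unfolding cell_test_def by blast
  have "torus_proj -` (torus_proj ` K) = K"
  proof (intro equalityI subsetI)
    fix x assume "x \<in> torus_proj -` (torus_proj ` K)"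
    then obtain y where y: "y \<in> K" "torus_proj x = torus_proj y" by blast
    then have "y + (x - y) \<in> K" by (intro K(3)) (simp_all add: torus_proj_eq_lattice)
    then show "x \<in> K" by simp
  qed blast
  then have "open (- (torus_proj ` K))"
    using K(1) by (simp add: open_torus3_def vimage_Compl closed_def)
  then have "closed (torus_proj ` K)" by (simp add: closed_def)
  moreover have "{p. (F \<circ> torus_rep) p \<noteq> 0} \<subseteq> torus_proj ` K"
  proof
    fix q assume "q \<in> {p. (F \<circ> torus_rep) p \<noteq> 0}"
    then have "torus_rep q \<in> K" using K(4) by simp
    moreover have "q = torus_proj (torus_rep q)"
      by (rule Quotient3_abs_rep[OF Quotient3_torus3, symmetric])
    ultimately show "q \<in> torus_proj ` K" by blast
  qed
  ultimately have "closure {p. (F \<circ> torus_rep) p \<noteq> 0} \<subseteq> torus_proj ` K" by (intro closure_minimal)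
  also have "\<dots> \<subseteq> W" using K(2) by blast
  finally show ?thesis using sm p by (simp add: test_functions_def periodic_factor)
qed

lemma cell_div_free:
  assumes u: "u \<in> L2_space UNIV" "weak_div_free UNIV u" and l: "bounded_linear (l :: complex \<Rightarrow> real)"
    and F: "smooth F" "periodic F"
  shows "(LINT x|lcell. (\<Sum>i\<in>UNIV. l (u (torus_proj x) $ i) * partial_deriv i F x)) = 0"
proof -
  let ?\<phi> = "F \<circ> torus_rep"
  have \<phi>: "?\<phi> \<in> test_functions UNIV" using F by (rule test_functions_UNIV_I)
  have pd: "torus_deriv i ?\<phi> (torus_proj x) = partial_deriv i F x" for i x
    by (rule partial_deriv_torus[OF F(2), symmetric])
  have ui: "(\<lambda>p. u p $ i) \<in> L2_space UNIV" for i using u(1) by (rule L2_space_nth)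
  have i: "set_integrable torus_measure UNIV (\<lambda>p. torus_deriv i ?\<phi> p *\<^sub>R (u p $ i))" for i
    by (rule set_integrable_mult_L2[OF torus_deriv_continuous[OF \<phi>] ui])
  have ci: "integrable lcell (\<lambda>x. l (u (torus_proj x) $ i) * partial_deriv i F x)" for i
  proof -
    have L: "cell_L2 (\<lambda>x. indicator UNIV (torus_proj x) * l (u (torus_proj x) $ i))"
      by (rule L2_space_component_cell_L2[OF ui l])
    obtain B where "\<And>x. \<bar>partial_deriv i F x\<bar> \<le> B"
      by (rule periodic_continuous_bounded[OF smooth_partial_deriv_continuous[OF F(1)] periodic_partial_deriv[OF F(2)]]) blast
    then show ?thesis
      using cell_L2_integrable[OF L] borel_measurable_continuous_onI[OF smooth_partial_deriv_continuous[OF F(1)]]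
      by (intro integrable_mult_bounded) simp_all
  qed
  have "0 = l (\<Sum>i\<in>UNIV. (LINT p:UNIV|torus_measure. torus_deriv i ?\<phi> p *\<^sub>R (u p $ i)))"
  proof -
    have "(LINT p:UNIV|torus_measure. (\<Sum>i\<in>UNIV. torus_deriv i ?\<phi> p *\<^sub>R (u p $ i))) =
        (\<Sum>i\<in>UNIV. (LINT p:UNIV|torus_measure. torus_deriv i ?\<phi> p *\<^sub>R (u p $ i)))"
      unfolding set_lebesgue_integral_def scaleR_sum_right
      using i unfolding set_integrable_def by (rule Bochner_Integration.integral_sum)
    then show ?thesis using u(2) \<phi> l by (simp add: weak_div_free_def linear_simps)
  qed
  also have "\<dots> = (\<Sum>i\<in>UNIV. l (LINT p:UNIV|torus_measure. torus_deriv i ?\<phi> p *\<^sub>R (u p $ i)))"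
    using l by (rule linear_sum[OF bounded_linear.linear])
  also have "\<dots> = (\<Sum>i\<in>UNIV. LINT x|lcell. l (u (torus_proj x) $ i) * partial_deriv i F x)"
    by (simp add: set_integral_component[OF torus_deriv_continuous[OF \<phi>] ui l] pd mult.commute)
  also have "\<dots> = (LINT x|lcell. (\<Sum>i\<in>UNIV. l (u (torus_proj x) $ i) * partial_deriv i F x))"
    using ci by (intro Bochner_Integration.integral_sum[symmetric])
  finally show ?thesis by simp
qed

lemma cell_gradient:
  assumes \<Theta>: "\<Theta> \<in> L2_space W" "has_L2_gradient W \<Theta> g" and l: "bounded_linear (l :: complex \<Rightarrow> real)"
    and F: "F \<in> cell_test (torus_proj -` W)"
  shows "(LINT x|lcell. partial_deriv i F x * (indicator W (torus_proj x) * l (\<Theta> (torus_proj x)))) =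
    - (LINT x|lcell. F x * (indicator W (torus_proj x) * l (g (torus_proj x) $ i)))"
proof -
  let ?\<phi> = "F \<circ> torus_rep"
  have \<phi>: "?\<phi> \<in> test_functions W" using F by (rule test_functionsI)
  have p: "periodic F" using F by (simp add: cell_test_def)
  have pd: "torus_deriv i ?\<phi> (torus_proj x) = partial_deriv i F x" for i x
    by (rule partial_deriv_torus[OF p, symmetric])
  have \<phi>F: "?\<phi> (torus_proj x) = F x" for x
    using periodic_factor[OF p] by (simp add: fun_eq_iff)
  have g: "(\<lambda>p. g p $ i) \<in> L2_space W"
    using \<Theta>(2) by (intro L2_space_nth) (simp add: has_L2_gradient_def)
  have "(LINT x|lcell. partial_deriv i F x * (indicator W (torus_proj x) * l (\<Theta> (torus_proj x)))) =
      l (LINT p:W|torus_measure. torus_deriv i ?\<phi> p *\<^sub>R \<Theta> p)"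
    by (simp only: set_integral_component[OF torus_deriv_continuous[OF \<phi>] \<Theta>(1) l] pd)
  also have "\<dots> = l (- (LINT p:W|torus_measure. ?\<phi> p *\<^sub>R (g p $ i)))"
    using \<Theta>(2) \<phi> unfolding has_L2_gradient_def by simp
  also have "\<dots> = - l (LINT p:W|torus_measure. ?\<phi> p *\<^sub>R (g p $ i))"
    using l by (simp add: linear_simps)
  also have "\<dots> = - (LINT x|lcell. F x * (indicator W (torus_proj x) * l (g (torus_proj x) $ i)))"
    by (simp only: set_integral_component[OF test_function_continuous[OF \<phi>] g l] \<phi>F)
  finally show ?thesis .
qed

lemma div_free_mean_eq_0:
  fixes u :: "3 \<Rightarrow> real^3 \<Rightarrow> real"
  assumes sec: "cell_section U s"
    and pair: "\<And>c. c \<noteq> 0 \<Longrightarrow>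
      div_free_pairing S U u (cell_section.sine_gradient U s j c) (cell_section.sine_potential U s j c)"
  shows "(LINT x|lcell. u j x * indicator U x) = 0"
proof -
  interpret cell_section U s by (rule sec)
  have uL: "cell_L2 (u j)" by (rule div_free_pairing.u_L2[OF pair[of 1]]) simp
  have [measurable]: "u j \<in> borel_measurable borel" using uL by (rule cell_L2_borel)
  let ?c = "\<lambda>n. inverse (real (Suc n))"
  have "(LINT x|lcell. u j x * sine_gradient j c j x) = 0" if "c \<noteq> 0" for c
  proof -
    have "(\<Sum>i\<in>UNIV. u i x * sine_gradient j c i x) = u j x * sine_gradient j c j x" for x
    proof -
      have "u i x * sine_gradient j c i x = (if i = j then u j x * sine_gradient j c j x else 0)" for i
        by (simp add: sine_gradient_def)
      then have "(\<Sum>i\<in>UNIV. u i x * sine_gradient j c i x) =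
          (\<Sum>i\<in>UNIV. if i = j then u j x * sine_gradient j c j x else 0)"
        by (rule sum.cong[OF refl])
      then show ?thesis by simp
    qed
    then show ?thesis using div_free_pairing.pairing_eq_0[OF pair[OF that]] by simp
  qed
  then have "(LINT x|lcell. u j x * sine_gradient j (?c n) j x) = 0" for n by simp
  moreover have "(\<lambda>n. LINT x|lcell. u j x * sine_gradient j (?c n) j x) \<longlonglongrightarrow>
      (LINT x|lcell. u j x * indicator U x)"
  proof (rule integral_dominated_convergence)
    show "integrable lcell (\<lambda>x. \<bar>u j x\<bar>)" using cell_L2_integrable[OF uL] by simp
    show "AE x in lcell. (\<lambda>n. u j x * sine_gradient j (?c n) j x) \<longlonglongrightarrow> u j x * indicator U x"
    proof (rule AE_I2, cases)
      fix x assume x: "x \<in> U"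
      have "(\<lambda>n. cos (?c n * s x $ j)) \<longlonglongrightarrow> cos (0 * s x $ j)"
        by (intro tendsto_intros LIMSEQ_inverse_real_of_nat)
      then have "(\<lambda>n. u j x * cos (?c n * s x $ j)) \<longlonglongrightarrow> u j x * cos (0 * s x $ j)"
        by (rule tendsto_mult[OF tendsto_const])
      then show "(\<lambda>n. u j x * sine_gradient j (?c n) j x) \<longlonglongrightarrow> u j x * indicator U x"
        using x by (simp add: sine_gradient_def)
    qed (simp add: sine_gradient_def)
    show "AE x in lcell. norm (u j x * sine_gradient j (?c n) j x) \<le> \<bar>u j x\<bar>" for n
      by (intro AE_I2) (simp add: sine_gradient_def abs_mult mult_left_le)
    show "(\<lambda>x. u j x * sine_gradient j (?c n) j x) \<in> borel_measurable lcell" for n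
      using cell_L2_borel[OF sine_gradient_L2, of j "?c n" j] by simp
  qed simp
  ultimately have "(\<lambda>n::nat. 0) \<longlonglongrightarrow> (LINT x|lcell. u j x * indicator U x)" by (simp only:)
  then show ?thesis by (simp add: LIMSEQ_const_iff)
qed

lemma cell_solution_component_eq_0:
  assumes V: "open (torus_proj ` \<Sigma>)" "lipschitz_boundary (torus_proj ` \<Sigma>)"
    and no_loops: "loop_directions (outer_cell \<Sigma>) = {}"
    and u: "cell_solution \<Sigma> u" and dec: "is_decomposition (outer_cell \<Sigma>) u \<Theta> c\<^sub>0"
    and l: "bounded_linear (l :: complex \<Rightarrow> real)"
  shows "AE x in lcell. \<forall>i. l (u (torus_proj x) $ i) = 0"
proof -
  define V where "V = torus_proj ` \<Sigma>"
  define W where "W = - closure V"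
  have W: "torus_proj ` outer_cell \<Sigma> = W" by (simp add: W_def V_def image_outer_cell)
  let ?S = "torus_proj -` V" and ?U = "torus_proj -` W"
  define ur where "ur i x = l (u (torus_proj x) $ i)" for i x
  have uL2: "u \<in> L2_space UNIV" and udiv: "weak_div_free UNIV u"
    and u0: "AE p in torus_measure. p \<in> V \<longrightarrow> u p = 0"
    using u by (auto simp: cell_solution_def torus_proj_unit_cell V_def)
  obtain g where \<Theta>: "\<Theta> \<in> L2_space W" and g: "has_L2_gradient W \<Theta> g"
    and ug: "AE p in torus_measure. p \<in> W \<longrightarrow> u p = g p + c\<^sub>0"
    using dec unfolding is_decomposition_def H1_space_def W by blast
  define gr where "gr i x = indicator W (torus_proj x) * l (g (torus_proj x) $ i)" for i x
  define \<psi> where "\<psi> x = indicator W (torus_proj x) * l (\<Theta> (torus_proj x))" for x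
  have ur_L2: "cell_L2 (ur i)" for i
    using L2_space_component_cell_L2[OF L2_space_nth[OF uL2] l, of i] by (simp add: ur_def[abs_def])
  have gr_L2: "cell_L2 (gr i)" for i
    using g L2_space_component_cell_L2[OF L2_space_nth l] by (simp add: gr_def[abs_def] has_L2_gradient_def)
  have \<psi>_L2: "cell_L2 \<psi>"
    unfolding \<psi>_def[abs_def] by (rule L2_space_component_cell_L2[OF \<Theta> l])
  have ur_0: "AE x in lcell. x \<in> ?S \<longrightarrow> ur i x = 0" for i
    using AE_cell_torusD[OF u0] by eventually_elim (use l in \<open>auto simp: ur_def linear_simps\<close>)
  have pairing: "div_free_pairing ?S ?U ur h \<eta>"
    if "\<And>i. cell_L2 (h i)" "cell_L2 \<eta>" "\<And>F i. F \<in> cell_test ?U \<Longrightarrow>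
      (LINT x|lcell. partial_deriv i F x * \<eta> x) = - (LINT x|lcell. F x * h i x)" for h \<eta>
  proof
    show "\<exists>d>0. pushes_into ?S ?U a d" for a
      unfolding W_def using V by (intro lipschitz_boundary_pushes) (simp_all add: V_def)
    show "(LINT x|lcell. (\<Sum>i\<in>UNIV. ur i x * partial_deriv i F x)) = 0" if "smooth F" "periodic F" for F
      unfolding ur_def by (rule cell_div_free[OF uL2 udiv l that])
  qed (use that ur_L2 ur_0 in \<open>simp_all add: torus_proj_add_lattice\<close>)
  have "div_free_pairing ?S ?U ur gr \<psi>"
    using cell_gradient[OF \<Theta> g l] by (intro pairing gr_L2 \<psi>_L2) (simp add: gr_def \<psi>_def)
  then have p1: "(LINT x|lcell. (\<Sum>i\<in>UNIV. ur i x * gr i x)) = 0"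
    by (rule div_free_pairing.pairing_eq_0)
  have U_open: "open ?U" unfolding W_def by (intro open_vimage_torus_proj open_Compl closed_closure)
  have U_lat: "x + m \<in> ?U" if "x \<in> ?U" "m \<in> lattice" for x m
    using that by (simp add: torus_proj_add_lattice)
  have free: "m = 0" if "m \<in> lattice" "connected_component ?U x (x + m)" for x m
    using no_loops_free[of "outer_cell \<Sigma>" m x] that no_loops open_image_outer_cell[of \<Sigma>, unfolded W]
    by (simp add: W)
  have "\<exists>s. cell_section ?U s"
    by (rule lattice_section[OF U_open]) (use U_lat free in blast)+
  then obtain s where sec: "cell_section ?U s" by blast
  have p2: "(LINT x|lcell. ur j x * indicator ?U x) = 0" for j
    by (rule div_free_mean_eq_0[OF sec pairing])
      (simp_all add: cell_section.sine_gradient_L2[OF sec] cell_section.sine_potential_L2[OF sec]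
        cell_section.sine_potential_gradient[OF sec])
  have "negligible (torus_proj -` frontier V)"
    using V by (intro frontier_negligible) (simp_all add: V_def)
  then have "AE x in lebesgue. x \<notin> torus_proj -` frontier V"
    by (intro AE_not_in) (simp add: negligible_iff_null_sets)
  then have fr: "AE x in lcell. torus_proj x \<notin> frontier V"
    by (intro AE_lcell) (simp add: AE_completion_iff)
  have sq: "AE x in lcell. (\<Sum>i\<in>UNIV. ur i x * gr i x) +
      (\<Sum>i\<in>UNIV. l (c\<^sub>0 $ i) * (ur i x * indicator ?U x)) = (\<Sum>i\<in>UNIV. (ur i x)\<^sup>2)"
    using fr AE_cell_torusD[OF u0] AE_cell_torusD[OF ug]
  proof eventually_elim
    case (elim x)
    consider "torus_proj x \<in> V" | "torus_proj x \<in> W"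
      using elim(1) V(1) by (auto simp: W_def V_def frontier_def interior_open)
    then show ?case
    proof cases
      case 1
      then have "ur i x = 0" for i using elim(2) l by (simp add: ur_def linear_simps)
      then show ?thesis by simp
    next
      case 2
      then have "ur i x = gr i x + l (c\<^sub>0 $ i)" for i
        using elim(3) l by (simp add: ur_def gr_def linear_simps)
      then have "(ur i x)\<^sup>2 = ur i x * gr i x + l (c\<^sub>0 $ i) * (ur i x * indicator ?U x)" for i
        using 2 by (simp add: power2_eq_square algebra_simps)
      then show ?thesis by (simp add: sum.distrib)
    qed
  qed
  have [measurable]: "ur i \<in> borel_measurable borel" "gr i \<in> borel_measurable borel" "?U \<in> sets borel" for i
    using ur_L2 gr_L2 U_open by (auto intro: cell_L2_borel)
  have i1: "integrable lcell (\<lambda>x. ur i x * gr i x)" for i by (rule cell_L2_mult_integrable[OF ur_L2 gr_L2])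
  have i2: "integrable lcell (\<lambda>x. ur i x * indicator ?U x)" for i
  proof (rule integrable_mult_bounded[OF cell_L2_integrable[OF ur_L2]])
    show "(indicator ?U :: real^3 \<Rightarrow> real) \<in> borel_measurable lcell" by measurable
    show "\<bar>indicator ?U x :: real\<bar> \<le> 1" for x by (simp add: indicator_def)
  qed
  have i3: "integrable lcell (\<lambda>x. (ur i x)\<^sup>2)" for i by (rule cell_L2_square[OF ur_L2])
  have "(LINT x|lcell. (\<Sum>i\<in>UNIV. (ur i x)\<^sup>2)) = (LINT x|lcell. (\<Sum>i\<in>UNIV. ur i x * gr i x) +
      (\<Sum>i\<in>UNIV. l (c\<^sub>0 $ i) * (ur i x * indicator ?U x)))"
    using sq by (intro integral_cong_AE[symmetric]) simp_all
  also have "\<dots> = 0"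
    using i1 i2 p1 p2 by (simp del: integral_indicator)
  finally have "AE x in lcell. (\<Sum>i\<in>UNIV. (ur i x)\<^sup>2) = 0"
    using i3 integral_nonneg_eq_0_iff_AE[of lcell "\<lambda>x. \<Sum>i\<in>UNIV. (ur i x)\<^sup>2"] by (simp add: sum_nonneg)
  then show ?thesis
    by eventually_elim (simp add: sum_nonneg_eq_0_iff ur_def)
qed

lemma cell_solution_no_loops_eq_0:
  assumes V: "open (torus_proj ` \<Sigma>)" "lipschitz_boundary (torus_proj ` \<Sigma>)"
    and no_loops: "loop_directions (outer_cell \<Sigma>) = {}"
    and u: "cell_solution \<Sigma> u" and dec: "is_decomposition (outer_cell \<Sigma>) u \<Theta> c\<^sub>0"
  shows "AE p in torus_measure. u p = 0"
proof -
  have [measurable]: "u \<in> borel_measurable borel"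
    using u L2_spaceD(1)[of u UNIV] by (simp add: cell_solution_def torus_proj_unit_cell)
  have "AE x in lcell. \<forall>i. Re (u (torus_proj x) $ i) = 0"
    by (rule cell_solution_component_eq_0[OF V no_loops u dec bounded_linear_Re])
  moreover have "AE x in lcell. \<forall>i. Im (u (torus_proj x) $ i) = 0"
    by (rule cell_solution_component_eq_0[OF V no_loops u dec bounded_linear_Im])
  ultimately have "AE x in lcell. u (torus_proj x) = 0"
    by eventually_elim (simp add: vec_eq_iff complex_eq_iff)
  then show ?thesis by (subst AE_torus_measure) simp_all
qed

section \<open>The solution space\<close>

lemma cell_solution_sum:
  assumes "finite A" "\<And>k. k \<in> A \<Longrightarrow> cell_solution \<Sigma> (f k)"
  shows "cell_solution \<Sigma> (\<lambda>p. \<Sum>k\<in>A. a k *s f k p)"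
  using assms by (induction A rule: finite_induct) (simp_all add: cell_solution_zero cell_solution_lincomb)

lemma is_decomposition_sum:
  assumes "finite A" "\<And>k. k \<in> A \<Longrightarrow> is_decomposition U (f k) (\<Theta> k) (b k)"
  shows "is_decomposition U (\<lambda>p. \<Sum>k\<in>A. a k *s f k p) (\<lambda>p. \<Sum>k\<in>A. a k * \<Theta> k p) (\<Sum>k\<in>A. a k *s b k)"
  using assms by (induction A rule: finite_induct) (simp_all add: is_decomposition_zero is_decomposition_lincomb)

text \<open>Any field with a geometric average makes the average of every decomposable field well defined:
  adding the difference of two decompositions to one of its own decompositions does not change it.\<close>

lemma decomposition_unique:
  assumes avg: "has_geometric_average U h a" and k: "k \<in> loop_directions U"
    and dec: "is_decomposition U u \<Theta> b" "is_decomposition U u \<Theta>' c"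
  shows "b $ k = c $ k"
proof -
  obtain \<Xi> d where d: "is_decomposition U h \<Xi> d" using avg by (auto simp: has_geometric_average_def)
  have "is_decomposition U (\<lambda>p. (- 1) *s u p + u p) (\<lambda>p. (- 1) * \<Theta> p + \<Theta>' p) ((- 1) *s b + c)"
    by (rule is_decomposition_lincomb[OF dec])
  from is_decomposition_lincomb[OF this d, of 1]
  have "is_decomposition U h (\<lambda>p. 1 * ((- 1) * \<Theta> p + \<Theta>' p) + \<Xi> p) (1 *s ((- 1) *s b + c) + d)"
    by (rule is_decomposition_cong) simp
  then have "a = (\<chi> k. if k \<in> loop_directions U then (1 *s ((- 1) *s b + c) + d) $ k else 0)"
    using avg unfolding has_geometric_average_def by blast
  moreover have "a = (\<chi> k. if k \<in> loop_directions U then d $ k else 0)"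
    using avg d unfolding has_geometric_average_def by blast
  ultimately have "(\<chi> k. if k \<in> loop_directions U then (1 *s ((- 1) *s b + c) + d) $ k else 0) $ k =
      (\<chi> k. if k \<in> loop_directions U then d $ k else 0) $ k" by (simp only:)
  then show ?thesis using k by (simp add: vector_add_component vector_smult_component)
qed

lemma has_geometric_average_I:
  assumes avg: "\<And>k. k \<in> loop_directions U \<Longrightarrow> \<exists>h a. has_geometric_average U h a"
    and dec: "is_decomposition U u \<Theta> c"
  shows "has_geometric_average U u (\<chi> k. if k \<in> loop_directions U then c $ k else 0)"
  unfolding has_geometric_average_def
proof (intro conjI allI impI)
  show "\<exists>\<Theta> c. is_decomposition U u \<Theta> c" using dec by blast
  fix \<Theta>' b assume b: "is_decomposition U u \<Theta>' b"
  have "c $ k = b $ k" if "k \<in> loop_directions U" for k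
    using avg[OF that] decomposition_unique[OF _ that dec b] by blast
  then show "(\<chi> k. if k \<in> loop_directions U then c $ k else 0) =
      (\<chi> k. if k \<in> loop_directions U then b $ k else 0)"
    by (simp add: vec_eq_iff)
qed

lemma L2_class_eq_iff:
  assumes "u \<in> L2_space UNIV" "v \<in> L2_space UNIV"
  shows "L2_class u = L2_class v \<longleftrightarrow> (AE p in torus_measure. u p = v p)"
  using Quotient3_rel[OF Quotient3_L2_field, of u v] assms by auto

lemma L2_class_lincomb:
  assumes "u \<in> L2_space UNIV" "v \<in> L2_space UNIV"
  shows "L2_class (\<lambda>p. c *s u p + v p) = scale_L2 c (L2_class u) + L2_class v"
  using assms by (simp add: scale_L2.abs_eq plus_L2_field.abs_eq eq_onp_def L2_scale)

lemma L2_class_zero: "L2_class (\<lambda>p. 0) = 0"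
  by (simp add: zero_L2_field.abs_eq zero_L2_field_def)

lemma L2_class_sum:
  assumes "finite A" "\<And>k. k \<in> A \<Longrightarrow> f k \<in> L2_space UNIV"
  shows "(\<lambda>p. \<Sum>k\<in>A. a k *s f k p) \<in> L2_space UNIV \<and>
    L2_class (\<lambda>p. \<Sum>k\<in>A. a k *s f k p) = (\<Sum>k\<in>A. scale_L2 (a k) (L2_class (f k)))"
  using assms
proof (induction A rule: finite_induct)
  case empty
  show ?case by (simp add: L2_class_zero L2_zero)
next
  case (insert k A)
  then show ?case by (simp add: L2_class_lincomb L2_add L2_scale)
qed

lemma cell_solution_L2: "cell_solution \<Sigma> u \<Longrightarrow> u \<in> L2_space UNIV"
  by (simp add: cell_solution_def torus_proj_unit_cell)

lemma cell_solution_decomposition: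
  assumes "simple_Helmholtz_domain (outer_cell \<Sigma>)" and u: "cell_solution \<Sigma> u"
  obtains \<Theta> c where "is_decomposition (outer_cell \<Sigma>) u \<Theta> c"
proof -
  have "u \<in> L2_space (torus_proj ` outer_cell \<Sigma>)"
    by (rule L2_space_subset[OF cell_solution_L2[OF u] borel_open[OF open_image_outer_cell]])
  moreover have "weak_curl_free (torus_proj ` outer_cell \<Sigma>) u"
    using u by (simp add: cell_solution_def)
  ultimately show ?thesis using assms(1) that unfolding simple_Helmholtz_domain_def by blast
qed

lemma subspace_solution_space: "L2.subspace (solution_space \<Sigma>)"
proof (rule L2.subspaceI)
  show "0 \<in> solution_space \<Sigma>"
    unfolding solution_space_def using cell_solution_zero L2_class_zero by (metis image_eqI mem_Collect_eq)
next
  fix x y assume "x \<in> solution_space \<Sigma>" "y \<in> solution_space \<Sigma>"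
  then obtain u v where u: "cell_solution \<Sigma> u" "x = L2_class u" and v: "cell_solution \<Sigma> v" "y = L2_class v"
    by (auto simp: solution_space_def)
  have "x + y = L2_class (\<lambda>p. 1 *s u p + v p)"
    using u v by (simp only: L2_class_lincomb cell_solution_L2 L2.scale_one)
  then show "x + y \<in> solution_space \<Sigma>"
    unfolding solution_space_def using cell_solution_lincomb[OF u(1) v(1)] by blast
next
  fix c x assume "x \<in> solution_space \<Sigma>"
  then obtain u where u: "cell_solution \<Sigma> u" "x = L2_class u" by (auto simp: solution_space_def)
  have "scale_L2 c x = L2_class (\<lambda>p. c *s u p + 0)"
    using L2_class_lincomb[OF cell_solution_L2[OF u(1)] L2_zero, of c] u(2) by (simp add: L2_class_zero)
  then show "scale_L2 c x \<in> solution_space \<Sigma>"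
    unfolding solution_space_def using cell_solution_lincomb[OF u(1) cell_solution_zero] by blast
qed

theorem proposition3p8:
  fixes \<Sigma> :: "(real^3) set" and H :: "3 \<Rightarrow> torus3 \<Rightarrow> complex^3"
  assumes "\<Sigma> \<subseteq> unit_cell" and "\<Sigma> \<noteq> {}"
    and "open (torus_proj ` \<Sigma>)" and "lipschitz_boundary (torus_proj ` \<Sigma>)"
    and "simple_Helmholtz_domain (outer_cell \<Sigma>)"
    and "\<And>k. k \<in> loop_directions (outer_cell \<Sigma>) \<Longrightarrow> unique_cell_solution \<Sigma> (axis k 1) (H k)"
  shows "(\<forall>u. cell_solution \<Sigma> u \<longrightarrow>
           (\<exists>\<alpha> :: complex^3. has_geometric_average (outer_cell \<Sigma>) u \<alpha> \<and>
             (AE p in torus_measure.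
                u p = (\<Sum>k \<in> loop_directions (outer_cell \<Sigma>). (\<alpha> $ k) *s H k p)))) \<and>
         L2.dim (solution_space \<Sigma>) = card (loop_directions (outer_cell \<Sigma>))"
proof -
  let ?U = "outer_cell \<Sigma>"
  define L where "L = loop_directions ?U"
  have H: "cell_solution \<Sigma> (H k)" and H_avg: "has_geometric_average ?U (H k) (axis k 1)"
    and H_unique: "\<And>v. cell_solution \<Sigma> v \<Longrightarrow> has_geometric_average ?U v (axis k 1) \<Longrightarrow>
      AE p in torus_measure. v p = H k p" if "k \<in> L" for k
    using assms(6)[of k] that by (auto simp: L_def unique_cell_solution_def)
  have avg_ex: "\<exists>h a. has_geometric_average ?U h a" if "k \<in> loop_directions ?U" for k
    using H_avg[of k] that by (auto simp: L_def)
  note avgI = has_geometric_average_I[OF avg_ex, folded L_def]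
  have "\<exists>\<Xi> d. is_decomposition ?U (H k) \<Xi> d" if "k \<in> L" for k
    using H_avg[OF that] unfolding has_geometric_average_def by blast
  then obtain \<Xi> d where \<Xi>: "\<And>k. k \<in> L \<Longrightarrow> is_decomposition ?U (H k) (\<Xi> k) (d k)" by metis
  have d: "d k $ j = (if j = k then 1 else 0)" if "k \<in> L" "j \<in> L" for k j
  proof -
    have "axis k 1 = (\<chi> k'. if k' \<in> L then d k $ k' else 0)"
      using H_avg[OF that(1)] \<Xi>[OF that(1)] unfolding has_geometric_average_def L_def by blast
    then have "axis k 1 $ j = (\<chi> k'. if k' \<in> L then d k $ k' else 0) $ j" by (simp only:)
    then show ?thesis using that(2) by (simp add: axis_def)
  qed
  have d_sum: "(\<Sum>k\<in>L. a k *s d k) $ j = a j" if "j \<in> L" for a j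
  proof -
    have "(\<Sum>k\<in>L. a k *s d k) $ j = (\<Sum>k\<in>L. if k = j then a j else 0)"
      unfolding sum_component by (rule sum.cong[OF refl]) (simp add: d that)
    also have "\<dots> = a j" using that by simp
    finally show ?thesis .
  qed
  have vanish: "AE p in torus_measure. v p = 0"
    if v: "cell_solution \<Sigma> v" and dec: "is_decomposition ?U v \<Theta> c" and c: "\<And>j. j \<in> L \<Longrightarrow> c $ j = 0" for v \<Theta> c
  proof (cases "L = {}")
    case True
    then show ?thesis using cell_solution_no_loops_eq_0[OF assms(3,4) _ v dec] by (simp add: L_def)
  next
    case False
    then obtain k where k: "k \<in> L" by blast
    have "has_geometric_average ?U (\<lambda>p. 1 *s v p + H k p)
        (\<chi> j. if j \<in> L then (1 *s c + d k) $ j else 0)"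
      by (rule avgI[OF _ is_decomposition_lincomb[OF dec \<Xi>[OF k]]])
    moreover have "(\<chi> j. if j \<in> L then (1 *s c + d k) $ j else 0) = axis k 1"
      using k by (simp add: vec_eq_iff axis_def c d)
    ultimately have "AE p in torus_measure. 1 *s v p + H k p = H k p"
      using H_unique[OF k cell_solution_lincomb[OF v H[OF k], of 1]] by simp
    then show ?thesis by eventually_elim simp
  qed
  have repr: "AE p in torus_measure. u p = (\<Sum>k\<in>L. (c $ k) *s H k p)"
    if u: "cell_solution \<Sigma> u" and dec: "is_decomposition ?U u \<Theta> c" for u \<Theta> c
  proof -
    let ?h = "\<lambda>p. \<Sum>k\<in>L. (c $ k) *s H k p"
    have "cell_solution \<Sigma> (\<lambda>p. (- 1) *s ?h p + u p)"
      by (intro cell_solution_lincomb cell_solution_sum u) (auto intro: H)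
    moreover have "is_decomposition ?U (\<lambda>p. (- 1) *s ?h p + u p)
        (\<lambda>p. (- 1) * (\<Sum>k\<in>L. c $ k * \<Xi> k p) + \<Theta> p) ((- 1) *s (\<Sum>k\<in>L. c $ k *s d k) + c)"
      by (intro is_decomposition_lincomb is_decomposition_sum dec) (auto intro: \<Xi>)
    moreover have "((- 1) *s (\<Sum>k\<in>L. c $ k *s d k) + c) $ j = 0" if "j \<in> L" for j
      using d_sum[OF that, of "\<lambda>k. c $ k"] by simp
    ultimately have "AE p in torus_measure. (- 1) *s ?h p + u p = 0" by (rule vanish)
    then show ?thesis by eventually_elim (simp add: eq_neg_iff_add_eq_0 add.commute)
  qed
  have part1: "\<exists>\<alpha>. has_geometric_average ?U u \<alpha> \<and>
      (AE p in torus_measure. u p = (\<Sum>k\<in>L. (\<alpha> $ k) *s H k p))" if u: "cell_solution \<Sigma> u" for u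
  proof -
    obtain \<Theta> c where dec: "is_decomposition ?U u \<Theta> c"
      by (rule cell_solution_decomposition[OF assms(5) u])
    let ?\<alpha> = "\<chi> k. if k \<in> L then c $ k else 0"
    have "(\<Sum>k\<in>L. (?\<alpha> $ k) *s H k p) = (\<Sum>k\<in>L. (c $ k) *s H k p)" for p
      by (rule sum.cong[OF refl]) simp
    then show ?thesis using avgI[OF _ dec] repr[OF u dec] by (intro exI[of _ ?\<alpha>]) simp
  qed
  have indep: "a j = 0" if j: "j \<in> L" and 0: "AE p in torus_measure. (\<Sum>k\<in>L. a k *s H k p) = 0" for a j
  proof -
    have "is_decomposition ?U (\<lambda>p. \<Sum>k\<in>L. a k *s H k p) (\<lambda>p. \<Sum>k\<in>L. a k * \<Xi> k p) (\<Sum>k\<in>L. a k *s d k)"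
      by (rule is_decomposition_sum) (auto intro: \<Xi>)
    then have "is_decomposition ?U (\<lambda>p. 0) (\<lambda>p. \<Sum>k\<in>L. a k * \<Xi> k p) (\<Sum>k\<in>L. a k *s d k)"
      using 0 by (rule is_decomposition_cong)
    then have "(\<Sum>k\<in>L. a k *s d k) $ j = 0 $ j"
      using decomposition_unique[OF H_avg[OF j] j[unfolded L_def] _ is_decomposition_zero] by blast
    then show ?thesis using d_sum[OF j] by simp
  qed
  let ?b = "\<lambda>k. L2_class (H k)"
  have class_sum: "(\<lambda>p. \<Sum>k\<in>L. a k *s H k p) \<in> L2_space UNIV"
    "L2_class (\<lambda>p. \<Sum>k\<in>L. a k *s H k p) = (\<Sum>k\<in>L. scale_L2 (a k) (?b k))" for a
    using L2_class_sum[of L H a] cell_solution_L2[OF H] by auto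
  have indep': "a j = 0" if j: "j \<in> L" and "(\<Sum>k\<in>L. scale_L2 (a k) (?b k)) = 0" for a j
    using that(2) class_sum[of a] L2_class_eq_iff[OF class_sum(1)[of a] L2_zero] indep[OF j]
    by (simp add: L2_class_zero)
  have inj: "inj_on ?b L"
  proof (rule inj_onI, rule ccontr)
    fix i j assume ij: "i \<in> L" "j \<in> L" "?b i = ?b j" "i \<noteq> j"
    have "(\<Sum>k\<in>L. scale_L2 (if k = i then 1 else if k = j then - 1 else 0) (?b k)) =
        (\<Sum>k\<in>L. (if k = i then ?b i else 0) - (if k = j then ?b j else 0))"
      using ij(4) by (intro sum.cong) auto
    also have "\<dots> = 0" using ij by (simp add: sum_subtractf)
    finally have "(if i = i then 1 else if i = j then - 1 else 0 :: complex) = 0" by (rule indep'[OF ij(1)])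
    then show False by simp
  qed
  have "L2.independent (?b ` L)"
  proof (rule L2.independent_if_scalars_zero)
    fix f x assume 0: "(\<Sum>x\<in>?b ` L. scale_L2 (f x) x) = 0" and x: "x \<in> ?b ` L"
    obtain j where j: "j \<in> L" "x = ?b j" using x by blast
    have "(\<Sum>k\<in>L. scale_L2 (f (?b k)) (?b k)) = 0"
      using 0 by (simp add: sum.reindex[OF inj])
    then show "f x = 0" using indep'[OF j(1), of "\<lambda>k. f (?b k)"] j(2) by simp
  qed simp
  moreover have "L2.span (?b ` L) = solution_space \<Sigma>"
  proof
    show "L2.span (?b ` L) \<subseteq> solution_space \<Sigma>"
      using H by (intro L2.span_minimal subspace_solution_space) (auto simp: solution_space_def)
    show "solution_space \<Sigma> \<subseteq> L2.span (?b ` L)"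
    proof
      fix x assume "x \<in> solution_space \<Sigma>"
      then obtain u where u: "cell_solution \<Sigma> u" "x = L2_class u" by (auto simp: solution_space_def)
      obtain \<alpha> where "AE p in torus_measure. u p = (\<Sum>k\<in>L. (\<alpha> $ k) *s H k p)" using part1[OF u(1)] by blast
      then have "x = (\<Sum>k\<in>L. scale_L2 (\<alpha> $ k) (?b k))"
        using L2_class_eq_iff[OF cell_solution_L2[OF u(1)] class_sum(1)[of "\<lambda>k. \<alpha> $ k"]] class_sum(2) u(2) by simp
      also have "\<dots> \<in> L2.span (?b ` L)"
        by (intro L2.span_sum L2.span_scale L2.span_base) blast
      finally show "x \<in> L2.span (?b ` L)" .
    qed
  qed
  then have "L2.span (?b ` L) = L2.span (solution_space \<Sigma>)"
    using L2.span_eq_iff subspace_solution_space by metis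
  ultimately have "L2.dim (solution_space \<Sigma>) = card (?b ` L)"
    by (intro L2.dim_eq_card)
  then show ?thesis using part1 card_image[OF inj] unfolding L_def by simp
qed

end
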